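(* Let $f$ be the germ at the origin of a real-analytic, symplectic, planar map, having an elliptic fixed point at the origin with irrational rotation number $\omega_0\in(0,\tfrac12)$. Suppose $f$ admits a real-analytic first integral $I_1:U\to\mathbb{R}$, $U$ a neighbourhood of the origin, with a non-degenerate local minimum at $(0,0)$. Then $f$ is real-analytically, symplectically, conjugate to its non-resonant Birkhoff normal form $$f_{\mathrm{NF}}(w,\bar w)=w\exp\left(i\left[2\pi\omega_0+\sum_{k=1}^{\infty}\gamma_k|w|^{2k}\right]\right),\qquad \gamma_k\in\mathbb{R}.$$
   Context: A real-analytic planar map germ $f$ with $f(0,0)=(0,0)$ has an elliptic fixed point at the origin with rotation number $\omega_0\in(0,\tfrac12)$ if the eigenvalues of its linear part $L=d_{(0,0)}f$ are $\mu=e^{i2\pi\omega_0}$ and $\bar\mu$. The plane is identified with $\mathbb{C}$ via $z=x+iy$, and it is assumed that in this coordinate $L(z)=\mu z$. Symplectic means preserving the form $dx\wedge dy$ (equivalently $\frac{i}{2}dz\wedge d\bar z$). The non-resonant Birkhoff normal form of $f$ is the (a priori formal) map of the displayed form to which $f$ is conjugated by a formal symplectic change of coordinates tangent to the identity. A first integral of $f$ is a function $I$ defined in a neighbourhood of the origin with $I\circ f=I$ near the origin. A non-degenerate local minimum at $(0,0)$ means a critical point there with positive definite Hessian. Two germs $f,g$ fixing the origin are real-analytically, symplectically, conjugate if there is a germ of real-analytic diffeomorphism $\phi$ fixing the origin and preserving $dx\wedge dy$ with $\phi^{-1}\circ f\circ\phi=g$. *)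

theory Defs
  imports "HOL-Analysis.Analysis" "HOL-Computational_Algebra.Formal_Power_Series"
begin

text \<open>
  The plane is \<^typ>\<open>complex\<close>, with \<open>z = x + iy\<close>. A germ at the origin is represented by a total
  function on the plane of which only the values near \<open>0\<close> are ever used.
\<close>

section \<open>Real-analytic and symplectic germs\<close>

definition real_analytic_at :: "(complex \<Rightarrow> 'a::real_normed_vector) \<Rightarrow> complex \<Rightarrow> bool" where
  "real_analytic_at f p \<longleftrightarrow>
     (\<exists>c :: nat \<Rightarrow> nat \<Rightarrow> 'a. \<exists>r>0. \<forall>x y. \<bar>x\<bar> < r \<longrightarrow> \<bar>y\<bar> < r \<longrightarrow>
        ((\<lambda>(m, n). (x ^ m * y ^ n) *\<^sub>R c m n) has_sum f (p + Complex x y)) UNIV)"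

definition area_form :: "complex \<Rightarrow> complex \<Rightarrow> real" where
  "area_form u v = Re u * Im v - Im u * Re v"

definition symplectic_germ :: "(complex \<Rightarrow> complex) \<Rightarrow> bool" where
  "symplectic_germ f \<longleftrightarrow>
     (\<forall>\<^sub>F z in nhds 0. \<exists>D. (f has_derivative D) (at z) \<and>
        (\<forall>u v. area_form (D u) (D v) = area_form u v))"

text \<open>
  Multiplication by \<open>\<mu> = e\<^bsup>2\<pi>i\<omega>\<^esup>\<close> is the real linear map of the plane with eigenvalues \<open>\<mu>\<close> and its
  conjugate, in the coordinate in which the linear part is in its normal form.
\<close>

definition elliptic_fixed_point :: "(complex \<Rightarrow> complex) \<Rightarrow> real \<Rightarrow> bool" where
  "elliptic_fixed_point f \<omega> \<longleftrightarrow>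
     f 0 = 0 \<and> 0 < \<omega> \<and> \<omega> < 1/2 \<and>
     (f has_derivative (\<lambda>z. exp (\<i> * of_real (2 * pi * \<omega>)) * z)) (at 0)"

definition first_integral_on :: "complex set \<Rightarrow> (complex \<Rightarrow> complex) \<Rightarrow> (complex \<Rightarrow> real) \<Rightarrow> bool" where
  "first_integral_on U f I \<longleftrightarrow>
     open U \<and> 0 \<in> U \<and> (\<forall>\<^sub>F z in nhds 0. z \<in> U \<and> f z \<in> U \<and> I (f z) = I z)"

text \<open>\<open>D z\<close> is the differential of \<open>I\<close> at \<open>z\<close>, and \<open>H\<close> the Hessian bilinear form at \<open>p\<close>.\<close>

definition nondegenerate_local_min :: "(complex \<Rightarrow> real) \<Rightarrow> complex \<Rightarrow> bool" where
  "nondegenerate_local_min I p \<longleftrightarrow>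
     (\<exists>D H. (\<forall>\<^sub>F z in nhds p. (I has_derivative D z) (at z)) \<and>
            (\<forall>v. D p v = 0) \<and>
            (\<forall>v. ((\<lambda>z. D z v) has_derivative (\<lambda>u. H u v)) (at p)) \<and>
            (\<forall>v. v \<noteq> 0 \<longrightarrow> H v v > 0))"

definition analytically_symplectically_conjugate ::
  "(complex \<Rightarrow> complex) \<Rightarrow> (complex \<Rightarrow> complex) \<Rightarrow> bool" where
  "analytically_symplectically_conjugate f g \<longleftrightarrow>
     (\<exists>\<phi> \<psi>. real_analytic_at \<phi> 0 \<and> \<phi> 0 = 0 \<and> symplectic_germ \<phi> \<and>
            real_analytic_at \<psi> 0 \<and> \<psi> 0 = 0 \<and>
            (\<forall>\<^sub>F z in nhds 0. \<psi> (\<phi> z) = z) \<and> (\<forall>\<^sub>F z in nhds 0. \<phi> (\<psi> z) = z) \<and>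
            (\<forall>\<^sub>F z in nhds 0. \<psi> (f (\<phi> z)) = g z))"

section \<open>Formal maps of the plane\<close>

text \<open>
  A formal map of the plane is a formal power series in \<open>z\<close> and its conjugate \<open>z'\<close> with complex
  coefficients. It is encoded as \<open>A :: complex fps fps\<close>: the outer variable is \<open>z\<close> and the inner one
  \<open>z'\<close>, so that \<open>coeff2 A m n\<close> is the coefficient of \<open>z\<^sup>m z'\<^sup>n\<close>.
\<close>

type_synonym fps2 = "complex fps fps"

definition coeff2 :: "fps2 \<Rightarrow> nat \<Rightarrow> nat \<Rightarrow> complex" where
  "coeff2 A m n = fps_nth (fps_nth A m) n"

definition Abs_fps2 :: "(nat \<Rightarrow> nat \<Rightarrow> complex) \<Rightarrow> fps2" where
  "Abs_fps2 a = Abs_fps (\<lambda>m. Abs_fps (a m))"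

definition cnj2 :: "fps2 \<Rightarrow> fps2" where
  "cnj2 A = Abs_fps2 (\<lambda>m n. cnj (coeff2 A n m))"

text \<open>
  The series \<open>A(P, Q)\<close>, for \<open>P\<close> and \<open>Q\<close> without constant term. Under that condition \<open>P\<^sup>m Q\<^sup>n\<close> only
  has terms of total degree at least \<open>m + n\<close>, so cutting the sum off at \<open>i + j\<close> loses nothing.
\<close>

definition subst2 :: "fps2 \<Rightarrow> fps2 \<Rightarrow> fps2 \<Rightarrow> fps2" where
  "subst2 A P Q =
     Abs_fps2 (\<lambda>i j. \<Sum>m\<le>i+j. \<Sum>n\<le>i+j. coeff2 A m n * coeff2 (P ^ m * Q ^ n) i j)"

definition formal_comp :: "fps2 \<Rightarrow> fps2 \<Rightarrow> fps2" where
  "formal_comp A P = subst2 A P (cnj2 P)"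

definition deriv_z :: "fps2 \<Rightarrow> fps2" where
  "deriv_z A = Abs_fps2 (\<lambda>m n. of_nat (Suc m) * coeff2 A (Suc m) n)"

definition deriv_zbar :: "fps2 \<Rightarrow> fps2" where
  "deriv_zbar A = Abs_fps2 (\<lambda>m n. of_nat (Suc n) * coeff2 A m (Suc n))"

text \<open>The pull-back of \<open>dz \<and> dz'\<close> by \<open>A\<close> is the left-hand side times \<open>dz \<and> dz'\<close>.\<close>

definition formal_symplectic :: "fps2 \<Rightarrow> bool" where
  "formal_symplectic A \<longleftrightarrow>
     deriv_z A * deriv_zbar (cnj2 A) - deriv_zbar A * deriv_z (cnj2 A) = 1"

definition formal_tangent_to_id :: "fps2 \<Rightarrow> bool" where
  "formal_tangent_to_id A \<longleftrightarrow> coeff2 A 0 0 = 0 \<and> coeff2 A 1 0 = 1 \<and> coeff2 A 0 1 = 0"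

definition has_expansion2 :: "(complex \<Rightarrow> complex) \<Rightarrow> fps2 \<Rightarrow> bool" where
  "has_expansion2 f A \<longleftrightarrow>
     (\<forall>\<^sub>F z in nhds 0. ((\<lambda>(m, n). coeff2 A m n * z ^ m * cnj z ^ n) has_sum f z) UNIV)"

section \<open>The Birkhoff normal form\<close>

text \<open>
  The coefficients are \<open>\<gamma> 1, \<gamma> 2, \<dots>\<close>; the value \<open>\<gamma> 0\<close> plays no role. The formal normal form is
  \<open>e\<^bsup>2\<pi>i\<omega>\<^esup> w E(w w')\<close>, where \<open>E(t)\<close> is the formal exponential of \<open>i \<Sum>\<^bsub>k \<ge> 1\<^esub> \<gamma>\<^sub>k t\<^sup>k\<close>.
\<close>

definition formal_normal_form :: "real \<Rightarrow> (nat \<Rightarrow> real) \<Rightarrow> fps2" where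
  "formal_normal_form \<omega> \<gamma> =
     (let E = fps_compose (fps_exp \<i>) (Abs_fps (\<lambda>k. if k = 0 then 0 else complex_of_real (\<gamma> k)))
      in Abs_fps2 (\<lambda>m n. if m = Suc n then exp (\<i> * of_real (2 * pi * \<omega>)) * fps_nth E n else 0))"

text \<open>
  A change of coordinates tangent to the identity is formally invertible, so the last equation says
  that \<open>\<Phi>\<close> conjugates \<open>f\<close> to the normal form.
\<close>

definition birkhoff_normal_form_of :: "(complex \<Rightarrow> complex) \<Rightarrow> real \<Rightarrow> (nat \<Rightarrow> real) \<Rightarrow> bool" where
  "birkhoff_normal_form_of f \<omega> \<gamma> \<longleftrightarrow>
     (\<exists>F \<Phi>. has_expansion2 f F \<and> formal_tangent_to_id \<Phi> \<and> formal_symplectic \<Phi> \<and>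
            formal_comp F \<Phi> = formal_comp \<Phi> (formal_normal_form \<omega> \<gamma>))"

definition normal_form_convergent :: "(nat \<Rightarrow> real) \<Rightarrow> bool" where
  "normal_form_convergent \<gamma> \<longleftrightarrow>
     (\<forall>\<^sub>F w :: complex in nhds 0. summable (\<lambda>k. \<gamma> (Suc k) * norm w ^ (2 * Suc k)))"

definition normal_form_map :: "real \<Rightarrow> (nat \<Rightarrow> real) \<Rightarrow> complex \<Rightarrow> complex" where
  "normal_form_map \<omega> \<gamma> w =
     w * exp (\<i> * of_real (2 * pi * \<omega> + (\<Sum>k. \<gamma> (Suc k) * norm w ^ (2 * Suc k))))"

end

theory Submission
  imports Defs "HOL-Complex_Analysis.Complex_Analysis"
begin

text \<open>
  By the analytic Morse lemma there is a coordinate \<open>M\<close> in which \<open>I\<^sub>1\<close> is, up to a constant, the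
  squared distance to the origin. The area form in this coordinate is brought back to the standard
  one by a change of coordinates that preserves the circles around the origin as a family; its
  angular part solves a linear equation without small divisors, so it converges. Conjugated by the
  resulting symplectic coordinate, \<open>f\<close> preserves every small circle and the area, hence is
  \<open>z \<mapsto> z exp (i \<theta>)\<close> with \<open>\<theta>\<close> a function of \<open>|z|\<^sup>2\<close>: a convergent normal form. Since \<open>\<omega>\<^sub>0\<close> is
  irrational, a formal symplectic map tangent to the identity that conjugates two normal forms
  commutes with rotations, and its symplecticity forces the two normal forms to agree. Thus the
  formal normal form is the convergent one.

  Real-analytic germs are handled as restrictions to \<open>z' = cnj z\<close> of holomorphic germs in two
  variables, which by Osgood's lemma are the \<open>C\<^sup>1\<close> germs with complex-linear derivative; closure
  under composition and inversion then follows from the chain rule and the inverse function theorem.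
\<close>

section \<open>Formal power series in two variables\<close>

text \<open>The usual construction of the normal form divides by differences of powers of \<mu> =
  e^(2 pi i \<omega>), which can be arbitrarily small, so its convergence cannot be read off from
  it. The first integral avoids this: the linear equations solved here only have the divisors m - n
  and n + 1, which are integers. Since \<open>birkhoff_normal_form_of\<close> speaks of formal
  changes of coordinates only, a convergent normal form settles the claim only together with
  uniqueness at the formal level. There the conjugacy equation between two normal forms is nonlinear
  in the unknown change X. The product of X and its conjugate is treated first, since it satisfies a
  linear equation; knowing it makes the equation for X linear. Irrationality enters as non-resonance
  of \<mu>: in the uniqueness proof, and as \<mu>^2 \<noteq> 1, which makes the quadratic part of
  the first integral a multiple of |z|^2. Hence the Morse coordinate is tangent to a multiple of the
  identity, and the symplectic coordinate built from it is tangent to the identity, as the normal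
  form requires.\<close>

lemma coeff2_Abs_fps2 [simp]: "coeff2 (Abs_fps2 a) m n = a m n"
  by (simp add: coeff2_def Abs_fps2_def)

lemma fps2_eqI: "(\<And>m n. coeff2 A m n = coeff2 B m n) \<Longrightarrow> A = B"
  by (auto simp: coeff2_def fps_eq_iff)

lemma coeff2_add [simp]: "coeff2 (A + B) m n = coeff2 A m n + coeff2 B m n"
  and coeff2_diff [simp]: "coeff2 (A - B) m n = coeff2 A m n - coeff2 B m n"
  and coeff2_uminus [simp]: "coeff2 (- A) m n = - coeff2 A m n"
  and coeff2_0 [simp]: "coeff2 0 m n = 0"
  and coeff2_sum: "coeff2 (sum F S) m n = (\<Sum>x\<in>S. coeff2 (F x) m n)"
  by (simp_all add: coeff2_def fps_sum_nth)

lemma coeff2_1: "coeff2 1 m n = (if m = 0 \<and> n = 0 then 1 else 0)"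
  by (simp add: coeff2_def)

lemma coeff2_mult: "coeff2 (A * B) m n = (\<Sum>i\<le>m. \<Sum>j\<le>n. coeff2 A i j * coeff2 B (m - i) (n - j))"
  by (simp add: coeff2_def fps_mult_nth fps_sum_nth atLeast0AtMost)

definition const2 :: "complex \<Rightarrow> fps2" where
  "const2 c = fps_const (fps_const c)"

definition var_z :: fps2 where "var_z = fps_X"

definition var_zbar :: fps2 where "var_zbar = fps_const fps_X"

lemma coeff2_const2: "coeff2 (const2 c) m n = (if m = 0 \<and> n = 0 then c else 0)"
  by (simp add: coeff2_def const2_def)

lemma coeff2_var_z: "coeff2 var_z m n = (if m = 1 \<and> n = 0 then 1 else 0)"
  by (simp add: coeff2_def var_z_def fps_X_def)

lemma coeff2_var_zbar: "coeff2 var_zbar m n = (if m = 0 \<and> n = 1 then 1 else 0)"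
  by (simp add: coeff2_def var_zbar_def fps_X_def)

lemma coeff2_const2_mult [simp]: "coeff2 (const2 c * A) m n = c * coeff2 A m n"
  by (simp add: coeff2_def const2_def)

lemma coeff2_var_z_mult: "coeff2 (var_z * A) m n = (if m = 0 then 0 else coeff2 A (m - 1) n)"
  by (simp add: coeff2_def var_z_def)

lemma coeff2_var_zbar_mult: "coeff2 (var_zbar * A) m n = (if n = 0 then 0 else coeff2 A m (n - 1))"
  by (simp add: coeff2_def var_zbar_def)

lemma const2_simps: "const2 0 = 0" "const2 1 = 1" "const2 (a * b) = const2 a * const2 b"
    "const2 (a + b) = const2 a + const2 b"
  by (simp_all add: const2_def)

lemma coeff2_0_0_mult [simp]: "coeff2 (A * B) 0 0 = coeff2 A 0 0 * coeff2 B 0 0"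
  by (simp add: coeff2_mult)

subsection \<open>Partial derivatives\<close>

lemma coeff2_deriv_z [simp]: "coeff2 (deriv_z A) m n = of_nat (Suc m) * coeff2 A (Suc m) n"
  and coeff2_deriv_zbar [simp]: "coeff2 (deriv_zbar A) m n = of_nat (Suc n) * coeff2 A m (Suc n)"
  by (simp_all add: deriv_z_def deriv_zbar_def)

lemma deriv_z_eq: "deriv_z A = fps_deriv A"
  by (rule fps2_eqI) (simp add: coeff2_def deriv_z_def Abs_fps2_def fps_eq_iff fps_of_nat[symmetric])

lemma deriv_zbar_nth: "fps_nth (deriv_zbar A) m = fps_deriv (fps_nth A m)"
  by (rule fps_ext) (simp add: deriv_zbar_def Abs_fps2_def coeff2_def)

text \<open>Covers both partial derivatives, so that the chain rule for \<open>subst2\<close> is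
  proved once, inside the locale.\<close>

locale formal_derivation =
  fixes D :: "fps2 \<Rightarrow> fps2"
  assumes add: "D (A + B) = D A + D B"
    and mult: "D (A * B) = D A * B + A * D B"
    and const: "D (const2 c) = 0"
begin

lemma zero: "D 0 = 0"
  using const[of 0] by (simp add: const2_simps)

lemma one: "D 1 = 0"
  using const[of 1] by (simp add: const2_simps)

lemma sum: "D (sum F S) = (\<Sum>x\<in>S. D (F x))"
  by (induction S rule: infinite_finite_induct) (simp_all add: zero add)

lemma power: "D (A ^ n) = of_nat n * A ^ (n - 1) * D A"
proof (induction n)
  case (Suc n)
  then show ?case by (cases n) (simp_all add: mult algebra_simps)
qed (simp add: one)

lemma const_mult: "D (const2 c * A) = const2 c * D A"
  by (simp add: mult const)

end

interpretation deriv_z: formal_derivation deriv_z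
  by unfold_locales (simp_all add: deriv_z_eq const2_def algebra_simps)

interpretation deriv_zbar: formal_derivation deriv_zbar
proof
  fix A B
  show "deriv_zbar (A * B) = deriv_zbar A * B + A * deriv_zbar B"
    by (rule fps_ext) (simp add: deriv_zbar_nth fps_mult_nth fps_deriv_sum sum.distrib)
qed (rule fps2_eqI, simp add: algebra_simps coeff2_const2)+

subsection \<open>Equality up to a given total degree\<close>

text \<open>Stands in for convergence in the adic topology: an identity of series is proved modulo
  each degree N and assembled by \<open>eqd_allI\<close>.\<close>

definition eqd :: "nat \<Rightarrow> fps2 \<Rightarrow> fps2 \<Rightarrow> bool" where
  "eqd N A B \<longleftrightarrow> (\<forall>i j. i + j < N \<longrightarrow> coeff2 A i j = coeff2 B i j)"

lemma eqdD: "eqd N A B \<Longrightarrow> i + j < N \<Longrightarrow> coeff2 A i j = coeff2 B i j"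
  by (simp add: eqd_def)

lemma eqd_0 [simp]: "eqd 0 A B"
  by (simp add: eqd_def)

lemma eqd_refl [simp]: "eqd N A A"
  by (simp add: eqd_def)

lemma eqd_sym: "eqd N A B \<Longrightarrow> eqd N B A"
  by (simp add: eqd_def)

lemma eqd_trans [trans]: "eqd N A B \<Longrightarrow> eqd N B C \<Longrightarrow> eqd N A C"
  by (simp add: eqd_def)

lemma eqd_mono: "eqd N A B \<Longrightarrow> M \<le> N \<Longrightarrow> eqd M A B"
  by (auto simp: eqd_def)

lemma eqd_add: "eqd N A B \<Longrightarrow> eqd N C D \<Longrightarrow> eqd N (A + C) (B + D)"
  by (simp add: eqd_def)

lemma eqd_mult: "eqd N A B \<Longrightarrow> eqd N C D \<Longrightarrow> eqd N (A * C) (B * D)"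
  unfolding eqd_def coeff2_mult by (intro allI impI sum.cong refl arg_cong2[where f = "(*)"]) auto

lemma eqd_allI: "(\<And>N. eqd N A B) \<Longrightarrow> A = B"
  by (rule fps2_eqI) (metis eqdD lessI)

text \<open>In characteristic 0 every other coefficient is recovered from a derivative, and
  differentiation costs one degree. Multiplicativity and associativity of substitution are
  inductions on the degree with this as their step, the chain rule supplying the
  derivatives.\<close>

lemma eqd_Suc_iff:
  "eqd (Suc N) A B \<longleftrightarrow> coeff2 A 0 0 = coeff2 B 0 0 \<and> eqd N (deriv_z A) (deriv_z B) \<and>
     eqd N (deriv_zbar A) (deriv_zbar B)"
proof (intro iffI conjI)
  assume R: "coeff2 A 0 0 = coeff2 B 0 0 \<and> eqd N (deriv_z A) (deriv_z B) \<and>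
     eqd N (deriv_zbar A) (deriv_zbar B)"
  show "eqd (Suc N) A B"
    unfolding eqd_def
  proof (intro allI impI)
    fix i j assume ij: "i + j < Suc N"
    show "coeff2 A i j = coeff2 B i j"
    proof (cases i)
      case (Suc k)
      then have "coeff2 (deriv_z A) k j = coeff2 (deriv_z B) k j"
        using R ij by (auto dest: eqdD)
      then show ?thesis using Suc by (simp del: of_nat_Suc)
    next
      case i: 0
      show ?thesis
      proof (cases j)
        case (Suc k)
        then have "coeff2 (deriv_zbar A) i k = coeff2 (deriv_zbar B) i k"
          using R ij by (auto dest: eqdD)
        then show ?thesis using Suc by (simp del: of_nat_Suc)
      qed (use R i in simp)
    qed
  qed
qed (auto simp: eqd_def)

lemma eqd_mult_0:
  assumes "eqd a A 0" "eqd b B 0"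
  shows "eqd (a + b) (A * B) 0"
  unfolding eqd_def coeff2_mult coeff2_0
proof (intro allI impI sum.neutral ballI)
  fix i j k l
  assume ij: "i + j < a + b" and "k \<in> {..i}" "l \<in> {..j}"
  then have "k + l < a \<or> (i - k) + (j - l) < b" by auto
  then show "coeff2 A k l * coeff2 B (i - k) (j - l) = 0"
    using assms by (auto simp: eqd_def)
qed

lemma eqd_1_0_iff: "eqd 1 A 0 \<longleftrightarrow> coeff2 A 0 0 = 0"
  by (auto simp: eqd_def)

lemma eqd_power_0: "coeff2 A 0 0 = 0 \<Longrightarrow> eqd n (A ^ n) 0"
  by (induction n) (use eqd_mult_0[of 1 A] in \<open>simp_all flip: eqd_1_0_iff\<close>)

lemma eqd_power_mult_power_0:
  assumes "coeff2 P 0 0 = 0" "coeff2 Q 0 0 = 0" "N \<le> m + n"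
  shows "eqd N (P ^ m * Q ^ n) 0"
  using eqd_mult_0[OF eqd_power_0 eqd_power_0, OF assms(1,2)] assms(3) eqd_mono by blast

subsection \<open>Substitution\<close>

text \<open>In \<open>subst2\<close> the cutoff moves with the coefficient, so Leibniz's rule does
  not apply to it directly. This truncation is a polynomial in P and Q. It has two separate bounds
  because each partial derivative of A lowers only one of them.\<close>

definition partial_subst2 :: "nat \<Rightarrow> nat \<Rightarrow> fps2 \<Rightarrow> fps2 \<Rightarrow> fps2 \<Rightarrow> fps2" where
  "partial_subst2 M N A P Q = (\<Sum>m\<le>M. \<Sum>n\<le>N. const2 (coeff2 A m n) * (P ^ m * Q ^ n))"

lemma eqd_partial_subst2:
  assumes "coeff2 P 0 0 = 0" "coeff2 Q 0 0 = 0" "K \<le> M" "K \<le> N"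
  shows "eqd (Suc K) (subst2 A P Q) (partial_subst2 M N A P Q)"
  unfolding eqd_def
proof (intro allI impI)
  fix i j assume ij: "i + j < Suc K"
  have z: "coeff2 (P ^ m * Q ^ n) i j = 0" if "m > i + j \<or> n > i + j" for m n
    using eqdD[OF eqd_power_mult_power_0[OF assms(1,2) order.refl, of m n], of i j] that by auto
  have "coeff2 (partial_subst2 M N A P Q) i j
      = (\<Sum>m\<le>M. \<Sum>n\<le>N. coeff2 A m n * coeff2 (P ^ m * Q ^ n) i j)"
    by (simp add: partial_subst2_def coeff2_sum)
  also have "\<dots> = (\<Sum>m\<le>M. \<Sum>n\<le>i+j. coeff2 A m n * coeff2 (P ^ m * Q ^ n) i j)"
    by (intro sum.cong refl sum.mono_neutral_right) (use z ij assms in auto)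
  also have "\<dots> = (\<Sum>m\<le>i+j. \<Sum>n\<le>i+j. coeff2 A m n * coeff2 (P ^ m * Q ^ n) i j)"
    by (intro sum.mono_neutral_right) (use z ij assms in auto)
  finally show "coeff2 (subst2 A P Q) i j = coeff2 (partial_subst2 M N A P Q) i j"
    by (simp add: subst2_def)
qed

lemma coeff2_subst2_0_0 [simp]: "coeff2 (subst2 A P Q) 0 0 = coeff2 A 0 0"
  by (simp add: subst2_def coeff2_1)

lemma subst2_add: "subst2 (A + B) P Q = subst2 A P Q + subst2 B P Q"
  by (rule fps2_eqI) (simp add: subst2_def sum.distrib distrib_right)

lemma subst2_diff: "subst2 (A - B) P Q = subst2 A P Q - subst2 B P Q"
  by (rule fps2_eqI) (simp add: subst2_def sum_subtractf left_diff_distrib)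

lemma (in formal_derivation) partial_subst2:
  "D (partial_subst2 (Suc M) (Suc N) A P Q) =
     partial_subst2 M (Suc N) (deriv_z A) P Q * D P +
     partial_subst2 (Suc M) N (deriv_zbar A) P Q * D Q"
proof -
  have "D (partial_subst2 (Suc M) (Suc N) A P Q) =
      (\<Sum>m\<le>Suc M. \<Sum>n\<le>Suc N. const2 (coeff2 A m n) * (of_nat m * P ^ (m - 1) * Q ^ n)) * D P +
      (\<Sum>m\<le>Suc M. \<Sum>n\<le>Suc N. const2 (coeff2 A m n) * (P ^ m * (of_nat n * Q ^ (n - 1)))) * D Q"
    unfolding partial_subst2_def sum const_mult mult power sum_distrib_right sum.distrib [symmetric]
    by (intro sum.cong refl) (simp add: const algebra_simps)
  also have "(\<Sum>m\<le>Suc M. \<Sum>n\<le>Suc N. const2 (coeff2 A m n) * (of_nat m * P ^ (m - 1) * Q ^ n))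
      = (\<Sum>m\<le>M. \<Sum>n\<le>Suc N. const2 (coeff2 A (Suc m) n) * (of_nat (Suc m) * P ^ m * Q ^ n))"
    by (subst sum.atMost_Suc_shift) simp
  also have "\<dots> = partial_subst2 M (Suc N) (deriv_z A) P Q"
    unfolding partial_subst2_def coeff2_deriv_z const2_simps
    by (intro sum.cong refl) (simp add: const2_def fps_of_nat algebra_simps del: of_nat_Suc)
  also have "(\<Sum>m\<le>Suc M. \<Sum>n\<le>Suc N. const2 (coeff2 A m n) * (P ^ m * (of_nat n * Q ^ (n - 1))))
      = (\<Sum>m\<le>Suc M. \<Sum>n\<le>N. const2 (coeff2 A m (Suc n)) * (P ^ m * (of_nat (Suc n) * Q ^ n)))"
    by (rule sum.cong[OF refl], subst sum.atMost_Suc_shift) simp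
  also have "\<dots> = partial_subst2 (Suc M) N (deriv_zbar A) P Q"
    unfolding partial_subst2_def coeff2_deriv_zbar const2_simps
    by (intro sum.cong refl) (simp add: const2_def fps_of_nat algebra_simps del: of_nat_Suc)
  finally show ?thesis .
qed

lemma eqd_deriv:
  assumes "eqd (Suc N) A B"
  shows "eqd N (deriv_z A) (deriv_z B)" "eqd N (deriv_zbar A) (deriv_zbar B)"
  using assms by (simp_all add: eqd_Suc_iff)

text \<open>In each degree only finitely many terms count, so the rule for
  \<open>partial_subst2\<close> is enough. The truncation is taken one degree higher than the claim,
  because D may cost a degree; this is what the assumption \<open>eqd\<close> records.\<close>

lemma (in formal_derivation) subst2:
  assumes eqd: "\<And>N A B. eqd (Suc N) A B \<Longrightarrow> eqd N (D A) (D B)"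
    and PQ: "coeff2 P 0 0 = 0" "coeff2 Q 0 0 = 0"
  shows "D (subst2 A P Q) = subst2 (deriv_z A) P Q * D P + subst2 (deriv_zbar A) P Q * D Q"
proof (rule eqd_allI)
  fix N
  have "eqd (Suc N) (D (subst2 A P Q)) (D (partial_subst2 (Suc N) (Suc N) A P Q))"
    by (intro eqd eqd_partial_subst2 PQ) auto
  then have "eqd N (D (subst2 A P Q)) (D (partial_subst2 (Suc N) (Suc N) A P Q))"
    by (rule eqd_mono) simp
  also have "eqd N (D (partial_subst2 (Suc N) (Suc N) A P Q))
     (subst2 (deriv_z A) P Q * D P + subst2 (deriv_zbar A) P Q * D Q)"
    unfolding partial_subst2
    by (intro eqd_add eqd_mult eqd_refl eqd_sym[OF eqd_mono[OF eqd_partial_subst2[where K = N]]] PQ) auto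
  finally show "eqd N (D (subst2 A P Q))
     (subst2 (deriv_z A) P Q * D P + subst2 (deriv_zbar A) P Q * D Q)" .
qed

lemma
  assumes "coeff2 P 0 0 = 0" "coeff2 Q 0 0 = 0"
  shows deriv_z_subst2: "deriv_z (subst2 A P Q) =
      subst2 (deriv_z A) P Q * deriv_z P + subst2 (deriv_zbar A) P Q * deriv_z Q"
    and deriv_zbar_subst2: "deriv_zbar (subst2 A P Q) =
      subst2 (deriv_z A) P Q * deriv_zbar P + subst2 (deriv_zbar A) P Q * deriv_zbar Q"
  using assms by (blast intro: deriv_z.subst2 deriv_zbar.subst2 eqd_deriv)+

text \<open>By the chain rule and Leibniz's rule the derivatives of both sides are the same
  combinations of substituted products, in which A or B is replaced by one of its derivatives. This
  is why A and B vary in the induction.\<close>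

lemma subst2_mult:
  assumes "coeff2 P 0 0 = 0" "coeff2 Q 0 0 = 0"
  shows "subst2 (A * B) P Q = subst2 A P Q * subst2 B P Q"
proof (rule eqd_allI)
  fix N show "eqd N (subst2 (A * B) P Q) (subst2 A P Q * subst2 B P Q)"
  proof (induction N arbitrary: A B)
    case (Suc N)
    have *: "eqd N (subst2 (A1 * B + A * B1) P Q * C + subst2 (A2 * B + A * B2) P Q * D)
       ((subst2 A1 P Q * subst2 B P Q + subst2 A P Q * subst2 B1 P Q) * C
         + (subst2 A2 P Q * subst2 B P Q + subst2 A P Q * subst2 B2 P Q) * D)" for A1 A2 B1 B2 C D
      unfolding subst2_add by (intro eqd_add eqd_mult[OF _ eqd_refl] Suc)
    show ?case
      unfolding eqd_Suc_iff deriv_z_subst2[OF assms] deriv_zbar_subst2[OF assms]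
        deriv_z.mult deriv_zbar.mult
      using *[of "deriv_z A" "deriv_z B" "deriv_z P" "deriv_zbar A" "deriv_zbar B" "deriv_z Q"]
        *[of "deriv_z A" "deriv_z B" "deriv_zbar P" "deriv_zbar A" "deriv_zbar B" "deriv_zbar Q"]
      by (simp add: algebra_simps)
  qed simp
qed

lemma subst2_assoc:
  assumes "coeff2 P 0 0 = 0" "coeff2 Q 0 0 = 0" "coeff2 R 0 0 = 0" "coeff2 S 0 0 = 0"
  shows "subst2 (subst2 A P Q) R S = subst2 A (subst2 P R S) (subst2 Q R S)"
proof (rule eqd_allI)
  have PQ': "coeff2 (subst2 P R S) 0 0 = 0" "coeff2 (subst2 Q R S) 0 0 = 0"
    using assms by simp_all
  fix N show "eqd N (subst2 (subst2 A P Q) R S) (subst2 A (subst2 P R S) (subst2 Q R S))"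
  proof (induction N arbitrary: A)
    case (Suc N)
    have *: "eqd N (C1 * subst2 (subst2 (deriv_z A) P Q) R S + C2 * subst2 (subst2 (deriv_zbar A) P Q) R S)
      (C1 * subst2 (deriv_z A) (subst2 P R S) (subst2 Q R S)
         + C2 * subst2 (deriv_zbar A) (subst2 P R S) (subst2 Q R S))" for C1 C2
      by (intro eqd_add eqd_mult eqd_refl Suc)
    show ?case
      unfolding eqd_Suc_iff
        deriv_z_subst2[OF assms(1,2)] deriv_zbar_subst2[OF assms(1,2)]
        deriv_z_subst2[OF assms(3,4)] deriv_zbar_subst2[OF assms(3,4)]
        deriv_z_subst2[OF PQ'] deriv_zbar_subst2[OF PQ'] subst2_add subst2_mult[OF assms(3,4)]
      using *[of "deriv_z (subst2 P R S)" "deriv_z (subst2 Q R S)"]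
        *[of "deriv_zbar (subst2 P R S)" "deriv_zbar (subst2 Q R S)"]
      unfolding deriv_z_subst2[OF assms(3,4)] deriv_zbar_subst2[OF assms(3,4)]
      by (simp add: algebra_simps)
  qed simp
qed

lemma subst2_const2: "subst2 (const2 c) P Q = const2 c"
proof (rule fps2_eqI)
  fix i j
  have "coeff2 (subst2 (const2 c) P Q) i j =
     (\<Sum>m\<le>i+j. if m = 0 then (\<Sum>n\<le>i+j. if n = 0 then c * coeff2 1 i j else 0) else 0)"
    unfolding subst2_def coeff2_Abs_fps2
    by (intro sum.cong refl)
      (auto simp: coeff2_const2 if_distrib[of "\<lambda>x. x * _"] simp del: sum.delta intro!: sum.cong)
  then show "coeff2 (subst2 (const2 c) P Q) i j = coeff2 (const2 c) i j"
    by (simp add: coeff2_1 coeff2_const2)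
qed

lemma subst2_1: "subst2 1 P Q = 1"
  using subst2_const2[of 1] by (simp add: const2_simps)

lemma deriv_var [simp]: "deriv_z var_z = 1" "deriv_zbar var_zbar = 1"
    "deriv_z var_zbar = 0" "deriv_zbar var_z = 0"
  by (auto intro!: fps2_eqI simp: coeff2_1 coeff2_var_z coeff2_var_zbar)

lemma subst2_var_z:
  assumes "coeff2 P 0 0 = 0" "coeff2 Q 0 0 = 0"
  shows "subst2 var_z P Q = P"
  by (rule eqd_allI[where A = "subst2 _ _ _"], rename_tac N, case_tac N)
    (simp_all add: eqd_Suc_iff deriv_z_subst2[OF assms] deriv_zbar_subst2[OF assms] subst2_1
      subst2_const2[of 0, unfolded const2_simps] coeff2_var_z assms)

subsection \<open>Conjugation\<close>

lemma coeff2_cnj2 [simp]: "coeff2 (cnj2 A) m n = cnj (coeff2 A n m)"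
  by (simp add: cnj2_def)

lemma cnj2_cnj2 [simp]: "cnj2 (cnj2 A) = A"
  by (rule fps2_eqI) simp

lemma cnj2_mult: "cnj2 (A * B) = cnj2 A * cnj2 B"
  by (rule fps2_eqI) (simp add: coeff2_mult, subst sum.swap, simp)

lemma cnj2_const2: "cnj2 (const2 c) = const2 (cnj c)"
  by (rule fps2_eqI) (simp add: coeff2_const2)

lemma cnj2_1: "cnj2 1 = 1"
  by (rule fps2_eqI) (simp add: coeff2_1)

lemma cnj2_power: "cnj2 (A ^ n) = cnj2 A ^ n"
  by (induction n) (simp_all add: cnj2_1 cnj2_mult)

lemma deriv_z_cnj2: "deriv_z (cnj2 A) = cnj2 (deriv_zbar A)"
  and deriv_zbar_cnj2: "deriv_zbar (cnj2 A) = cnj2 (deriv_z A)"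
  by (rule fps2_eqI, simp)+

lemma cnj2_subst2: "cnj2 (subst2 A P Q) = subst2 (cnj2 A) (cnj2 Q) (cnj2 P)"
proof (rule fps2_eqI)
  fix i j
  have e: "cnj (coeff2 (P ^ m * Q ^ n) j i) = coeff2 (cnj2 Q ^ n * cnj2 P ^ m) i j" for m n
    using coeff2_cnj2[of "P ^ m * Q ^ n" i j] by (simp add: cnj2_mult cnj2_power mult.commute)
  show "coeff2 (cnj2 (subst2 A P Q)) i j = coeff2 (subst2 (cnj2 A) (cnj2 Q) (cnj2 P)) i j"
    unfolding coeff2_cnj2 subst2_def coeff2_Abs_fps2 cnj_sum complex_cnj_mult e
    by (subst sum.swap) (simp add: add.commute)
qed

lemma cnj2_formal_comp: "cnj2 (formal_comp A P) = formal_comp (cnj2 A) P"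
  by (simp add: formal_comp_def cnj2_subst2)

lemma formal_comp_assoc:
  assumes "coeff2 P 0 0 = 0" "coeff2 Q 0 0 = 0"
  shows "formal_comp (formal_comp A P) Q = formal_comp A (formal_comp P Q)"
proof -
  have "formal_comp (formal_comp A P) Q
      = subst2 A (subst2 P Q (cnj2 Q)) (subst2 (cnj2 P) Q (cnj2 Q))"
    unfolding formal_comp_def by (rule subst2_assoc) (use assms in simp_all)
  also have "subst2 (cnj2 P) Q (cnj2 Q) = cnj2 (subst2 P Q (cnj2 Q))"
    by (simp add: cnj2_subst2)
  finally show ?thesis by (simp add: formal_comp_def)
qed

subsection \<open>Series in the product of the two variables\<close>

definition diag2 :: "complex fps \<Rightarrow> fps2" where
  "diag2 a = Abs_fps2 (\<lambda>m n. if m = n then fps_nth a n else 0)"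

definition cnj1 :: "complex fps \<Rightarrow> complex fps" where
  "cnj1 a = Abs_fps (\<lambda>n. cnj (fps_nth a n))"

lemma coeff2_diag2: "coeff2 (diag2 a) m n = (if m = n then fps_nth a n else 0)"
  by (simp add: diag2_def)

lemma coeff2_diag2_mult:
  "coeff2 (diag2 a * B) m n = (\<Sum>k\<le>min m n. fps_nth a k * coeff2 B (m - k) (n - k))"
proof -
  have "coeff2 (diag2 a * B) m n =
      (\<Sum>i\<le>m. \<Sum>j\<le>n. if i = j then fps_nth a i * coeff2 B (m - i) (n - i) else 0)"
    unfolding coeff2_mult by (intro sum.cong refl) (simp add: coeff2_diag2)
  also have "\<dots> = (\<Sum>i\<le>m. if i \<le> n then fps_nth a i * coeff2 B (m - i) (n - i) else 0)"
    by (simp add: sum.delta)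
  also have "\<dots> = (\<Sum>k\<in>{..m} \<inter> {..n}. fps_nth a k * coeff2 B (m - k) (n - k))"
    by (subst sum.inter_restrict) (auto intro!: sum.cong)
  also have "{..m} \<inter> {..n} = {..min m n}" by auto
  finally show ?thesis .
qed

lemma diag2_mult: "diag2 (a * b) = diag2 a * diag2 b"
proof (rule fps2_eqI)
  fix m n :: nat
  have "coeff2 (diag2 a * diag2 b) m n = (if m = n then \<Sum>k\<le>n. fps_nth a k * fps_nth b (n - k) else 0)"
    unfolding coeff2_diag2_mult by (auto simp: coeff2_diag2 intro!: sum.neutral)
  then show "coeff2 (diag2 (a * b)) m n = coeff2 (diag2 a * diag2 b) m n"
    by (simp add: coeff2_diag2 fps_mult_nth atLeast0AtMost)
qed

lemma diag2_1: "diag2 1 = 1"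
  by (rule fps2_eqI) (auto simp: coeff2_diag2 coeff2_1)

lemma diag2_add: "diag2 (a + b) = diag2 a + diag2 b"
  by (rule fps2_eqI) (simp add: coeff2_diag2)

lemma diag2_power: "diag2 (a ^ n) = diag2 a ^ n"
  by (induction n) (simp_all add: diag2_1 diag2_mult)

lemma diag2_eq_iff [simp]: "diag2 a = diag2 b \<longleftrightarrow> a = b"
  by (metis coeff2_diag2 fps_ext)

lemma diag2_fps_X: "diag2 fps_X = var_z * var_zbar"
  by (rule fps2_eqI) (auto simp: coeff2_diag2 coeff2_var_z_mult coeff2_var_zbar fps_X_def)

lemma deriv_z_diag2: "deriv_z (diag2 a) = var_zbar * diag2 (fps_deriv a)"
  by (rule fps2_eqI) (auto simp: coeff2_diag2 coeff2_var_zbar_mult)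

lemma deriv_zbar_diag2: "deriv_zbar (diag2 a) = var_z * diag2 (fps_deriv a)"
  by (rule fps2_eqI) (auto simp: coeff2_diag2 coeff2_var_z_mult)

lemma cnj2_diag2: "cnj2 (diag2 a) = diag2 (cnj1 a)"
  by (rule fps2_eqI) (simp add: coeff2_diag2 cnj1_def)

lemma cnj2_var_z [simp]: "cnj2 var_z = var_zbar"
  by (rule fps2_eqI) (auto simp: coeff2_var_z coeff2_var_zbar)

lemma coeff2_subst2_diag2:
  "coeff2 (subst2 (diag2 a) P Q) i j = (\<Sum>n\<le>i+j. fps_nth a n * coeff2 ((P * Q) ^ n) i j)"
proof -
  have "(\<Sum>n\<le>i+j. coeff2 (diag2 a) m n * coeff2 (P ^ m * Q ^ n) i j) =
      (\<Sum>n\<le>i+j. if n = m then fps_nth a m * coeff2 (P ^ m * Q ^ m) i j else 0)" for m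
    by (intro sum.cong refl) (simp add: coeff2_diag2)
  then show ?thesis
    unfolding subst2_def coeff2_Abs_fps2 by (simp add: power_mult_distrib)
qed

text \<open>The monomials of \<open>diag2 a\<close> are powers of \<open>z z'\<close>, so P and Q
  enter only through their product.\<close>

lemma subst2_diag2_diag2:
  assumes "P * Q = diag2 j"
  shows "\<exists>e. subst2 (diag2 a) P Q = diag2 e"
proof
  show "subst2 (diag2 a) P Q = diag2 (Abs_fps (\<lambda>i. \<Sum>n\<le>i+i. fps_nth a n * fps_nth (j ^ n) i))"
    by (rule fps2_eqI) (simp add: coeff2_subst2_diag2 assms coeff2_diag2 flip: diag2_power)
qed

lemma fps2_eq_diag2I:
  assumes "\<And>m n. m \<noteq> n \<Longrightarrow> coeff2 A m n = 0"
  obtains a where "A = diag2 a"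
  by (rule that[of "Abs_fps (\<lambda>n. coeff2 A n n)"], rule fps2_eqI) (use assms in \<open>auto simp: coeff2_diag2\<close>)

lemma fps2_eq_var_z_diag2I:
  assumes "\<And>m n. m \<noteq> Suc n \<Longrightarrow> coeff2 A m n = 0"
  obtains a where "A = var_z * diag2 a"
  by (rule that[of "Abs_fps (\<lambda>n. coeff2 A (Suc n) n)"], rule fps2_eqI)
    (use assms in \<open>auto simp: coeff2_diag2 coeff2_var_z_mult\<close>)

lemma subst2_diag2_eq:
  assumes "P * Q = var_z * var_zbar"
  shows "subst2 (diag2 a) P Q = diag2 a"
proof (rule fps2_eqI)
  fix i j :: nat
  have "coeff2 (subst2 (diag2 a) P Q) i j =
      (\<Sum>n\<le>i+j. if n = i then if i = j then fps_nth a i else 0 else 0)"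
    unfolding coeff2_subst2_diag2 assms diag2_fps_X[symmetric] diag2_power[symmetric]
    by (intro sum.cong refl) (auto simp: coeff2_diag2)
  then show "coeff2 (subst2 (diag2 a) P Q) i j = coeff2 (diag2 a) i j"
    by (simp add: coeff2_diag2)
qed

subsection \<open>Uniqueness of the Birkhoff normal form\<close>

text \<open>The chain rule makes the Jacobian determinant multiplicative, and substituting into the
  constant 1 gives 1.\<close>

lemma formal_symplectic_comp:
  assumes "formal_symplectic A" "formal_symplectic P" "coeff2 P 0 0 = 0"
  shows "formal_symplectic (formal_comp A P)"
proof -
  have P': "coeff2 (cnj2 P) 0 0 = 0" using assms by simp
  let ?s = "\<lambda>A. subst2 A P (cnj2 P)"
  let ?c = "cnj2 A"
  have "deriv_z (?s A) * deriv_zbar (?s ?c) - deriv_zbar (?s A) * deriv_z (?s ?c) =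
    (?s (deriv_z A) * ?s (deriv_zbar ?c) - ?s (deriv_zbar A) * ?s (deriv_z ?c)) *
    (deriv_z P * deriv_zbar (cnj2 P) - deriv_zbar P * deriv_z (cnj2 P))"
    unfolding deriv_z_subst2[OF assms(3) P'] deriv_zbar_subst2[OF assms(3) P']
    by (simp add: algebra_simps)
  also have "?s (deriv_z A) * ?s (deriv_zbar ?c) - ?s (deriv_zbar A) * ?s (deriv_z ?c) = ?s 1"
    using assms(1) unfolding formal_symplectic_def
    by (simp flip: subst2_mult[OF assms(3) P'] subst2_diff)
  finally show ?thesis
    using assms(2) unfolding formal_symplectic_def cnj2_formal_comp
    by (simp add: formal_comp_def subst2_1)
qed

lemma formal_tangent_to_id_comp:
  assumes "formal_tangent_to_id A" "formal_tangent_to_id P"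
  shows "formal_tangent_to_id (formal_comp A P)"
proof -
  have *: "coeff2 B 1 0 = coeff2 (deriv_z B) 0 0" "coeff2 B 0 1 = coeff2 (deriv_zbar B) 0 0" for B
    by simp_all
  have "coeff2 P 0 0 = 0" "coeff2 (cnj2 P) 0 0 = 0"
    using assms by (auto simp: formal_tangent_to_id_def)
  then show ?thesis
    using assms unfolding formal_tangent_to_id_def * formal_comp_def
    by (simp add: deriv_z_subst2 deriv_zbar_subst2)
qed

lemma var_z_power: "var_z ^ p = fps_X ^ p"
  and var_zbar_power: "var_zbar ^ p = fps_const (fps_X ^ p)"
  by (simp_all add: var_z_def var_zbar_def fps_const_power)

lemma coeff2_var_power_mult:
  "coeff2 (var_z ^ p * (var_zbar ^ q * A)) m n =
     (if p \<le> m \<and> q \<le> n then coeff2 A (m - p) (n - q) else 0)"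
  by (auto simp: var_z_power var_zbar_power coeff2_def fps_X_power_mult_nth)

text \<open>
  Substituting \<open>N = \<mu> z E(z z')\<close> multiplies the monomial \<open>z\<^sup>m z'\<^sup>n\<close> by \<open>\<mu>\<^bsup>m-n\<^esup>\<close> and a series in \<open>z z'\<close>
  with constant term \<open>1\<close>, so coefficients only interact within a class of constant \<open>m - n\<close>.
\<close>

lemma resonant_coeffs_only:
  assumes \<mu>: "\<mu> * cnj \<mu> = 1" and E: "fps_nth E 0 = 1" and e: "fps_nth e 0 = 1"
    and N: "N = const2 \<mu> * (var_z * diag2 E)"
    and eq: "const2 c * (diag2 e * Y) = subst2 Y N (cnj2 N)"
    and c: "c \<noteq> \<mu> ^ m * cnj \<mu> ^ n"
  shows "coeff2 Y m n = 0"
  using c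
proof (induction m arbitrary: n rule: less_induct)
  case (less m)
  have N': "cnj2 N = const2 (cnj \<mu>) * (var_zbar * diag2 (cnj1 E))"
    by (simp add: N cnj2_mult cnj2_const2 cnj2_diag2)
  have const2_power: "const2 a ^ n = const2 (a ^ n)" for a n
    by (simp add: const2_def fps_const_power)
  have pow: "N ^ p * cnj2 N ^ q = const2 (\<mu> ^ p * cnj \<mu> ^ q) *
      (var_z ^ p * (var_zbar ^ q * diag2 (E ^ p * cnj1 E ^ q)))" for p q
    unfolding N' unfolding N power_mult_distrib const2_power const2_simps diag2_mult diag2_power
    by (simp only: mult_ac)
  have res: "\<mu> ^ (m - k) * cnj \<mu> ^ (n - k) = \<mu> ^ m * cnj \<mu> ^ n" if "k \<le> m" "k \<le> n" for k
  proof -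
    have "\<mu> ^ m * cnj \<mu> ^ n = \<mu> ^ (m - k + k) * cnj \<mu> ^ (n - k + k)" using that by simp
    also have "\<dots> = \<mu> ^ (m - k) * cnj \<mu> ^ (n - k) * (\<mu> * cnj \<mu>) ^ k"
      unfolding power_add power_mult_distrib by simp
    finally show ?thesis by (simp add: \<mu>)
  qed
  \<comment> \<open>By \<open>res\<close> the factor of a monomial depends only on m - n, so c
    differs from it at the lower indices of the same diagonal as well.\<close>
  have IH: "coeff2 Y (m - k) (n - k) = 0" if "k \<le> m" "k \<le> n" "k \<noteq> 0" for k
    using less that res[of k] by (intro less.IH) auto
  have "c * coeff2 Y m n = c * (\<Sum>k\<le>min m n. if k = 0 then coeff2 Y m n else 0)"
    by simp
  also have "\<dots> = coeff2 (const2 c * (diag2 e * Y)) m n"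
    unfolding coeff2_const2_mult coeff2_diag2_mult
    by (intro arg_cong2[where f = "(*)"] sum.cong refl) (use IH e in auto)
  also have "\<dots> = coeff2 (subst2 Y N (cnj2 N)) m n" by (simp add: eq)
  also have "\<dots> = (\<Sum>p\<le>m+n. if p = m then (\<Sum>q\<le>m+n. if q = n then coeff2 Y m n * (\<mu> ^ m * cnj \<mu> ^ n) else 0) else 0)"
    unfolding subst2_def coeff2_Abs_fps2 pow coeff2_const2_mult coeff2_var_power_mult
  proof (intro sum.cong refl)
    fix p
    \<comment> \<open>A nonzero contribution needs m - p = n - q, so (p, q) lies on the diagonal of
      (m, n). By the induction hypothesis only p = m, q = n survives, where the series in
      \<open>z z'\<close> contributes its constant term 1.\<close>
    have t: "coeff2 Y p q * (\<mu> ^ p * cnj \<mu> ^ q * (if p \<le> m \<and> q \<le> n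
         then coeff2 (diag2 (E ^ p * cnj1 E ^ q)) (m - p) (n - q) else 0))
       = (if p = m \<and> q = n then coeff2 Y m n * (\<mu> ^ m * cnj \<mu> ^ n) else 0)" for q
    proof (cases "p \<le> m \<and> q \<le> n \<and> m - p = n - q")
      case True
      show ?thesis
      proof (cases "m - p = 0")
        case True': True
        then show ?thesis using True by (auto simp: coeff2_diag2 E cnj1_def fps_power_zeroth)
      next
        case False
        moreover have "m - (m - p) = p" "n - (m - p) = q" "m - p \<le> n" using True by auto
        ultimately have "coeff2 Y p q = 0" using IH[of "m - p"] by simp
        then show ?thesis using False by auto
      qed
    qed (auto simp: coeff2_diag2)
    show "(\<Sum>q\<le>m+n. coeff2 Y p q * (\<mu> ^ p * cnj \<mu> ^ q * (if p \<le> m \<and> q \<le> n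
         then coeff2 (diag2 (E ^ p * cnj1 E ^ q)) (m - p) (n - q) else 0)))
      = (if p = m then (\<Sum>q\<le>m+n. if q = n then coeff2 Y m n * (\<mu> ^ m * cnj \<mu> ^ n) else 0) else 0)"
      unfolding t by (auto intro!: sum.cong)
  qed
  also have "\<dots> = \<mu> ^ m * cnj \<mu> ^ n * coeff2 Y m n" by simp
  finally show ?case using less.prems by simp
qed

section \<open>The exponential factor of the normal form, and non-resonance\<close>

definition nf_phase :: "(nat \<Rightarrow> real) \<Rightarrow> complex fps" where
  "nf_phase \<gamma> = Abs_fps (\<lambda>k. if k = 0 then 0 else complex_of_real (\<gamma> k))"

definition nf_factor :: "(nat \<Rightarrow> real) \<Rightarrow> complex fps" where
  "nf_factor \<gamma> = fps_compose (fps_exp \<i>) (nf_phase \<gamma>)"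

lemma formal_normal_form_eq:
  "formal_normal_form \<omega> \<gamma> =
     const2 (exp (\<i> * of_real (2 * pi * \<omega>))) * (var_z * diag2 (nf_factor \<gamma>))"
  by (rule fps2_eqI) (auto simp: formal_normal_form_def Let_def nf_factor_def nf_phase_def
      coeff2_var_z_mult coeff2_diag2)

lemma nf_phase_0 [simp]: "fps_nth (nf_phase \<gamma>) 0 = 0"
  by (simp add: nf_phase_def)

lemma nf_factor_0: "fps_nth (nf_factor \<gamma>) 0 = 1"
  by (simp add: nf_factor_def fps_compose_nth)

lemma cnj1_mult: "cnj1 (a * b) = cnj1 a * cnj1 b"
  by (rule fps_ext) (simp add: cnj1_def fps_mult_nth)

lemma cnj1_power: "cnj1 (a ^ n) = cnj1 a ^ n"
  by (induction n) (simp_all add: cnj1_mult, simp add: cnj1_def fps_eq_iff)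

text \<open>The phase is a real series, so conjugation only turns \<i> into -\<i> in the
  exponential.\<close>

lemma nf_factor_unimodular: "nf_factor \<gamma> * cnj1 (nf_factor \<gamma>) = 1"
proof -
  have "cnj1 (nf_phase \<gamma>) = nf_phase \<gamma>"
    by (simp add: cnj1_def nf_phase_def fps_eq_iff)
  then have "fps_nth (cnj1 (nf_phase \<gamma> ^ k)) n = fps_nth (nf_phase \<gamma> ^ k) n" for k n
    by (simp add: cnj1_power)
  then have "cnj (fps_nth (nf_phase \<gamma> ^ k) n) = fps_nth (nf_phase \<gamma> ^ k) n" for k n
    by (simp add: cnj1_def)
  then have "cnj1 (nf_factor \<gamma>) = fps_compose (fps_exp (-\<i>)) (nf_phase \<gamma>)"
    by (simp add: nf_factor_def fps_eq_iff fps_compose_nth cnj1_def)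
  then have "nf_factor \<gamma> * cnj1 (nf_factor \<gamma>) = fps_compose (fps_exp \<i> * fps_exp (-\<i>)) (nf_phase \<gamma>)"
    by (simp add: nf_factor_def fps_compose_mult_distrib)
  also have "fps_exp \<i> * fps_exp (-\<i>) = (1 :: complex fps)"
    by (simp flip: fps_exp_add_mult)
  finally show ?thesis by simp
qed

text \<open>The logarithmic derivative of the factor is \<i> times the derivative of the phase, and
  the phase has constant term 0.\<close>

lemma nf_factor_inj:
  assumes "nf_factor \<gamma> = nf_factor \<gamma>'" "k > 0"
  shows "\<gamma> k = \<gamma>' k"
proof -
  have d: "fps_deriv (nf_factor g) = fps_const \<i> * nf_factor g * fps_deriv (nf_phase g)" for g
    unfolding nf_factor_def fps_compose_deriv[OF nf_phase_0] fps_exp_deriv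
      fps_compose_mult_distrib[OF nf_phase_0] fps_const_compose ..
  have "nf_factor \<gamma> \<noteq> 0" using nf_factor_0[of \<gamma>] by auto
  moreover have "fps_const \<i> * nf_factor \<gamma> * fps_deriv (nf_phase \<gamma>) =
      fps_const \<i> * nf_factor \<gamma> * fps_deriv (nf_phase \<gamma>')"
    using d[of \<gamma>] d[of \<gamma>'] unfolding assms(1) by (rule trans[OF sym])
  ultimately have "fps_deriv (nf_phase \<gamma>) = fps_deriv (nf_phase \<gamma>')"
    by simp
  then have "fps_nth (nf_phase \<gamma>) k = fps_nth (nf_phase \<gamma>') k"
    unfolding fps_deriv_eq_iff by simp
  then show ?thesis
    using assms(2) by (simp add: nf_phase_def)
qed

text \<open>This is where irrationality is used: the equation says that e^(2 pi i \<omega> (m - n -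
  k)) = 1, so \<omega> would be a quotient of integers if m - n - k were not 0.\<close>

lemma unit_rotation_power_eq:
  assumes "\<omega> \<notin> \<rat>" "\<mu> = exp (\<i> * of_real (2 * pi * \<omega>))" "\<mu> ^ m * cnj \<mu> ^ n = \<mu> ^ k"
  shows "m = n + k"
proof (rule ccontr)
  assume ne: "m \<noteq> n + k"
  have e: "\<mu> ^ j = exp (\<i> * of_real (2 * pi * \<omega> * real j))" for j
    unfolding assms(2) exp_of_nat_mult[symmetric] by (simp add: algebra_simps)
  have "exp (\<i> * of_real (2 * pi * \<omega> * (real m - real n - real k))) = \<mu> ^ m * cnj (\<mu> ^ n) * cnj (\<mu> ^ k)"
    unfolding e by (simp add: exp_cnj flip: exp_add) (simp add: algebra_simps)
  also have "\<dots> = \<mu> ^ k * cnj (\<mu> ^ k)" using assms(3) by simp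
  also have "\<dots> = 1" unfolding e by (simp add: exp_cnj flip: exp_add)
  finally obtain l :: int where "2 * pi * \<omega> * (real m - real n - real k) = of_int (2 * l) * pi"
    by (auto simp: exp_eq_1)
  then have "\<omega> * (real m - real n - real k) = of_int l" by simp
  moreover have "real m - real n - real k \<noteq> 0" using ne by linarith
  ultimately have "\<omega> = of_int l / of_int (int m - int n - int k)" by (simp add: field_simps)
  then show False using assms(1) by (metis Rats_divide Rats_of_int)
qed

text \<open>The composition X of the two changes satisfies
  \<open>formal_comp N' X = formal_comp X N\<close>. Non-resonance alone gives X = z x(z z'), and
  the two factors could still differ by a reparametrisation of \<open>z z'\<close>. Symplecticity
  excludes this.\<close>

theorem birkhoff_normal_form_unique:
  assumes \<omega>: "\<omega> \<notin> \<rat>"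
    and \<Psi>: "formal_tangent_to_id \<Psi>" "formal_symplectic \<Psi>"
    and \<Phi>: "formal_tangent_to_id \<Phi>" "formal_symplectic \<Phi>"
    and F: "coeff2 F 0 0 = 0"
    and conj\<Psi>: "formal_comp \<Psi> F = formal_comp (formal_normal_form \<omega> \<gamma>') \<Psi>"
    and conj\<Phi>: "formal_comp F \<Phi> = formal_comp \<Phi> (formal_normal_form \<omega> \<gamma>)"
    and k: "k > 0"
  shows "\<gamma> k = \<gamma>' k"
proof -
  define \<mu> where "\<mu> = exp (\<i> * of_real (2 * pi * \<omega>))"
  define E where "E = nf_factor \<gamma>"
  define E' where "E' = nf_factor \<gamma>'"
  define N where "N = formal_normal_form \<omega> \<gamma>"
  define N' where "N' = formal_normal_form \<omega> \<gamma>'"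
  define X where "X = formal_comp \<Psi> \<Phi>"
  have \<mu>: "\<mu> * cnj \<mu> = 1" by (simp add: \<mu>_def del: of_real_mult flip: complex_norm_square)
  have N: "N = const2 \<mu> * (var_z * diag2 E)" and N': "N' = const2 \<mu> * (var_z * diag2 E')"
    by (simp_all add: N_def N'_def formal_normal_form_eq E_def E'_def \<mu>_def)
  have E0: "fps_nth E 0 = 1" "fps_nth E' 0 = 1" and EE: "E * cnj1 E = 1" "E' * cnj1 E' = 1"
    by (simp_all add: E_def E'_def nf_factor_0 nf_factor_unimodular)
  have N0: "coeff2 N 0 0 = 0" "coeff2 N' 0 0 = 0"
    by (simp_all add: N N' coeff2_var_z)
  have P0: "coeff2 \<Psi> 0 0 = 0" "coeff2 \<Phi> 0 0 = 0"
    using \<Psi> \<Phi> by (simp_all add: formal_tangent_to_id_def)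
  have X: "formal_tangent_to_id X" "formal_symplectic X"
    unfolding X_def using \<Psi> \<Phi> P0 by (simp_all add: formal_tangent_to_id_comp formal_symplectic_comp)
  then have X0: "coeff2 X 0 0 = 0" "coeff2 (cnj2 X) 0 0 = 0" and X1: "coeff2 X 1 0 = 1"
    by (simp_all add: formal_tangent_to_id_def)
  have "formal_comp N' X = formal_comp (formal_comp N' \<Psi>) \<Phi>"
    unfolding X_def by (rule formal_comp_assoc[OF P0, symmetric])
  also have "\<dots> = formal_comp \<Psi> (formal_comp F \<Phi>)"
    unfolding N'_def conj\<Psi>[symmetric] by (rule formal_comp_assoc[OF F P0(2)])
  also have "\<dots> = formal_comp X N"
    unfolding X_def conj\<Phi> N_def[symmetric] by (rule formal_comp_assoc[OF P0(2) N0(1), symmetric])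
  finally have "formal_comp N' X = formal_comp X N" .
  moreover define S where "S = subst2 (diag2 E') X (cnj2 X)"
  moreover have "formal_comp N' X = const2 \<mu> * (X * S)"
    unfolding formal_comp_def N' S_def
    by (simp add: subst2_const2 subst2_mult[OF X0] subst2_var_z[OF X0])
  ultimately have conj: "const2 \<mu> * (X * S) = subst2 X N (cnj2 N)"
    by (simp add: formal_comp_def)
  define S' where "S' = subst2 (diag2 (cnj1 E')) X (cnj2 X)"
  have "cnj2 (const2 \<mu> * (X * S)) = subst2 (cnj2 X) N (cnj2 N)"
    unfolding conj by (simp add: cnj2_subst2)
  moreover have "cnj2 S = S'"
    by (simp add: S_def S'_def cnj2_subst2 cnj2_diag2)
  ultimately have conj_cnj: "subst2 (cnj2 X) N (cnj2 N) = const2 (cnj \<mu>) * (cnj2 X * S')"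
    by (simp add: cnj2_mult cnj2_const2)
  have SS: "S * S' = 1"
    by (simp add: S_def S'_def EE diag2_1 subst2_1 flip: subst2_mult[OF X0] diag2_mult)
  have "subst2 (X * cnj2 X) N (cnj2 N) = subst2 X N (cnj2 N) * subst2 (cnj2 X) N (cnj2 N)"
    using N0 by (intro subst2_mult) simp_all
  also have "\<dots> = const2 (\<mu> * cnj \<mu>) * (X * cnj2 X) * (S * S')"
    unfolding conj[symmetric] conj_cnj const2_simps by (simp only: mult_ac)
  \<comment> \<open>The trivial factors \<open>const2 1\<close> and \<open>diag2 1\<close> give the
    equation the shape that \<open>resonant_coeffs_only\<close> expects.\<close>
  finally have J: "const2 1 * (diag2 1 * (X * cnj2 X)) = subst2 (X * cnj2 X) N (cnj2 N)"
    by (simp add: SS \<mu> diag2_1)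
  \<comment> \<open>\<open>X X'\<close> is a formal first integral of \<open>N\<close>. Knowing that it is a series in \<open>z z'\<close>
      turns the conjugacy equation into one that is linear in \<open>X\<close>.\<close>
  have "coeff2 (X * cnj2 X) m n = 0" if "m \<noteq> n" for m n
    using unit_rotation_power_eq[OF \<omega> \<mu>_def, of m n 0] that
    by (intro resonant_coeffs_only[OF \<mu> E0(1) _ N J]) auto
  then obtain j where j: "X * cnj2 X = diag2 j" using fps2_eq_diag2I by blast
  then obtain e where e: "S = diag2 e" unfolding S_def using subst2_diag2_diag2 by blast
  have "fps_nth e 0 = coeff2 S 0 0" by (simp add: e coeff2_diag2)
  then have e0: "fps_nth e 0 = 1" by (simp add: S_def coeff2_diag2 E0)
  have conj': "const2 \<mu> * (diag2 e * X) = subst2 X N (cnj2 N)"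
    using conj by (simp add: e mult.commute)
  have "coeff2 X m n = 0" if "m \<noteq> Suc n" for m n
    using unit_rotation_power_eq[OF \<omega> \<mu>_def, of m n 1] that
    by (intro resonant_coeffs_only[OF \<mu> E0(1) e0 N conj']) auto
  then obtain x where x: "X = var_z * diag2 x" using fps2_eq_var_z_diag2I by blast
  have cX: "cnj2 X = var_zbar * diag2 (cnj1 x)" by (simp add: x cnj2_mult cnj2_diag2)
  \<comment> \<open>X maps t = \<open>z z'\<close> to t x(t) x'(t), with x' the conjugate series,
    and its Jacobian is the derivative of this function of t. As this function vanishes at 0 and has
    derivative 1, it is t, so X preserves \<open>z z'\<close>.\<close>
  have "1 = diag2 (fps_deriv (fps_X * (x * cnj1 x)))"
    using X(2) unfolding formal_symplectic_def cX unfolding x deriv_z.mult deriv_zbar.mult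
      deriv_z_diag2 deriv_zbar_diag2
    by (simp add: diag2_add diag2_mult diag2_fps_X algebra_simps)
  then have "fps_deriv (fps_X * (x * cnj1 x)) = fps_deriv fps_X"
    by (simp flip: diag2_1)
  then have "fps_X * (x * cnj1 x) = fps_X * 1"
    unfolding fps_deriv_eq_iff by simp
  then have xx: "x * cnj1 x = 1" by simp
  have "X * cnj2 X = var_z * var_zbar * diag2 (x * cnj1 x)"
    by (simp add: x cnj2_mult cnj2_diag2 diag2_mult algebra_simps)
  then have S: "S = diag2 E'" unfolding S_def by (intro subst2_diag2_eq) (simp add: xx diag2_1)
  have "N * cnj2 N = const2 (\<mu> * cnj \<mu>) * (var_z * var_zbar * diag2 (E * cnj1 E))"
    by (simp add: N cnj2_mult cnj2_const2 cnj2_diag2 diag2_mult const2_simps algebra_simps)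
  then have "subst2 (diag2 x) N (cnj2 N) = diag2 x"
    by (intro subst2_diag2_eq) (simp add: \<mu> EE diag2_1 const2_simps)
  then have "const2 \<mu> * (X * diag2 E') = N * diag2 x"
    using conj N0 by (simp add: S) (simp add: x subst2_mult subst2_var_z)
  then have "const2 \<mu> * var_z * diag2 x * diag2 E' = const2 \<mu> * var_z * diag2 x * diag2 E"
    by (simp add: x N algebra_simps)
  moreover have "const2 \<mu> * var_z * diag2 x \<noteq> 0"
  proof
    assume "const2 \<mu> * var_z * diag2 x = 0"
    then have "coeff2 (const2 \<mu> * (var_z * diag2 x)) 1 0 = 0"
      by (simp only: mult.assoc coeff2_0)
    then show False using X1 \<mu> unfolding coeff2_const2_mult x[symmetric] by auto
  qed
  ultimately have "E' = E" by simp
  then show ?thesis using k by (metis E'_def E_def nf_factor_inj)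
qed

section \<open>Convergent power series in two complex variables\<close>

text \<open>Cauchy's estimates on a polydisc. Convergence is encoded by them because shifts,
  derivatives and division of coefficients by integers preserve them, up to a change of
  constants.\<close>

definition coeffs_bounded :: "fps2 \<Rightarrow> real \<Rightarrow> real \<Rightarrow> bool" where
  "coeffs_bounded A C r \<longleftrightarrow> r > 0 \<and> (\<forall>m n. norm (coeff2 A m n) * r ^ (m + n) \<le> C)"

definition convergent2 :: "fps2 \<Rightarrow> bool" where
  "convergent2 A \<longleftrightarrow> (\<exists>C r. coeffs_bounded A C r)"

text \<open>The value is 0 where the series is not summable, so facts about \<open>pser\<close> are
  stated near the origin or on a polydisc of known estimates.\<close>

definition pser :: "fps2 \<Rightarrow> complex \<times> complex \<Rightarrow> complex" where
  "pser A p = (\<Sum>\<^sub>\<infinity>(m, n). coeff2 A m n * fst p ^ m * snd p ^ n)"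

lemma coeffs_bounded_mono:
  assumes "coeffs_bounded A C r" "0 < r'" "r' \<le> r" "C \<le> C'"
  shows "coeffs_bounded A C' r'"
  unfolding coeffs_bounded_def
proof (intro conjI allI)
  fix m n
  have "norm (coeff2 A m n) * r' ^ (m + n) \<le> norm (coeff2 A m n) * r ^ (m + n)"
    using assms by (intro mult_left_mono power_mono) auto
  also have "\<dots> \<le> C" using assms by (simp add: coeffs_bounded_def)
  finally show "norm (coeff2 A m n) * r' ^ (m + n) \<le> C'" using assms by simp
qed fact

lemma coeffs_bounded_nonneg:
  assumes "coeffs_bounded A C r"
  shows "C \<ge> 0"
proof -
  have "norm (coeff2 A 0 0) * r ^ (0 + 0) \<le> C" using assms unfolding coeffs_bounded_def by blast
  then have "norm (coeff2 A 0 0) \<le> C" by simp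
  with norm_ge_zero show ?thesis by (rule order_trans)
qed

lemma geometric_double_summable:
  assumes "0 \<le> q" "q < (1::real)"
  shows "(\<lambda>(m::nat, n::nat). C * q ^ m * q ^ n) summable_on UNIV"
proof -
  have s: "((\<lambda>n. q ^ n) has_sum (1 / (1 - q))) UNIV"
    using assms by (intro sums_nonneg_imp_has_sum geometric_sums) auto
  have "(\<lambda>(m::nat, n::nat). q ^ m * q ^ n) summable_on Sigma UNIV (\<lambda>_. UNIV)"
  proof (rule summable_on_SigmaI)
    show "((\<lambda>n. case (m, n) of (m, n) \<Rightarrow> q ^ m * q ^ n) has_sum (q ^ m * (1 / (1 - q)))) UNIV" for m :: nat
      using has_sum_cmult_right[OF s] by simp
    show "(\<lambda>m. q ^ m * (1 / (1 - q))) summable_on UNIV"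
      using has_sum_cmult_left[OF s] summable_on_def by blast
  qed (use assms in auto)
  then have "(\<lambda>x. C * (case x of (m, n) \<Rightarrow> q ^ m * q ^ n)) summable_on UNIV"
    by (intro summable_on_cmult_right) simp
  then show ?thesis by (simp add: case_prod_unfold mult.assoc)
qed

lemma pser_term_bound:
  assumes "coeffs_bounded A C r" "norm z \<le> r / 4" "norm w \<le> r / 4"
  shows "norm (coeff2 A m n * z ^ m * w ^ n) \<le> C * (1 / 4) ^ m * (1 / 4) ^ n"
proof -
  have "norm (coeff2 A m n * z ^ m * w ^ n) \<le> norm (coeff2 A m n) * (r / 4) ^ m * (r / 4) ^ n"
    unfolding norm_mult norm_power using assms by (intro mult_mono power_mono) (auto simp: coeffs_bounded_def)
  also have "\<dots> = (norm (coeff2 A m n) * r ^ (m + n)) * (1 / 4) ^ m * (1 / 4) ^ n"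
    by (simp add: power_add power_divide)
  also have "\<dots> \<le> C * (1 / 4) ^ m * (1 / 4) ^ n"
    using assms by (intro mult_right_mono) (auto simp: coeffs_bounded_def)
  finally show ?thesis .
qed

lemma pser_has_sum:
  assumes "coeffs_bounded A C r" "norm z \<le> r / 4" "norm w \<le> r / 4"
  shows "((\<lambda>(m, n). coeff2 A m n * z ^ m * w ^ n) has_sum pser A (z, w)) UNIV"
proof -
  have "(\<lambda>k. norm (case k of (m, n) \<Rightarrow> coeff2 A m n * z ^ m * w ^ n)) summable_on UNIV"
  proof (rule Infinite_Sum.abs_summable_on_comparison_test')
    show "(\<lambda>(m::nat, n::nat). C * (1 / 4) ^ m * (1 / 4 :: real) ^ n) summable_on UNIV"
      by (rule geometric_double_summable) simp_all
    show "norm (case k of (m, n) \<Rightarrow> coeff2 A m n * z ^ m * w ^ n)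
        \<le> (case k of (m, n) \<Rightarrow> C * (1 / 4) ^ m * (1 / 4) ^ n)" for k
      using pser_term_bound[OF assms, of "fst k" "snd k"] by (simp only: case_prod_unfold)
  qed
  then show ?thesis
    unfolding pser_def fst_conv snd_conv by (rule has_sum_infsum[OF abs_summable_summable])
qed

text \<open>Halving the radius absorbs the polynomial factor, since (m + 1)(n + 1) \<le> 2^m 2^n;
  the shift of indices only costs the constant r^(p + q).\<close>

lemma convergent2_dominated:
  assumes "convergent2 A" "K \<ge> 0"
    and dom: "\<And>m n. norm (coeff2 B m n) \<le> K * (real (Suc m) * real (Suc n)) * norm (coeff2 A (m + p) (n + q))"
  shows "convergent2 B"
proof -
  obtain C r where A: "coeffs_bounded A C r" using assms(1) by (auto simp: convergent2_def)
  have r: "r > 0" and C: "C \<ge> 0" using A coeffs_bounded_nonneg by (auto simp: coeffs_bounded_def)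
  have "coeffs_bounded B (K * (C / r ^ (p + q))) (r / 2)"
    unfolding coeffs_bounded_def
  proof (intro conjI allI)
    fix m n
    have e: "real (Suc m) * real (Suc n) \<le> 2 ^ m * 2 ^ n"
      by (intro mult_mono) (metis Suc_leI of_nat_le_iff of_nat_numeral of_nat_power less_exp,
          metis Suc_leI of_nat_le_iff of_nat_numeral of_nat_power less_exp, auto)
    have "norm (coeff2 B m n) * (r / 2) ^ (m + n)
      \<le> (K * (real (Suc m) * real (Suc n)) * norm (coeff2 A (m + p) (n + q))) * (r / 2) ^ (m + n)"
      using r by (intro mult_right_mono dom) auto
    also have "\<dots> \<le> (K * (2 ^ m * 2 ^ n) * norm (coeff2 A (m + p) (n + q))) * (r / 2) ^ (m + n)"
      using r e assms(2) by (intro mult_right_mono mult_left_mono) auto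
    also have "\<dots> = K * (norm (coeff2 A (m + p) (n + q)) * r ^ ((m + p) + (n + q)) / r ^ (p + q))"
      using r by (simp add: power_add power_divide)
    also have "\<dots> \<le> K * (C / r ^ (p + q))"
      using A r assms(2) unfolding coeffs_bounded_def by (intro mult_left_mono divide_right_mono) auto
    finally show "norm (coeff2 B m n) * (r / 2) ^ (m + n) \<le> K * (C / r ^ (p + q))" .
  qed (use r in simp)
  then show ?thesis by (auto simp: convergent2_def)
qed

lemma convergent2_shifted:
  assumes "convergent2 A" "\<And>m n. norm (coeff2 B m n) \<le> norm (coeff2 A (m + p) (n + q))"
  shows "convergent2 B"
proof (rule convergent2_dominated[OF assms(1), of 1])
  fix m n
  have "1 * norm (coeff2 A (m + p) (n + q)) \<le> (real (Suc m) * real (Suc n)) * norm (coeff2 A (m + p) (n + q))"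
    by (rule mult_right_mono) (simp_all add: algebra_simps)
  with assms(2)[of m n]
  show "norm (coeff2 B m n) \<le> 1 * (real (Suc m) * real (Suc n)) * norm (coeff2 A (m + p) (n + q))" by linarith
qed simp

lemma convergent2_deriv_z:
  assumes "convergent2 A"
  shows "convergent2 (deriv_z A)"
proof (rule convergent2_dominated[OF assms, of 1 _ 1 0])
  fix m n
  have "real (Suc m) * norm (coeff2 A (Suc m) n) \<le> real (Suc m) * real (Suc n) * norm (coeff2 A (Suc m) n)"
    by (intro mult_right_mono) (simp_all add: algebra_simps)
  then show "norm (coeff2 (deriv_z A) m n) \<le> 1 * (real (Suc m) * real (Suc n)) * norm (coeff2 A (m + 1) (n + 0))"
    by (simp add: norm_mult del: of_nat_Suc)
qed simp

lemma convergent2_deriv_zbar: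
  assumes "convergent2 A"
  shows "convergent2 (deriv_zbar A)"
proof (rule convergent2_dominated[OF assms, of 1 _ 0 1])
  fix m n
  have "real (Suc n) * norm (coeff2 A m (Suc n)) \<le> real (Suc m) * real (Suc n) * norm (coeff2 A m (Suc n))"
    by (intro mult_right_mono) (simp_all add: algebra_simps)
  then show "norm (coeff2 (deriv_zbar A) m n) \<le> 1 * (real (Suc m) * real (Suc n)) * norm (coeff2 A (m + 0) (n + 1))"
    by (simp add: norm_mult del: of_nat_Suc)
qed simp

lemma sums_tail_bound:
  fixes D :: "nat \<Rightarrow> 'a::banach"
  assumes "D sums G" "\<And>i. norm (D i) \<le> M i" "summable M"
  shows "norm ((\<Sum>i<n. D i) - G) \<le> (\<Sum>i. M (i + n))"
proof -
  have "G - (\<Sum>i<n. D i) = (\<Sum>i. D (i + n))"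
    using suminf_minus_initial_segment[of D n] assms(1) by (simp add: sums_iff)
  then have "norm ((\<Sum>i<n. D i) - G) = norm (\<Sum>i. D (i + n))"
    by (metis norm_minus_commute)
  also have "\<dots> \<le> (\<Sum>i. M (i + n))"
    using assms(2,3) by (intro norm_suminf_le summable_ignore_initial_segment)
  finally show ?thesis .
qed

lemma has_sum_prod_decode:
  assumes "(f has_sum (S :: 'a::real_normed_vector)) UNIV"
  shows "(\<lambda>i. f (prod_decode i)) sums S"
  using assms has_sum_reindex_bij_betw[OF bij_prod_decode, of f S] has_sum_imp_sums by blast

text \<open>Termwise differentiation. \<open>has_derivative_series\<close> is about sequences of
  functions on a convex set, so the double series is enumerated by \<open>prod_decode\<close>, and a
  summable majorant independent of the point gives uniform convergence of the derivatives.\<close>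

lemma pser_has_derivative:
  assumes A: "coeffs_bounded A C r"
    and A1: "coeffs_bounded (deriv_z A) C r" and A2: "coeffs_bounded (deriv_zbar A) C r"
    and p: "norm (fst p) < r / 4" "norm (snd p) < r / 4"
  shows "(pser A has_derivative
      (\<lambda>h. pser (deriv_z A) p * fst h + pser (deriv_zbar A) p * snd h)) (at p)"
proof -
  define S where "S = ball (0::complex) (r / 4) \<times> ball (0::complex) (r / 4)"
  have S: "convex S" "open S" "p \<in> S"
    using p by (auto simp: S_def convex_Times open_Times mem_Times_iff)
  have C: "C \<ge> 0" using A by (rule coeffs_bounded_nonneg)
  have Sle: "norm (fst x) \<le> r / 4" "norm (snd x) \<le> r / 4" if "x \<in> S" for x
    using that by (auto simp: S_def)
  define T where "T = (\<lambda>k x. coeff2 A (fst k) (snd k) * fst x ^ fst k * snd x ^ snd k)"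
  define D1 where "D1 = (\<lambda>k x. coeff2 A (fst k) (snd k) * (of_nat (fst k) * fst x ^ (fst k - 1)) * snd x ^ snd k)"
  define D2 where "D2 = (\<lambda>k x. coeff2 A (fst k) (snd k) * fst x ^ fst k * (of_nat (snd k) * snd x ^ (snd k - 1)))"
  \<comment> \<open>The factor 4 makes up for the power of 1/4 that is lost with the exponent when a
    monomial is differentiated; the same majorant then serves both partial derivatives.\<close>
  define M where "M = (\<lambda>k. 4 * C * (1 / 4) ^ fst k * (1 / 4 :: real) ^ snd k)"
  have sT: "((\<lambda>k. T k x) has_sum pser A x) UNIV" if "x \<in> S" for x
    using pser_has_sum[OF A Sle[OF that]] by (simp add: T_def case_prod_unfold)
  have sD1: "((\<lambda>k. D1 k x) has_sum pser (deriv_z A) x) UNIV" if "x \<in> S" for x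
  proof -
    have "((\<lambda>(m, n). coeff2 (deriv_z A) m n * fst x ^ m * snd x ^ n) has_sum pser (deriv_z A) x) UNIV"
      using pser_has_sum[OF A1 Sle[OF that]] by simp
    also have "?this \<longleftrightarrow> ((\<lambda>k. D1 k x) has_sum pser (deriv_z A) x) {k. fst k > 0}"
      by (rule has_sum_reindex_bij_witness[of _ "\<lambda>(m, n). (m - 1, n)" "\<lambda>(m, n). (Suc m, n)"])
        (auto simp: D1_def)
    also have "\<dots> \<longleftrightarrow> ((\<lambda>k. D1 k x) has_sum pser (deriv_z A) x) UNIV"
      by (rule has_sum_cong_neutral) (auto simp: D1_def)
    finally show ?thesis .
  qed
  have sD2: "((\<lambda>k. D2 k x) has_sum pser (deriv_zbar A) x) UNIV" if "x \<in> S" for x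
  proof -
    have "((\<lambda>(m, n). coeff2 (deriv_zbar A) m n * fst x ^ m * snd x ^ n) has_sum pser (deriv_zbar A) x) UNIV"
      using pser_has_sum[OF A2 Sle[OF that]] by simp
    also have "?this \<longleftrightarrow> ((\<lambda>k. D2 k x) has_sum pser (deriv_zbar A) x) {k. snd k > 0}"
      by (rule has_sum_reindex_bij_witness[of _ "\<lambda>(m, n). (m, n - 1)" "\<lambda>(m, n). (m, Suc n)"])
        (auto simp: D2_def)
    also have "\<dots> \<longleftrightarrow> ((\<lambda>k. D2 k x) has_sum pser (deriv_zbar A) x) UNIV"
      by (rule has_sum_cong_neutral) (auto simp: D2_def)
    finally show ?thesis .
  qed
  have bD1: "norm (D1 k x) \<le> M k" if "x \<in> S" for k x
  proof (cases "fst k")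
    case (Suc m)
    then show ?thesis
      using pser_term_bound[OF A1 Sle[OF that], of m "snd k"] by (simp add: D1_def M_def mult_ac)
  qed (use C in \<open>simp add: D1_def M_def\<close>)
  have bD2: "norm (D2 k x) \<le> M k" if "x \<in> S" for k x
  proof (cases "snd k")
    case (Suc n)
    then show ?thesis
      using pser_term_bound[OF A2 Sle[OF that], of "fst k" n] by (simp add: D2_def M_def mult_ac)
  qed (use C in \<open>simp add: D2_def M_def\<close>)
  have "M summable_on UNIV"
    using geometric_double_summable[of "1/4" "4 * C"] by (simp add: M_def case_prod_unfold)
  then have "(M has_sum infsum M UNIV) UNIV" by simp
  then have sM: "summable (\<lambda>i. M (prod_decode i))"
    using has_sum_prod_decode sums_summable by blast
  have "\<exists>g. \<forall>x\<in>S. (\<lambda>i. T (prod_decode i) x) sums g x \<and>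
     (g has_derivative (\<lambda>h. pser (deriv_z A) x * fst h + pser (deriv_zbar A) x * snd h)) (at x within S)"
  proof (rule has_derivative_series[OF S(1) _ _ S(3)])
    show "(\<lambda>i. T (prod_decode i) p) sums pser A p"
      by (rule has_sum_prod_decode[OF sT[OF S(3)]])
    show "(T (prod_decode i) has_derivative
        (\<lambda>h. D1 (prod_decode i) x * fst h + D2 (prod_decode i) x * snd h)) (at x within S)" for i x
      unfolding T_def D1_def D2_def
      by (auto intro!: derivative_eq_intros simp: fun_eq_iff algebra_simps)
    \<comment> \<open>The error is split evenly between the two partial derivatives, as each
      component of h is bounded by the norm of h.\<close>
    fix e :: real assume "e > 0"
    then obtain N where N: "\<And>n. n \<ge> N \<Longrightarrow> norm (\<Sum>i. M (prod_decode (i + n))) < e / 2"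
      using suminf_exist_split[OF _ sM, of "e / 2"] by auto
    show "\<forall>\<^sub>F n in sequentially. \<forall>x\<in>S. \<forall>h. norm ((\<Sum>i<n. D1 (prod_decode i) x * fst h
        + D2 (prod_decode i) x * snd h) - (pser (deriv_z A) x * fst h + pser (deriv_zbar A) x * snd h)) \<le> e * norm h"
      unfolding eventually_sequentially
    proof (intro exI[of _ N] allI impI ballI)
      fix n x and h :: "complex \<times> complex" assume n: "n \<ge> N" and x: "x \<in> S"
      let ?d = "(\<Sum>i<n. D1 (prod_decode i) x * fst h + D2 (prod_decode i) x * snd h)
        - (pser (deriv_z A) x * fst h + pser (deriv_zbar A) x * snd h)"
      let ?E1 = "(\<Sum>i<n. D1 (prod_decode i) x) - pser (deriv_z A) x"
      let ?E2 = "(\<Sum>i<n. D2 (prod_decode i) x) - pser (deriv_zbar A) x"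
      have 1: "norm ?E1 \<le> e / 2"
        using sums_tail_bound[OF has_sum_prod_decode[OF sD1[OF x]] bD1[OF x] sM, of n] N[OF n] by simp
      have 2: "norm ?E2 \<le> e / 2"
        using sums_tail_bound[OF has_sum_prod_decode[OF sD2[OF x]] bD2[OF x] sM, of n] N[OF n] by simp
      have "norm (?E1 * fst h) \<le> e / 2 * norm h" "norm (?E2 * snd h) \<le> e / 2 * norm h"
        unfolding norm_mult
        using 1 2 \<open>e > 0\<close> norm_fst_le[of "fst h" "snd h"] norm_snd_le[of "snd h" "fst h"]
        by (auto intro!: mult_mono norm_ge_zero simp only: prod.collapse)
      then have "norm (?E1 * fst h + ?E2 * snd h) \<le> e * norm h"
        by (intro norm_triangle_le) simp
      moreover have "?d = ?E1 * fst h + ?E2 * snd h"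
        unfolding sum.distrib left_diff_distrib sum_distrib_right by simp
      ultimately show "norm ?d \<le> e * norm h" by (simp only:)
    qed
  qed
  then obtain g where g: "\<And>x. x \<in> S \<Longrightarrow> (\<lambda>i. T (prod_decode i) x) sums g x"
    and g': "\<And>x. x \<in> S \<Longrightarrow> (g has_derivative
       (\<lambda>h. pser (deriv_z A) x * fst h + pser (deriv_zbar A) x * snd h)) (at x within S)"
    by blast
  have "g x = pser A x" if "x \<in> S" for x
    using g[OF that] has_sum_prod_decode[OF sT[OF that]] sums_unique2 by blast
  moreover have "(g has_derivative
       (\<lambda>h. pser (deriv_z A) p * fst h + pser (deriv_zbar A) p * snd h)) (at p)"
    using g'[OF S(3)] at_within_open[OF S(3,2)] by simp
  ultimately show ?thesis
    using has_derivative_transform_within_open[OF _ S(2,3)] by blast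
qed

lemma pser_locally:
  assumes "convergent2 A"
  obtains r where "r > 0"
    "\<And>z w. norm z < r \<Longrightarrow> norm w < r \<Longrightarrow>
       ((\<lambda>(m, n). coeff2 A m n * z ^ m * w ^ n) has_sum pser A (z, w)) UNIV"
    "\<And>p. norm (fst p) < r \<Longrightarrow> norm (snd p) < r \<Longrightarrow> (pser A has_derivative
      (\<lambda>h. pser (deriv_z A) p * fst h + pser (deriv_zbar A) p * snd h)) (at p)"
proof -
  obtain C0 r0 where b0: "coeffs_bounded A C0 r0"
    using assms unfolding convergent2_def by (elim exE)
  obtain C1 r1 where b1: "coeffs_bounded (deriv_z A) C1 r1"
    using convergent2_deriv_z[OF assms] unfolding convergent2_def by (elim exE)
  obtain C2 r2 where b2: "coeffs_bounded (deriv_zbar A) C2 r2"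
    using convergent2_deriv_zbar[OF assms] unfolding convergent2_def by (elim exE)
  note b = b0 b1 b2
  define C where "C = max C0 (max C1 C2)"
  define r where "r = min r0 (min r1 r2)"
  have r: "r > 0" using b by (simp add: coeffs_bounded_def r_def)
  have b': "coeffs_bounded A C r" "coeffs_bounded (deriv_z A) C r" "coeffs_bounded (deriv_zbar A) C r"
    using coeffs_bounded_mono[OF b(1) r, of C] coeffs_bounded_mono[OF b(2) r, of C]
      coeffs_bounded_mono[OF b(3) r, of C] by (simp_all add: C_def r_def)
  show ?thesis
    by (rule that[of "r / 4"]) (use r pser_has_sum[OF b'(1)] pser_has_derivative[OF b'] in auto)
qed

lemma pser_has_derivative_locally:
  assumes "convergent2 A"
  shows "\<exists>r>0. \<forall>p\<in>ball 0 r \<times> ball 0 r. (pser A has_derivative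
      (\<lambda>h. pser (deriv_z A) p * fst h + pser (deriv_zbar A) p * snd h)) (at p)"
  by (rule pser_locally[OF assms], rule exI, rule conjI, assumption) (simp add: mem_Times_iff)

subsection \<open>Germs of holomorphic functions of two variables\<close>

text \<open>
  Continuity of the partial derivatives is part of the definition, so that one may differentiate
  under the integral sign in Cauchy's formula and apply the inverse function theorem.
\<close>

definition hol2 :: "(complex \<times> complex \<Rightarrow> complex) \<Rightarrow> bool" where
  "hol2 F \<longleftrightarrow> (\<exists>S a b. open S \<and> 0 \<in> S \<and> continuous_on S a \<and> continuous_on S b \<and>
     (\<forall>p\<in>S. (F has_derivative (\<lambda>h. a p * fst h + b p * snd h)) (at p)))"

lemma hol2_pser:
  assumes "convergent2 A"
  shows "hol2 (pser A)"
proof -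
  obtain r where r: "r > 0" "\<forall>p\<in>ball 0 r \<times> ball 0 r. (pser A has_derivative
      (\<lambda>h. pser (deriv_z A) p * fst h + pser (deriv_zbar A) p * snd h)) (at p)"
    using pser_has_derivative_locally[OF assms] by (elim exE conjE)
  obtain r1 where r1: "r1 > 0" "\<forall>p\<in>ball 0 r1 \<times> ball 0 r1. (pser (deriv_z A) has_derivative
      (\<lambda>h. pser (deriv_z (deriv_z A)) p * fst h + pser (deriv_zbar (deriv_z A)) p * snd h)) (at p)"
    using pser_has_derivative_locally[OF convergent2_deriv_z[OF assms]] by (elim exE conjE)
  obtain r2 where r2: "r2 > 0" "\<forall>p\<in>ball 0 r2 \<times> ball 0 r2. (pser (deriv_zbar A) has_derivative
      (\<lambda>h. pser (deriv_z (deriv_zbar A)) p * fst h + pser (deriv_zbar (deriv_zbar A)) p * snd h)) (at p)"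
    using pser_has_derivative_locally[OF convergent2_deriv_zbar[OF assms]] by (elim exE conjE)
  define R where "R = min r (min r1 r2)"
  define S where "S = ball (0::complex) R \<times> ball (0::complex) R"
  have "open S" "0 \<in> S" using r(1) r1(1) r2(1) by (auto simp: S_def R_def open_Times zero_prod_def)
  moreover have "continuous_on S (pser (deriv_z A))" "continuous_on S (pser (deriv_zbar A))"
    by (intro continuous_at_imp_continuous_on ballI has_derivative_continuous[OF bspec[OF r1(2)]]
        has_derivative_continuous[OF bspec[OF r2(2)]], simp add: S_def R_def mem_Times_iff)+
  moreover have "\<forall>p\<in>S. (pser A has_derivative
      (\<lambda>h. pser (deriv_z A) p * fst h + pser (deriv_zbar A) p * snd h)) (at p)"
    by (intro ballI bspec[OF r(2)]) (simp add: S_def R_def mem_Times_iff)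
  ultimately show ?thesis
    unfolding hol2_def
    by (intro exI[of _ S] exI[of _ "pser (deriv_z A)"] exI[of _ "pser (deriv_zbar A)"] conjI)
qed

lemma hol2_polydisc:
  assumes "hol2 F"
  obtains r a b where "r > 0"
    "continuous_on (ball 0 r \<times> ball 0 r) a" "continuous_on (ball 0 r \<times> ball 0 r) b"
    "\<And>p. p \<in> ball 0 r \<times> ball 0 r \<Longrightarrow> (F has_derivative (\<lambda>h. a p * fst h + b p * snd h)) (at p)"
proof -
  obtain S a b where S: "open S" "0 \<in> S" "continuous_on S a" "continuous_on S b"
     "\<forall>p\<in>S. (F has_derivative (\<lambda>h. a p * fst h + b p * snd h)) (at p)"
    using assms unfolding hol2_def by (elim exE conjE) (rule that)
  obtain e where e: "e > 0" "ball 0 e \<subseteq> S" using S(1,2) openE by blast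
  have "ball 0 (e / 2) \<times> ball 0 (e / 2) \<subseteq> ball (0 :: complex \<times> complex) e"
  proof
    fix p assume "p \<in> ball (0::complex) (e / 2) \<times> ball (0::complex) (e / 2)"
    then have "norm (fst p) < e / 2" "norm (snd p) < e / 2" by auto
    moreover have "norm p \<le> norm (fst p) + norm (snd p)"
      using norm_Pair_le[of "fst p" "snd p"] by simp
    ultimately show "p \<in> ball 0 e" by simp
  qed
  then have sub: "ball 0 (e / 2) \<times> ball 0 (e / 2) \<subseteq> S" using e by blast
  show ?thesis
    using e continuous_on_subset[OF S(3) sub] continuous_on_subset[OF S(4) sub]
      bspec[OF S(5) subsetD[OF sub]]
    by (intro that[of "e / 2" a b]) simp_all
qed

text \<open>For fixed z, expand in w; the coefficient c n z is a Cauchy integral over a circle in w.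
  Differentiating under the integral, which needs continuity of the partial derivative a, shows that
  it is holomorphic in z, so it can be expanded as well. Cauchy's inequality in each variable bounds
  the double coefficients, which justifies summing in any order.\<close>

theorem osgood:
  assumes "hol2 F"
  obtains A where "convergent2 A" "\<forall>\<^sub>F p in nhds 0. F p = pser A p"
proof -
  obtain R a b where R: "R > 0"
    and cont: "continuous_on (ball 0 R \<times> ball 0 R) a" "continuous_on (ball 0 R \<times> ball 0 R) b"
    and der: "\<And>p. p \<in> ball 0 R \<times> ball 0 R \<Longrightarrow> (F has_derivative (\<lambda>h. a p * fst h + b p * snd h)) (at p)"
    using hol2_polydisc[OF assms] by blast
  have dz: "((\<lambda>z. F (z, w)) has_field_derivative a (z, w)) (at z)"
    if "norm z < R" "norm w < R" for z w
  proof -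
    have "((\<lambda>z. F (z, w)) has_derivative (\<lambda>h. a (z, w) * fst (h, 0::complex) + b (z, w) * snd (h, 0::complex))) (at z)"
      by (rule has_derivative_compose[of "\<lambda>z. (z, w)" "\<lambda>h. (h, 0)" z UNIV F, OF _ der])
        (use that in \<open>auto intro!: derivative_eq_intros\<close>)
    then show ?thesis by (simp add: has_field_derivative_def)
  qed
  have dw: "((\<lambda>w. F (z, w)) has_field_derivative b (z, w)) (at w)"
    if "norm z < R" "norm w < R" for z w
  proof -
    have "((\<lambda>w. F (z, w)) has_derivative (\<lambda>h. a (z, w) * fst (0::complex, h) + b (z, w) * snd (0::complex, h))) (at w)"
      by (rule has_derivative_compose[of "\<lambda>w. (z, w)" "\<lambda>h. (0, h)" w UNIV F, OF _ der])
        (use that in \<open>auto intro!: derivative_eq_intros\<close>)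
    then show ?thesis by (simp add: has_field_derivative_def)
  qed
  have contF: "continuous_on (ball 0 R \<times> ball 0 R) F"
    using der has_derivative_continuous by (intro continuous_at_imp_continuous_on) blast
  define r where "r = R / 2"
  have r: "0 < r" "r < R" using R by (simp_all add: r_def)
  define c where "c = (\<lambda>n z. (deriv ^^ n) (\<lambda>w. F (z, w)) 0 / fact n)"
  define A where "A = Abs_fps2 (\<lambda>m n. (deriv ^^ m) (c n) 0 / fact m)"
  have holw: "(\<lambda>w. F (z, w)) holomorphic_on ball 0 R" if "norm z < R" for z
    unfolding holomorphic_on_open[OF open_ball]
  proof
    fix w assume "w \<in> ball (0::complex) R"
    then show "\<exists>d. ((\<lambda>w. F (z, w)) has_field_derivative d) (at w)"
      using dw[OF that, of w] by auto
  qed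
  have holr: "(\<lambda>w. F (z, w)) holomorphic_on ball 0 r" "continuous_on (cball 0 r) (\<lambda>w. F (z, w))"
    if "norm z < R" for z
    by (rule holomorphic_on_subset[OF holw] holomorphic_on_imp_continuous_on[OF holomorphic_on_subset[OF holw]],
        use that r in auto)+
  have "compact (cball (0::complex) r \<times> cball (0::complex) r)"
    by (intro compact_Times compact_cball)
  moreover have "continuous_on (cball 0 r \<times> cball 0 r) F"
    by (rule continuous_on_subset[OF contF]) (use r in auto)
  ultimately have "bounded (F ` (cball 0 r \<times> cball 0 r))"
    by (intro compact_imp_bounded compact_continuous_image)
  then obtain B where B: "\<And>z w. norm z \<le> r \<Longrightarrow> norm w \<le> r \<Longrightarrow> norm (F (z, w)) \<le> B"
    unfolding bounded_iff by force
  have c_bound: "norm (c n z) \<le> B / r ^ n" if "norm z \<le> r" for n z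
  proof -
    have "norm ((deriv ^^ n) (\<lambda>w. F (z, w)) 0) \<le> fact n * B / r ^ n"
      by (rule Cauchy_inequality[OF holr]) (use that r B in auto)
    then show ?thesis by (simp add: c_def norm_divide field_simps)
  qed
  have c_hol: "c n holomorphic_on ball 0 R" for n
  proof -
    \<comment> \<open>Cauchy's kernel together with the velocity of the circle: the contour integral
      becomes an integral over [0,1], to which \<open>leibniz_rule_holomorphic\<close>
      applies.\<close>
    define k where "k = (\<lambda>t. vector_derivative (circlepath 0 r) (at t) / circlepath 0 r t ^ Suc n)"
    have nz: "circlepath 0 r t \<noteq> 0" "norm (circlepath 0 r t) = r" for t
      using r by (auto simp: circlepath norm_mult)
    have "continuous_on {0..1} (\<lambda>t. 2 * pi * \<i> * r * exp (2 * of_real pi * \<i> * t) / circlepath 0 r t ^ Suc n)"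
      unfolding circlepath using r by (intro continuous_intros) auto
    then have k: "continuous_on {0..1} k"
      unfolding k_def vector_derivative_circlepath by simp
    have pc: "continuous_on T (circlepath 0 r)" for T
      unfolding circlepath by (intro continuous_intros)
    have "(\<lambda>z. integral (cbox 0 1) (\<lambda>t. F (z, circlepath 0 r t) * k t)) holomorphic_on ball 0 R"
    proof (rule leibniz_rule_holomorphic)
      fix z t assume z: "z \<in> ball (0::complex) R" and t: "t \<in> cbox (0::real) 1"
      show "((\<lambda>z. F (z, circlepath 0 r t) * k t) has_field_derivative a (z, circlepath 0 r t) * k t) (at z within ball 0 R)"
        by (rule DERIV_cmult_right, rule DERIV_subset[OF dz]) (use z r nz in auto)
    next
      fix z assume z: "z \<in> ball (0::complex) R"
      show "(\<lambda>t. F (z, circlepath 0 r t) * k t) integrable_on cbox 0 1"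
      proof (intro integrable_continuous continuous_intros)
        show "continuous_on (cbox 0 1) k" using k by simp
        show "continuous_on (cbox 0 1) (\<lambda>t. F (z, circlepath 0 r t))"
          by (rule continuous_on_compose2[OF contF]) (use z r nz in \<open>auto intro!: continuous_intros pc\<close>)
      qed
    next
      have "continuous_on (ball 0 R \<times> {0..1}) (\<lambda>p. a (fst p, circlepath 0 r (snd p)) * k (snd p))"
      proof (intro continuous_intros)
        show "continuous_on (ball 0 R \<times> {0..1}) (\<lambda>p. k (snd p))"
          by (rule continuous_on_compose2[OF k]) (auto intro!: continuous_intros)
        show "continuous_on (ball 0 R \<times> {0..1}) (\<lambda>p. a (fst p, circlepath 0 r (snd p)))"
          by (rule continuous_on_compose2[OF cont(1)])
            (use r nz in \<open>auto intro!: continuous_intros continuous_on_compose2[OF pc[of UNIV]]\<close>)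
      qed
      then show "continuous_on (ball 0 R \<times> cbox 0 1) (\<lambda>(z, t). a (z, circlepath 0 r t) * k t)"
        by (simp add: case_prod_unfold)
    qed auto
    then have "(\<lambda>z. 1 / (2 * pi * \<i>) * integral (cbox 0 1) (\<lambda>t. F (z, circlepath 0 r t) * k t)) holomorphic_on ball 0 R"
      by (intro holomorphic_intros)
    moreover have "1 / (2 * pi * \<i>) * integral (cbox 0 1) (\<lambda>t. F (z, circlepath 0 r t) * k t) = c n z"
      if "z \<in> ball 0 R" for z
    proof -
      have "(deriv ^^ n) (\<lambda>w. F (z, w)) 0 = fact n / (2 * pi * \<i>) *
          contour_integral (circlepath 0 r) (\<lambda>u. F (z, u) / (u - 0) ^ Suc n)"
        by (rule Cauchy_higher_derivative_integral_circlepath(2)[OF holr(2,1)]) (use that r in auto)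
      then show ?thesis
        by (simp add: c_def contour_integral_integral k_def)
    qed
    ultimately show ?thesis by (rule holomorphic_transform)
  qed
  have "norm (coeff2 A m n) * r ^ (m + n) \<le> B" for m n
  proof -
    have "norm ((deriv ^^ m) (c n) 0) \<le> fact m * (B / r ^ n) / r ^ m"
      by (rule Cauchy_inequality)
        (use r c_bound in \<open>auto intro!: holomorphic_on_subset[OF c_hol]
           holomorphic_on_imp_continuous_on[OF holomorphic_on_subset[OF c_hol]]\<close>)
    then have "norm (coeff2 A m n) \<le> B / (r ^ n * r ^ m)"
      by (simp add: A_def norm_divide field_simps)
    then show ?thesis using r by (simp add: field_simps power_add)
  qed
  then have A: "coeffs_bounded A B r" using r by (simp add: coeffs_bounded_def)
  have eq: "F (z, w) = pser A (z, w)" if z: "norm z < r / 4" and w: "norm w < r / 4" for z w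
  proof -
    \<comment> \<open>The indices are swapped so that the inner sum, over m at fixed n, is the
      Taylor series of c n.\<close>
    have s': "((\<lambda>(n, m). coeff2 A m n * z ^ m * w ^ n) has_sum pser A (z, w)) (UNIV \<times> UNIV)"
      using pser_has_sum[OF A, of z w] z w by (subst has_sum_swap) (simp add: case_prod_unfold)
    have "((\<lambda>n. c n z * w ^ n) has_sum pser A (z, w)) UNIV"
    proof (rule has_sum_Sigma'[OF s'])
      fix n
      have "(\<lambda>m. coeff2 A m n * z ^ m) sums c n z"
        using holomorphic_power_series[OF c_hol, of z n] z r by (simp add: A_def)
      moreover have "(\<lambda>(n, m). coeff2 A m n * z ^ m * w ^ n) summable_on Sigma UNIV (\<lambda>_. UNIV)"
        using s' by (auto simp: summable_on_def)
      then have "(\<lambda>m. coeff2 A m n * z ^ m * w ^ n) summable_on UNIV"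
        using summable_on_SigmaD1[of "\<lambda>n m. coeff2 A m n * z ^ m * w ^ n" UNIV "\<lambda>_. UNIV" n] by simp
      then obtain S where S: "((\<lambda>m. coeff2 A m n * z ^ m * w ^ n) has_sum S) UNIV"
        by (auto simp: summable_on_def)
      moreover from this have "(\<lambda>m. coeff2 A m n * z ^ m * w ^ n) sums S" by (rule has_sum_imp_sums)
      ultimately have "S = c n z * w ^ n"
        using sums_mult2 sums_unique2 by blast
      then show "((\<lambda>m. case (n, m) of (n, m) \<Rightarrow> coeff2 A m n * z ^ m * w ^ n) has_sum (c n z * w ^ n)) UNIV"
        using S by simp
    qed
    then have "(\<lambda>n. c n z * w ^ n) sums pser A (z, w)" by (rule has_sum_imp_sums)
    moreover have "(\<lambda>n. c n z * w ^ n) sums F (z, w)"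
      using holomorphic_power_series[OF holw, of z w] z w r by (simp add: c_def)
    ultimately show ?thesis using sums_unique2 by blast
  qed
  have "open (ball (0::complex) (r / 4) \<times> ball (0::complex) (r / 4))"
    by (intro open_Times open_ball)
  then have "\<forall>\<^sub>F p in nhds 0. p \<in> ball (0::complex) (r / 4) \<times> ball (0::complex) (r / 4)"
    by (rule eventually_nhds_in_open) (use r in \<open>auto simp: zero_prod_def\<close>)
  then have "\<forall>\<^sub>F p in nhds 0. F p = pser A p"
    by eventually_elim (use eq in auto)
  then show ?thesis using A that by (auto simp: convergent2_def)
qed

section \<open>Sums, products and compositions of holomorphic germs in two variables\<close>

lemma hol2E:
  assumes "hol2 F"
  obtains S a b where "open S" "0 \<in> S" "continuous_on S F" "continuous_on S a" "continuous_on S b"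
    "\<forall>p\<in>S. (F has_derivative (\<lambda>h. a p * fst h + b p * snd h)) (at p)"
proof -
  obtain S a b where S: "open S" "0 \<in> S" "continuous_on S a" "continuous_on S b"
    and F: "\<forall>p\<in>S. (F has_derivative (\<lambda>h. a p * fst h + b p * snd h)) (at p)"
    using assms unfolding hol2_def by (elim exE conjE) (rule that)
  have "continuous_on S F"
    by (intro continuous_at_imp_continuous_on ballI) (rule has_derivative_continuous[OF bspec[OF F]])
  then show ?thesis using that S F by simp
qed

lemma hol2I:
  assumes "open S" "0 \<in> S" "continuous_on S a" "continuous_on S b"
    "\<And>p. p \<in> S \<Longrightarrow> (F has_derivative (\<lambda>h. a p * fst h + b p * snd h)) (at p)"
  shows "hol2 F"
  unfolding hol2_def using assms by (intro exI[of _ S] exI[of _ a] exI[of _ b]) simp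

lemma hol2_const: "hol2 (\<lambda>p. c)"
  by (rule hol2I[of UNIV "\<lambda>_. 0" "\<lambda>_. 0"]) auto

lemma hol2_fst: "hol2 fst"
  by (rule hol2I[of UNIV "\<lambda>_. 1" "\<lambda>_. 0"]) (auto intro!: derivative_eq_intros)

lemma hol2_snd: "hol2 snd"
  by (rule hol2I[of UNIV "\<lambda>_. 0" "\<lambda>_. 1"]) (auto intro!: derivative_eq_intros)

lemma hol2_add:
  assumes "hol2 F" "hol2 G"
  shows "hol2 (\<lambda>p. F p + G p)"
proof -
  from assms(1) obtain S a b where S: "open S" "0 \<in> S" "continuous_on S a" "continuous_on S b"
    and F: "\<forall>p\<in>S. (F has_derivative (\<lambda>h. a p * fst h + b p * snd h)) (at p)" by (rule hol2E)
  from assms(2) obtain T c d where T: "open T" "0 \<in> T" "continuous_on T c" "continuous_on T d"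
    and G: "\<forall>p\<in>T. (G has_derivative (\<lambda>h. c p * fst h + d p * snd h)) (at p)" by (rule hol2E)
  have ct: "continuous_on (S \<inter> T) a" "continuous_on (S \<inter> T) b"
      "continuous_on (S \<inter> T) c" "continuous_on (S \<inter> T) d"
    using S T by (auto intro: continuous_on_subset)
  show ?thesis
  proof (rule hol2I[of "S \<inter> T" "\<lambda>p. a p + c p" "\<lambda>p. b p + d p"])
    fix p assume p: "p \<in> S \<inter> T"
    have "((\<lambda>p. F p + G p) has_derivative
        (\<lambda>h. (a p * fst h + b p * snd h) + (c p * fst h + d p * snd h))) (at p)"
      by (rule has_derivative_add[OF bspec[OF F] bspec[OF G]]) (use p in auto)
    then show "((\<lambda>p. F p + G p) has_derivative
        (\<lambda>h. (a p + c p) * fst h + (b p + d p) * snd h)) (at p)"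
      by (simp add: algebra_simps)
  qed (use S T ct in \<open>auto intro!: continuous_intros\<close>)
qed

lemma hol2_mult:
  assumes "hol2 F" "hol2 G"
  shows "hol2 (\<lambda>p. F p * G p)"
proof -
  from assms(1) obtain S a b where S: "open S" "0 \<in> S" "continuous_on S F" "continuous_on S a" "continuous_on S b"
    and F: "\<forall>p\<in>S. (F has_derivative (\<lambda>h. a p * fst h + b p * snd h)) (at p)" by (rule hol2E)
  from assms(2) obtain T c d where T: "open T" "0 \<in> T" "continuous_on T G" "continuous_on T c" "continuous_on T d"
    and G: "\<forall>p\<in>T. (G has_derivative (\<lambda>h. c p * fst h + d p * snd h)) (at p)" by (rule hol2E)
  have ct: "continuous_on (S \<inter> T) a" "continuous_on (S \<inter> T) b"
      "continuous_on (S \<inter> T) c" "continuous_on (S \<inter> T) d" "continuous_on (S \<inter> T) F" "continuous_on (S \<inter> T) G"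
    using S T by (auto intro: continuous_on_subset)
  show ?thesis
  proof (rule hol2I[of "S \<inter> T" "\<lambda>p. F p * c p + a p * G p" "\<lambda>p. F p * d p + b p * G p"])
    fix p assume p: "p \<in> S \<inter> T"
    have "((\<lambda>p. F p * G p) has_derivative
        (\<lambda>h. F p * (c p * fst h + d p * snd h) + (a p * fst h + b p * snd h) * G p)) (at p)"
      by (rule has_derivative_mult[OF bspec[OF F] bspec[OF G]]) (use p in auto)
    then show "((\<lambda>p. F p * G p) has_derivative
        (\<lambda>h. (F p * c p + a p * G p) * fst h + (F p * d p + b p * G p) * snd h)) (at p)"
      by (simp add: algebra_simps)
  qed (use S T ct in \<open>auto intro!: continuous_intros\<close>)
qed

lemma hol2_compose:
  assumes "hol2 F" "hol2 P" "hol2 Q" "P 0 = 0" "Q 0 = 0"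
  shows "hol2 (\<lambda>p. F (P p, Q p))"
proof -
  from assms(1) obtain R e f where R: "open R" "0 \<in> R" "continuous_on R e" "continuous_on R f"
    and F: "\<forall>p\<in>R. (F has_derivative (\<lambda>h. e p * fst h + f p * snd h)) (at p)" by (rule hol2E)
  from assms(2) obtain S a b where S: "open S" "0 \<in> S" "continuous_on S P" "continuous_on S a" "continuous_on S b"
    and P: "\<forall>p\<in>S. (P has_derivative (\<lambda>h. a p * fst h + b p * snd h)) (at p)" by (rule hol2E)
  from assms(3) obtain T c d where T: "open T" "0 \<in> T" "continuous_on T Q" "continuous_on T c" "continuous_on T d"
    and Q: "\<forall>p\<in>T. (Q has_derivative (\<lambda>h. c p * fst h + d p * snd h)) (at p)" by (rule hol2E)
  define V where "V = (S \<inter> T) \<inter> (\<lambda>p. (P p, Q p)) -` R"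
  have ct: "continuous_on (S \<inter> T) P" "continuous_on (S \<inter> T) Q"
    using S T by (auto intro: continuous_on_subset)
  then have cPQ: "continuous_on (S \<inter> T) (\<lambda>p. (P p, Q p))" by (intro continuous_on_Pair)
  then have V: "open V" unfolding V_def using S T R by (intro continuous_open_preimage open_Int) auto
  have cPQV: "continuous_on V (\<lambda>p. (P p, Q p))"
    by (rule continuous_on_subset[OF cPQ]) (auto simp: V_def)
  have cV: "continuous_on V (\<lambda>p. e (P p, Q p))" "continuous_on V (\<lambda>p. f (P p, Q p))"
    by (rule continuous_on_compose2[OF R(3) cPQV] continuous_on_compose2[OF R(4) cPQV], force simp: V_def)+
  have cV': "continuous_on V a" "continuous_on V b" "continuous_on V c" "continuous_on V d"
    using S T by (auto intro: continuous_on_subset simp: V_def)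
  show ?thesis
  proof (rule hol2I[of V "\<lambda>p. e (P p, Q p) * a p + f (P p, Q p) * c p" "\<lambda>p. e (P p, Q p) * b p + f (P p, Q p) * d p"])
    show "0 \<in> V" using S T R assms by (simp add: V_def zero_prod_def)
    fix p assume p: "p \<in> V"
    then have p': "p \<in> S" "p \<in> T" "(P p, Q p) \<in> R" by (auto simp: V_def)
    have "((\<lambda>p. (P p, Q p)) has_derivative (\<lambda>h. (a p * fst h + b p * snd h, c p * fst h + d p * snd h))) (at p)"
      by (rule has_derivative_Pair[OF bspec[OF P] bspec[OF Q]]) (use p' in auto)
    from has_derivative_compose[OF this bspec[OF F p'(3)]]
    show "((\<lambda>p. F (P p, Q p)) has_derivative
      (\<lambda>h. (e (P p, Q p) * a p + f (P p, Q p) * c p) * fst h +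
           (e (P p, Q p) * b p + f (P p, Q p) * d p) * snd h)) (at p)"
      by (simp add: algebra_simps)
  qed (intro V cV cV' continuous_intros)+
qed

lemma hol2_holomorphic_compose:
  assumes "hol2 P" "k holomorphic_on D" "open D" "P 0 \<in> D"
  shows "hol2 (\<lambda>p. k (P p))"
proof -
  from assms(1) obtain S a b where S: "open S" "0 \<in> S" "continuous_on S P" "continuous_on S a" "continuous_on S b"
    and P: "\<forall>p\<in>S. (P has_derivative (\<lambda>h. a p * fst h + b p * snd h)) (at p)" by (rule hol2E)
  define V where "V = S \<inter> P -` D"
  have V: "open V" unfolding V_def using S assms by (intro continuous_open_preimage) auto
  have ct: "continuous_on V a" "continuous_on V b" "continuous_on V P"
    using S by (auto intro: continuous_on_subset simp: V_def)
  have cd: "continuous_on V (\<lambda>p. deriv k (P p))"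
    by (rule continuous_on_compose2[OF holomorphic_on_imp_continuous_on[OF holomorphic_deriv[OF assms(2,3)]] ct(3)])
      (auto simp: V_def)
  show ?thesis
  proof (rule hol2I[of V "\<lambda>p. deriv k (P p) * a p" "\<lambda>p. deriv k (P p) * b p"])
    show "0 \<in> V" using S assms by (simp add: V_def)
    fix p assume p: "p \<in> V"
    then have p': "p \<in> S" "P p \<in> D" by (auto simp: V_def)
    have "(k has_derivative (\<lambda>h. deriv k (P p) * h)) (at (P p))"
      using holomorphic_derivI[OF assms(2,3) p'(2)] by (simp add: has_field_derivative_def)
    from has_derivative_compose[OF bspec[OF P p'(1)] this]
    show "((\<lambda>p. k (P p)) has_derivative
      (\<lambda>h. deriv k (P p) * a p * fst h + deriv k (P p) * b p * snd h)) (at p)"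
      by (simp add: algebra_simps)
  qed (intro V cd ct continuous_intros)+
qed

section \<open>Real-analytic germs of the plane\<close>

definition ev :: "fps2 \<Rightarrow> complex \<Rightarrow> complex" where
  "ev A z = pser A (z, cnj z)"

text \<open>Real analyticity at 0, expressed in z and its conjugate instead of x and y so that it
  fits the formal side. \<open>real_analytic_at_imp_ra\<close> and
  \<open>ra_imp_real_analytic_at\<close> compare it with \<open>real_analytic_at\<close>.\<close>

definition ra :: "(complex \<Rightarrow> complex) \<Rightarrow> bool" where
  "ra f \<longleftrightarrow> (\<exists>A. has_expansion2 f A)"

lemma raE: "ra f \<Longrightarrow> (\<And>A. has_expansion2 f A \<Longrightarrow> thesis) \<Longrightarrow> thesis"
  by (auto simp: ra_def)

lemma has_expansion2_ra: "has_expansion2 f A \<Longrightarrow> ra f"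
  by (auto simp: ra_def)

lemma eventually_norm_less: "r > 0 \<Longrightarrow> \<forall>\<^sub>F z in nhds (0::'a::real_normed_vector). norm z < r"
  using eventually_nhds_ball[of r "0::'a"] by simp

lemma eventually_nhds_nhds: "eventually Q (nhds x) \<Longrightarrow> \<forall>\<^sub>F y in nhds x. eventually Q (nhds y)"
  by (simp add: eventually_eventually)

lemma has_expansion2_cong:
  assumes "has_expansion2 f A" "\<forall>\<^sub>F z in nhds 0. f z = g z"
  shows "has_expansion2 g A"
  using assms unfolding has_expansion2_def by eventually_elim simp

lemma convergent2_has_expansion2:
  assumes "convergent2 A"
  shows "has_expansion2 (ev A) A"
proof (rule pser_locally[OF assms])
  fix r assume r: "r > 0" and s: "\<And>z w. norm z < r \<Longrightarrow> norm w < r \<Longrightarrow>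
       ((\<lambda>(m, n). coeff2 A m n * z ^ m * w ^ n) has_sum pser A (z, w)) UNIV"
  show ?thesis
    unfolding has_expansion2_def ev_def using eventually_norm_less[OF r]
    by eventually_elim (rule s, auto)
qed

text \<open>One point with both coordinates of modulus r is enough: a summable complex family is
  absolutely summable, and each term is bounded by the sum of all norms.\<close>

lemma has_sum_imp_convergent2:
  assumes "((\<lambda>(m, n). coeff2 A m n * z ^ m * w ^ n) has_sum S) UNIV" "norm z = r" "norm w = r" "r > 0"
  shows "convergent2 A"
proof -
  let ?f = "\<lambda>k. case k of (m, n) \<Rightarrow> coeff2 A m n * z ^ m * w ^ n"
  have "?f summable_on UNIV" using assms(1) by (auto simp: summable_on_def)
  then have s: "(\<lambda>k. norm (?f k)) summable_on UNIV"
    using summable_on_iff_abs_summable_on_complex by blast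
  have "norm (coeff2 A m n) * r ^ (m + n) \<le> infsum (\<lambda>k. norm (?f k)) UNIV" for m n
  proof -
    have "sum (\<lambda>k. norm (?f k)) {(m, n)} \<le> infsum (\<lambda>k. norm (?f k)) UNIV"
      by (rule finite_sum_le_infsum[OF s]) auto
    then show ?thesis using assms(2,3) by (simp add: norm_mult norm_power power_add mult.assoc)
  qed
  then have "coeffs_bounded A (infsum (\<lambda>k. norm (?f k)) UNIV) r"
    using assms(4) by (simp add: coeffs_bounded_def)
  then show ?thesis unfolding convergent2_def by blast
qed

lemma has_expansion2_convergent2:
  assumes "has_expansion2 f A"
  shows "convergent2 A"
proof -
  obtain r where r: "r > 0" "\<And>z. norm z < r \<Longrightarrow>
      ((\<lambda>(m, n). coeff2 A m n * z ^ m * cnj z ^ n) has_sum f z) UNIV"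
    using assms unfolding has_expansion2_def eventually_nhds_metric by auto
  \<comment> \<open>At the real point r / 2, z and its conjugate both have modulus r / 2.\<close>
  show ?thesis
    by (rule has_sum_imp_convergent2[OF r(2)[of "of_real (r / 2)"], of "r / 2"]) (use r(1) in auto)
qed

lemma has_expansion2_eq_ev:
  assumes "has_expansion2 f A"
  shows "\<forall>\<^sub>F z in nhds 0. f z = ev A z"
  using assms convergent2_has_expansion2[OF has_expansion2_convergent2[OF assms]]
  unfolding has_expansion2_def by eventually_elim (rule has_sum_unique)

lemma has_expansion2_at_0: "has_expansion2 f A \<Longrightarrow> f 0 = coeff2 A 0 0"
proof -
  assume "has_expansion2 f A"
  then have "((\<lambda>(m, n). coeff2 A m n * 0 ^ m * cnj 0 ^ n) has_sum f 0) UNIV"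
    unfolding has_expansion2_def by (rule eventually_nhds_x_imp_x)
  moreover have "((\<lambda>(m, n). coeff2 A m n * 0 ^ m * cnj 0 ^ n) has_sum coeff2 A 0 0) UNIV"
    by (rule has_sum_finite_neutralI[of "{(0, 0)}"]) auto
  ultimately show ?thesis by (rule has_sum_unique)
qed

lemma isCont_tendsto_nhds: "isCont f x \<Longrightarrow> (f \<longlongrightarrow> f x) (nhds x)"
  unfolding isCont_def by (rule tendsto_at_iff_tendsto_nhds[THEN iffD1])

lemma eventually_nhds_Pair_cnj:
  assumes "\<forall>\<^sub>F p in nhds 0. Q p"
  shows "\<forall>\<^sub>F z in nhds 0. Q (z, cnj z)"
proof -
  have "isCont (\<lambda>z. (z, cnj z)) 0" by (intro continuous_intros)
  then have "((\<lambda>z. (z, cnj z)) \<longlongrightarrow> (0, cnj 0)) (nhds 0)" by (rule isCont_tendsto_nhds)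
  then show ?thesis using assms by (auto simp: filterlim_iff zero_prod_def)
qed

lemma ra_iff_hol2: "ra f \<longleftrightarrow> (\<exists>F. hol2 F \<and> (\<forall>\<^sub>F z in nhds 0. f z = F (z, cnj z)))"
proof
  assume "ra f"
  then obtain A where A: "has_expansion2 f A" by (rule raE)
  show "\<exists>F. hol2 F \<and> (\<forall>\<^sub>F z in nhds 0. f z = F (z, cnj z))"
    using hol2_pser[OF has_expansion2_convergent2[OF A]] has_expansion2_eq_ev[OF A]
    by (intro exI[of _ "pser A"]) (simp add: ev_def)
next
  assume "\<exists>F. hol2 F \<and> (\<forall>\<^sub>F z in nhds 0. f z = F (z, cnj z))"
  then obtain F where F: "hol2 F" "\<forall>\<^sub>F z in nhds 0. f z = F (z, cnj z)" by blast
  from osgood[OF F(1)] obtain A where A: "convergent2 A" "\<forall>\<^sub>F p in nhds 0. F p = pser A p" .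
  have "\<forall>\<^sub>F z in nhds 0. ev A z = f z"
    using F(2) eventually_nhds_Pair_cnj[OF A(2)] by eventually_elim (simp add: ev_def)
  then show "ra f"
    using has_expansion2_cong[OF convergent2_has_expansion2[OF A(1)]] has_expansion2_ra by blast
qed

lemma ra_hol2E:
  assumes "ra f"
  obtains F where "hol2 F" "\<forall>\<^sub>F z in nhds 0. f z = F (z, cnj z)" "F 0 = f 0"
proof -
  obtain F where F: "hol2 F" "\<forall>\<^sub>F z in nhds 0. f z = F (z, cnj z)"
    using assms unfolding ra_iff_hol2 by blast
  from eventually_nhds_x_imp_x[OF F(2)] have "F 0 = f 0" by (simp add: zero_prod_def)
  then show ?thesis using that F by blast
qed

section \<open>Algebra and composition of real-analytic germs\<close>

lemma ra_const: "ra (\<lambda>z. c)"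
  unfolding ra_iff_hol2 by (rule exI[of _ "\<lambda>p. c"]) (simp add: hol2_const)

lemma ra_ident: "ra (\<lambda>z. z)"
  unfolding ra_iff_hol2 by (rule exI[of _ fst]) (simp add: hol2_fst)

lemma ra_cnj_ident: "ra (\<lambda>z. cnj z)"
  unfolding ra_iff_hol2 by (rule exI[of _ snd]) (simp add: hol2_snd)

lemma ra_add:
  assumes "ra f" "ra g" shows "ra (\<lambda>z. f z + g z)"
proof -
  obtain F where F: "hol2 F" "\<forall>\<^sub>F z in nhds 0. f z = F (z, cnj z)" using assms(1) by (rule ra_hol2E)
  obtain G where G: "hol2 G" "\<forall>\<^sub>F z in nhds 0. g z = G (z, cnj z)" using assms(2) by (rule ra_hol2E)
  have "\<forall>\<^sub>F z in nhds 0. f z + g z = F (z, cnj z) + G (z, cnj z)"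
    using F(2) G(2) by eventually_elim simp
  then show ?thesis unfolding ra_iff_hol2 using hol2_add[OF F(1) G(1)] by (intro exI conjI)
qed

lemma ra_mult:
  assumes "ra f" "ra g" shows "ra (\<lambda>z. f z * g z)"
proof -
  obtain F where F: "hol2 F" "\<forall>\<^sub>F z in nhds 0. f z = F (z, cnj z)" using assms(1) by (rule ra_hol2E)
  obtain G where G: "hol2 G" "\<forall>\<^sub>F z in nhds 0. g z = G (z, cnj z)" using assms(2) by (rule ra_hol2E)
  have "\<forall>\<^sub>F z in nhds 0. f z * g z = F (z, cnj z) * G (z, cnj z)"
    using F(2) G(2) by eventually_elim simp
  then show ?thesis unfolding ra_iff_hol2 using hol2_mult[OF F(1) G(1)] by (intro exI conjI)
qed

lemma ra_uminus: "ra f \<Longrightarrow> ra (\<lambda>z. - f z)"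
  using ra_mult[OF ra_const[of "-1"]] by simp

lemma ra_diff: "ra f \<Longrightarrow> ra g \<Longrightarrow> ra (\<lambda>z. f z - g z)"
  using ra_add[OF _ ra_uminus] by simp

lemma ra_holomorphic:
  assumes "ra f" "k holomorphic_on D" "open D" "f 0 \<in> D"
  shows "ra (\<lambda>z. k (f z))"
proof -
  obtain F where F: "hol2 F" "\<forall>\<^sub>F z in nhds 0. f z = F (z, cnj z)" "F 0 = f 0"
    using assms(1) by (rule ra_hol2E)
  have "\<forall>\<^sub>F z in nhds 0. k (f z) = k (F (z, cnj z))"
    using F(2) by eventually_elim simp
  then show ?thesis
    unfolding ra_iff_hol2 using hol2_holomorphic_compose[OF F(1) assms(2,3)] F(3) assms(4)
    by (intro exI conjI) simp_all
qed

lemma ra_exp: "ra f \<Longrightarrow> ra (\<lambda>z. exp (f z))"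
  by (rule ra_holomorphic[of f exp UNIV]) (auto intro: holomorphic_intros)

lemma ra_inverse_mult:
  assumes "ra f" "f 0 \<noteq> 0"
  shows "ra (\<lambda>z. inverse (f z))"
  by (rule ra_holomorphic[OF assms(1), of inverse "- {0}"]) (use assms in \<open>auto intro!: holomorphic_intros\<close>)

lemma ra_divide: "ra f \<Longrightarrow> ra g \<Longrightarrow> g 0 \<noteq> 0 \<Longrightarrow> ra (\<lambda>z. f z / g z)"
  unfolding divide_inverse by (intro ra_mult ra_inverse_mult)

lemma ra_csqrt:
  assumes "ra f" "f 0 \<notin> \<real>\<^sub>\<le>\<^sub>0"
  shows "ra (\<lambda>z. csqrt (f z))"
  by (rule ra_holomorphic[OF assms(1), of csqrt "- \<real>\<^sub>\<le>\<^sub>0"])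
    (use assms in \<open>auto intro!: holomorphic_on_csqrt\<close>)

lemma ra_Ln:
  assumes "ra f" "f 0 \<notin> \<real>\<^sub>\<le>\<^sub>0"
  shows "ra (\<lambda>z. Ln (f z))"
  by (rule ra_holomorphic[OF assms(1), of Ln "- \<real>\<^sub>\<le>\<^sub>0"])
    (use assms in \<open>auto intro!: holomorphic_on_Ln\<close>)

lemma has_expansion2_cnj:
  assumes "has_expansion2 f A"
  shows "has_expansion2 (\<lambda>z. cnj (f z)) (cnj2 A)"
  using assms unfolding has_expansion2_def
proof eventually_elim
  case (elim z)
  then have "((\<lambda>k. cnj (case k of (m, n) \<Rightarrow> coeff2 A m n * z ^ m * cnj z ^ n)) has_sum cnj (f z)) UNIV"
    by (simp only: has_sum_cnj_iff)
  also have "?this \<longleftrightarrow> ?case"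
    by (rule has_sum_reindex_bij_witness[of _ prod.swap prod.swap]) (auto simp: mult_ac)
  finally show ?case .
qed

lemma ra_cnj: "ra f \<Longrightarrow> ra (\<lambda>z. cnj (f z))"
  using has_expansion2_cnj unfolding ra_def by blast

text \<open>The second variable of the extension F of h has to be fed with a holomorphic extension Q
  of the conjugate of p. The conjugate of P would agree with it where \<open>z' = cnj z\<close>, but
  is not holomorphic.\<close>

lemma ra_compose:
  assumes "ra h" "ra p" "p 0 = 0"
  shows "ra (\<lambda>z. h (p z))"
proof -
  obtain F where F: "hol2 F" "\<forall>\<^sub>F z in nhds 0. h z = F (z, cnj z)" using assms(1) by (rule ra_hol2E)
  obtain P where P: "hol2 P" "\<forall>\<^sub>F z in nhds 0. p z = P (z, cnj z)" "P 0 = p 0" using assms(2) by (rule ra_hol2E)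
  obtain Q where Q: "hol2 Q" "\<forall>\<^sub>F z in nhds 0. cnj (p z) = Q (z, cnj z)" "Q 0 = cnj (p 0)"
    using ra_cnj[OF assms(2)] by (rule ra_hol2E)
  from hol2E[OF P(1)] obtain S where S: "open S" "0 \<in> S" "continuous_on S P" .
  have "isCont P 0" using S by (simp add: continuous_on_eq_continuous_at)
  then have "(P \<longlongrightarrow> 0) (nhds 0)"
    using P(3) assms(3) isCont_tendsto_nhds by force
  then have "\<forall>\<^sub>F q in nhds 0. h (P q) = F (P q, cnj (P q))"
    using F(2) by (auto simp: filterlim_iff)
  then have "\<forall>\<^sub>F z in nhds 0. h (P (z, cnj z)) = F (P (z, cnj z), cnj (P (z, cnj z)))"
    by (rule eventually_nhds_Pair_cnj)
  with P(2) Q(2) have "\<forall>\<^sub>F z in nhds 0. h (p z) = F (P (z, cnj z), Q (z, cnj z))"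
    by eventually_elim simp
  moreover have "hol2 (\<lambda>q. F (P q, Q q))"
    using F P Q assms(3) by (intro hol2_compose) simp_all
  ultimately show ?thesis unfolding ra_iff_hol2 by (intro exI conjI)
qed

subsection \<open>Wirtinger derivatives\<close>

definition has_wirtinger :: "(complex \<Rightarrow> complex) \<Rightarrow> complex \<Rightarrow> complex \<Rightarrow> complex \<Rightarrow> bool" where
  "has_wirtinger f a b z \<longleftrightarrow> (f has_derivative (\<lambda>u. a * u + b * cnj u)) (at z)"

lemma has_wirtinger_unique:
  assumes "has_wirtinger f a b z" "has_wirtinger f a' b' z"
  shows "a = a'" "b = b'"
proof -
  have "a * u + b * cnj u = a' * u + b' * cnj u" for u
    using has_derivative_unique[OF assms[unfolded has_wirtinger_def]] by meson
  from this[of 1] this[of \<i>] have "a + b = a' + b'" "\<i> * (a - b) = \<i> * (a' - b')"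
    by (simp_all add: algebra_simps)
  then have "a + b = a' + b'" "a - b = a' - b'" by simp_all
  then show "a = a'" "b = b'" by (simp_all add: algebra_simps complex_eq_iff)
qed

lemma has_wirtinger_cong:
  assumes "has_wirtinger f a b z" "\<forall>\<^sub>F w in nhds z. f w = g w"
  shows "has_wirtinger g a b z"
proof -
  obtain S where "open S" "z \<in> S" "\<And>w. w \<in> S \<Longrightarrow> f w = g w"
    using assms(2) unfolding eventually_nhds by blast
  then show ?thesis
    using assms(1) has_derivative_transform_within_open unfolding has_wirtinger_def by blast
qed

lemma has_wirtinger_add:
  "has_wirtinger f a b z \<Longrightarrow> has_wirtinger g c d z \<Longrightarrow> has_wirtinger (\<lambda>z. f z + g z) (a + c) (b + d) z"
  unfolding has_wirtinger_def by (drule (1) has_derivative_add) (simp add: algebra_simps)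

lemma has_wirtinger_mult:
  "has_wirtinger f a b z \<Longrightarrow> has_wirtinger g c d z \<Longrightarrow>
     has_wirtinger (\<lambda>z. f z * g z) (a * g z + f z * c) (b * g z + f z * d) z"
  unfolding has_wirtinger_def by (drule (1) has_derivative_mult) (simp add: algebra_simps)

lemma has_wirtinger_const: "has_wirtinger (\<lambda>z. c) 0 0 z"
  by (simp add: has_wirtinger_def)

lemma has_wirtinger_ident: "has_wirtinger (\<lambda>z. z) 1 0 z"
  by (simp add: has_wirtinger_def)

lemma has_wirtinger_cnj:
  "has_wirtinger f a b z \<Longrightarrow> has_wirtinger (\<lambda>z. cnj (f z)) (cnj b) (cnj a) z"
  unfolding has_wirtinger_def
  by (drule bounded_linear.has_derivative[OF bounded_linear_cnj]) (simp add: algebra_simps)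

lemma has_wirtinger_compose:
  assumes "has_wirtinger f a b z" "has_wirtinger h c d (f z)"
  shows "has_wirtinger (\<lambda>z. h (f z)) (c * a + d * cnj b) (c * b + d * cnj a) z"
  using has_derivative_compose[OF assms[unfolded has_wirtinger_def]]
  unfolding has_wirtinger_def by (simp add: algebra_simps)

lemma has_wirtinger_field:
  assumes "has_wirtinger f a b z" "(h has_field_derivative c) (at (f z))"
  shows "has_wirtinger (\<lambda>z. h (f z)) (c * a) (c * b) z"
  using has_wirtinger_compose[OF assms(1), of h c 0] assms(2)
  by (simp add: has_wirtinger_def has_field_derivative_def)

lemma has_wirtinger_isCont: "has_wirtinger f a b z \<Longrightarrow> isCont f z"
  unfolding has_wirtinger_def by (rule has_derivative_continuous)

lemma has_expansion2_wirtinger_ev: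
  assumes "has_expansion2 f A"
  shows "\<forall>\<^sub>F z in nhds 0. has_wirtinger f (ev (deriv_z A) z) (ev (deriv_zbar A) z) z"
proof -
  obtain r where r: "r > 0" "\<forall>p\<in>ball 0 r \<times> ball 0 r. (pser A has_derivative
      (\<lambda>h. pser (deriv_z A) p * fst h + pser (deriv_zbar A) p * snd h)) (at p)"
    using pser_has_derivative_locally[OF has_expansion2_convergent2[OF assms]] by (elim exE conjE)
  show ?thesis
    using eventually_nhds_nhds[OF has_expansion2_eq_ev[OF assms]] eventually_norm_less[OF r(1)]
  proof eventually_elim
    case (elim z)
    have "((\<lambda>z. (z, cnj z)) has_derivative (\<lambda>h. (h, cnj h))) (at z)"
      by (intro has_derivative_Pair has_derivative_ident bounded_linear.has_derivative[OF bounded_linear_cnj])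
    then have "((\<lambda>z. pser A (z, cnj z)) has_derivative
       (\<lambda>h. pser (deriv_z A) (z, cnj z) * fst (h, cnj h) + pser (deriv_zbar A) (z, cnj z) * snd (h, cnj h))) (at z)"
      by (rule has_derivative_compose) (rule bspec[OF r(2)], use elim in auto)
    then have "has_wirtinger (ev A) (ev (deriv_z A) z) (ev (deriv_zbar A) z) z"
      unfolding has_wirtinger_def ev_def by simp
    then show ?case
      by (rule has_wirtinger_cong) (use elim in \<open>auto elim: eventually_mono\<close>)
  qed
qed

lemma has_expansion2_ev_deriv:
  assumes "has_expansion2 f A"
  shows "has_expansion2 (ev (deriv_z A)) (deriv_z A)" "has_expansion2 (ev (deriv_zbar A)) (deriv_zbar A)"
  using assms by (simp_all add: convergent2_has_expansion2 convergent2_deriv_z convergent2_deriv_zbar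
      has_expansion2_convergent2)

lemma has_expansion2_wirtinger:
  assumes "has_expansion2 f A" "\<forall>\<^sub>F z in nhds 0. has_wirtinger f (a z) (b z) z"
  shows "has_expansion2 a (deriv_z A)" "has_expansion2 b (deriv_zbar A)"
proof -
  have "\<forall>\<^sub>F z in nhds 0. ev (deriv_z A) z = a z" "\<forall>\<^sub>F z in nhds 0. ev (deriv_zbar A) z = b z"
    using has_expansion2_wirtinger_ev[OF assms(1)] assms(2)
    by (eventually_elim, use has_wirtinger_unique in blast)+
  then show "has_expansion2 a (deriv_z A)" "has_expansion2 b (deriv_zbar A)"
    using has_expansion2_ev_deriv[OF assms(1)] has_expansion2_cong by blast+
qed

lemma has_wirtinger_at_0:
  assumes "has_expansion2 f A"
  shows "has_wirtinger f (coeff2 A 1 0) (coeff2 A 0 1) 0"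
  using eventually_nhds_x_imp_x[OF has_expansion2_wirtinger_ev[OF assms]]
    has_expansion2_ev_deriv[OF assms, THEN has_expansion2_at_0] by simp

lemma ra_tendsto: "ra f \<Longrightarrow> (f \<longlongrightarrow> f 0) (nhds 0)"
  by (erule raE, drule has_wirtinger_at_0, drule has_wirtinger_isCont) (rule isCont_tendsto_nhds)

lemma ra_eventually:
  assumes "ra f" "\<forall>\<^sub>F w in nhds (f 0). Q w"
  shows "\<forall>\<^sub>F z in nhds 0. Q (f z)"
  using ra_tendsto[OF assms(1)] assms(2) by (auto simp: filterlim_iff)

subsection \<open>Coefficients\<close>

text \<open>Identity theorem for the points with \<open>z' = cnj z\<close>: a germ that vanishes
  near 0 has vanishing Wirtinger derivatives near 0, and their expansions carry the coefficients of
  positive degree.\<close>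

lemma has_expansion2_zero_coeff:
  assumes "has_expansion2 f A" "\<forall>\<^sub>F z in nhds 0. f z = 0"
  shows "coeff2 A m n = 0"
  using assms
proof (induction "m + n" arbitrary: f A m n)
  case 0
  then show ?case
    using has_expansion2_at_0 eventually_nhds_x_imp_x by fastforce
next
  case (Suc k)
  from eventually_nhds_nhds[OF Suc.prems(2)] have "\<forall>\<^sub>F z in nhds 0. has_wirtinger f 0 0 z"
  proof eventually_elim
    case (elim z)
    then show ?case
      by (intro has_wirtinger_cong[OF has_wirtinger_const[of 0]]) (auto elim: eventually_mono)
  qed
  from has_expansion2_wirtinger[OF Suc.prems(1) this]
  have e: "has_expansion2 (\<lambda>z. 0) (deriv_z A)" "has_expansion2 (\<lambda>z. 0) (deriv_zbar A)" .
  show ?case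
  proof (cases m)
    case (Suc m')
    then have "coeff2 (deriv_z A) m' n = 0" using Suc.hyps(2) by (intro Suc.hyps(1)[OF _ e(1)]) auto
    then show ?thesis using Suc by (simp del: of_nat_Suc)
  next
    case 0
    then obtain n' where n': "n = Suc n'" using Suc.hyps(2) by auto
    then have "coeff2 (deriv_zbar A) m n' = 0" using Suc.hyps(2) by (intro Suc.hyps(1)[OF _ e(2)]) auto
    then show ?thesis using n' by (simp del: of_nat_Suc)
  qed
qed

lemma has_expansion2_add:
  assumes "has_expansion2 f A" "has_expansion2 g B"
  shows "has_expansion2 (\<lambda>z. f z + g z) (A + B)"
  using assms unfolding has_expansion2_def
proof eventually_elim
  case (elim z)
  then show ?case using has_sum_add[OF elim] by (simp add: case_prod_unfold algebra_simps)
qed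

lemma has_expansion2_const_mult:
  assumes "has_expansion2 f A"
  shows "has_expansion2 (\<lambda>z. c * f z) (const2 c * A)"
  using assms unfolding has_expansion2_def
proof eventually_elim
  case (elim z)
  then show ?case using has_sum_cmult_right[OF elim, of c] by (simp add: case_prod_unfold mult.assoc)
qed

lemma has_expansion2_uminus: "has_expansion2 f A \<Longrightarrow> has_expansion2 (\<lambda>z. - f z) (- A)"
proof -
  assume "has_expansion2 f A"
  moreover have "const2 (- 1) * A = - A" by (rule fps2_eqI) simp
  ultimately show ?thesis using has_expansion2_const_mult[of f A "- 1"] by simp
qed

lemma has_expansion2_diff:
  "has_expansion2 f A \<Longrightarrow> has_expansion2 g B \<Longrightarrow> has_expansion2 (\<lambda>z. f z - g z) (A - B)"
  using has_expansion2_add[OF _ has_expansion2_uminus] by fastforce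

lemma has_expansion2_unique:
  assumes "has_expansion2 f A" "has_expansion2 f B"
  shows "A = B"
proof (rule fps2_eqI)
  fix m n
  have "coeff2 (A - B) m n = 0"
    by (rule has_expansion2_zero_coeff[OF has_expansion2_diff[OF assms]]) simp
  then show "coeff2 A m n = coeff2 B m n" by simp
qed

lemma has_expansion2_const: "has_expansion2 (\<lambda>z. c) (const2 c)"
  unfolding has_expansion2_def
  by (intro always_eventually allI has_sum_finite_neutralI[of "{(0, 0)}"])
    (auto simp: coeff2_const2 split: if_splits)

lemma has_expansion2_ident: "has_expansion2 (\<lambda>z. z) var_z"
  unfolding has_expansion2_def
  by (intro always_eventually allI has_sum_finite_neutralI[of "{(1, 0)}"])
    (auto simp: coeff2_var_z split: if_splits)

lemma has_expansion2_cnj_ident: "has_expansion2 cnj var_zbar"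
  using has_expansion2_cnj[OF has_expansion2_ident] by simp

text \<open>
  Expansions of products and compositions are identified by induction on the total degree, using
  that a series is determined by its constant term and its two derivatives.
\<close>

lemma has_expansion2_mult:
  assumes "has_expansion2 f A" "has_expansion2 g B"
  shows "has_expansion2 (\<lambda>z. f z * g z) (A * B)"
proof -
  \<comment> \<open>C is whatever expansion the product has; one exists by \<open>ra_mult\<close>.
    The claim ranges over all f and g because the step applies it to their derivatives.\<close>
  have "eqd N C (A * B)" if "has_expansion2 f A" "has_expansion2 g B" "has_expansion2 (\<lambda>z. f z * g z) C"
    for N f g A B C
    using that
  proof (induction N arbitrary: f g A B C)
    case (Suc N)
    note f = Suc.prems(1) and g = Suc.prems(2) and C = Suc.prems(3)
    have "\<forall>\<^sub>F z in nhds 0. has_wirtinger (\<lambda>z. f z * g z) (ev (deriv_z A) z * g z + f z * ev (deriv_z B) z)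
        (ev (deriv_zbar A) z * g z + f z * ev (deriv_zbar B) z) z"
      using has_expansion2_wirtinger_ev[OF f] has_expansion2_wirtinger_ev[OF g]
      by eventually_elim (rule has_wirtinger_mult)
    note w = has_expansion2_wirtinger[OF C this]
    have r: "ra f" "ra g" "ra (ev (deriv_z A))" "ra (ev (deriv_zbar A))" "ra (ev (deriv_z B))" "ra (ev (deriv_zbar B))"
      using f g has_expansion2_ev_deriv[OF f] has_expansion2_ev_deriv[OF g] has_expansion2_ra by blast+
    obtain C1 C2 C3 C4 where c: "has_expansion2 (\<lambda>z. ev (deriv_z A) z * g z) C1"
        "has_expansion2 (\<lambda>z. f z * ev (deriv_z B) z) C2"
        "has_expansion2 (\<lambda>z. ev (deriv_zbar A) z * g z) C3"
        "has_expansion2 (\<lambda>z. f z * ev (deriv_zbar B) z) C4"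
      using ra_mult[OF r(3,2)] ra_mult[OF r(1,5)] ra_mult[OF r(4,2)] ra_mult[OF r(1,6)]
      by (elim raE)
    have "deriv_z C = C1 + C2" "deriv_zbar C = C3 + C4"
      using has_expansion2_unique[OF w(1) has_expansion2_add[OF c(1,2)]]
        has_expansion2_unique[OF w(2) has_expansion2_add[OF c(3,4)]] .
    moreover have "eqd N C1 (deriv_z A * B)" "eqd N C2 (A * deriv_z B)"
        "eqd N C3 (deriv_zbar A * B)" "eqd N C4 (A * deriv_zbar B)"
      using Suc.IH[OF has_expansion2_ev_deriv(1)[OF f] g c(1)] Suc.IH[OF f has_expansion2_ev_deriv(1)[OF g] c(2)]
        Suc.IH[OF has_expansion2_ev_deriv(2)[OF f] g c(3)] Suc.IH[OF f has_expansion2_ev_deriv(2)[OF g] c(4)] .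
    ultimately show ?case
      unfolding eqd_Suc_iff deriv_z.mult deriv_zbar.mult
      using has_expansion2_at_0[OF f] has_expansion2_at_0[OF g] has_expansion2_at_0[OF C]
      by (simp add: eqd_add)
  qed simp
  moreover obtain C where "has_expansion2 (\<lambda>z. f z * g z) C"
    using ra_mult[OF assms[THEN has_expansion2_ra]] by (rule raE)
  ultimately show ?thesis using assms eqd_allI by metis
qed

lemma has_expansion2_compose:
  assumes "has_expansion2 h A" "has_expansion2 p P" "p 0 = 0"
  shows "has_expansion2 (\<lambda>z. h (p z)) (formal_comp A P)"
proof -
  have P0: "coeff2 P 0 0 = 0" "coeff2 (cnj2 P) 0 0 = 0"
    using has_expansion2_at_0[OF assms(2)] assms(3) by simp_all
  have p: "ra p" using assms has_expansion2_ra by blast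
  define p1 where p1: "p1 = ev (deriv_z P)"
  define p2 where p2: "p2 = ev (deriv_zbar P)"
  have e: "has_expansion2 p1 (deriv_z P)" "has_expansion2 p2 (deriv_zbar P)"
      "has_expansion2 (\<lambda>z. cnj (p1 z)) (deriv_zbar (cnj2 P))" "has_expansion2 (\<lambda>z. cnj (p2 z)) (deriv_z (cnj2 P))"
    unfolding deriv_z_cnj2 deriv_zbar_cnj2 using has_expansion2_ev_deriv[OF assms(2)]
    by (auto simp: p1 p2 intro: has_expansion2_cnj)
  have "eqd N C (formal_comp A P)" if "has_expansion2 h A" "has_expansion2 (\<lambda>z. h (p z)) C" for N h A C
    using that
  proof (induction N arbitrary: h A C)
    case (Suc N)
    note h = Suc.prems(1) and C = Suc.prems(2)
    let ?a = "ev (deriv_z A)" and ?b = "ev (deriv_zbar A)"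
    have "\<forall>\<^sub>F w in nhds (p 0). has_wirtinger h (?a w) (?b w) w"
      using has_expansion2_wirtinger_ev[OF h] assms(3) by simp
    from ra_eventually[OF p this] has_expansion2_wirtinger_ev[OF assms(2)]
    have "\<forall>\<^sub>F z in nhds 0. has_wirtinger (\<lambda>z. h (p z))
        (?a (p z) * p1 z + ?b (p z) * cnj (p2 z)) (?a (p z) * p2 z + ?b (p z) * cnj (p1 z)) z"
      unfolding p1 p2 by eventually_elim (rule has_wirtinger_compose)
    note w = has_expansion2_wirtinger[OF C this]
    have r: "ra ?a" "ra ?b" using has_expansion2_ev_deriv[OF h] has_expansion2_ra by blast+
    obtain C1 C2 where c: "has_expansion2 (\<lambda>z. ?a (p z)) C1" "has_expansion2 (\<lambda>z. ?b (p z)) C2"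
      using ra_compose[OF r(1) p assms(3)] ra_compose[OF r(2) p assms(3)] by (elim raE)
    have "deriv_z C = C1 * deriv_z P + C2 * deriv_z (cnj2 P)"
        "deriv_zbar C = C1 * deriv_zbar P + C2 * deriv_zbar (cnj2 P)"
      by (rule has_expansion2_unique[OF w(1)] has_expansion2_unique[OF w(2)],
          intro has_expansion2_add has_expansion2_mult c e)+
    moreover have "eqd N C1 (formal_comp (deriv_z A) P)" "eqd N C2 (formal_comp (deriv_zbar A) P)"
      using Suc.IH[OF has_expansion2_ev_deriv(1)[OF h] c(1)] Suc.IH[OF has_expansion2_ev_deriv(2)[OF h] c(2)] .
    ultimately show ?case
      unfolding eqd_Suc_iff formal_comp_def deriv_z_subst2[OF P0] deriv_zbar_subst2[OF P0]
      using has_expansion2_at_0[OF h] has_expansion2_at_0[OF C] assms(3)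
      by (simp add: eqd_add eqd_mult)
  qed simp
  moreover obtain C where "has_expansion2 (\<lambda>z. h (p z)) C"
    using ra_compose[OF has_expansion2_ra[OF assms(1)] p assms(3)] by (rule raE)
  ultimately show ?thesis using assms(1) eqd_allI by metis
qed

lemma hol2_has_wirtinger:
  assumes "(F has_derivative (\<lambda>h. a * fst h + b * snd h)) (at (z, cnj z))"
  shows "has_wirtinger (\<lambda>z. F (z, cnj z)) a b z"
proof -
  have "((\<lambda>z. (z, cnj z)) has_derivative (\<lambda>h. (h, cnj h))) (at z)"
    by (intro has_derivative_Pair has_derivative_ident bounded_linear.has_derivative[OF bounded_linear_cnj])
  from has_derivative_compose[OF this assms] show ?thesis
    by (simp add: has_wirtinger_def)
qed

lemma pser_cnj2: "pser (cnj2 A) (z, w) = cnj (pser A (cnj w, cnj z))"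
proof -
  have "bij (prod.swap :: nat \<times> nat \<Rightarrow> _)" by (rule bij_swap)
  from infsum_reindex_bij_betw[OF this, of "\<lambda>(m, n). coeff2 (cnj2 A) m n * z ^ m * w ^ n"]
  have "pser (cnj2 A) (z, w) = (\<Sum>\<^sub>\<infinity>k. cnj (case k of (m, n) \<Rightarrow> coeff2 A m n * cnj w ^ m * cnj z ^ n))"
    unfolding pser_def by (simp add: case_prod_unfold mult_ac)
  then show ?thesis by (simp add: pser_def)
qed

subsection \<open>Inverse functions\<close>

text \<open>A 2 by 2 complex matrix in the type of bounded linear maps on which
  \<open>inverse_function_theorem\<close> is stated.\<close>

definition lin2 :: "complex \<Rightarrow> complex \<Rightarrow> complex \<Rightarrow> complex \<Rightarrow> (complex \<times> complex) \<Rightarrow>\<^sub>L (complex \<times> complex)" where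
  "lin2 a b c d = Blinfun (\<lambda>h. (a * fst h + b * snd h, c * fst h + d * snd h))"

lemma lin2_apply: "blinfun_apply (lin2 a b c d) h = (a * fst h + b * snd h, c * fst h + d * snd h)"
proof -
  have "bounded_linear (\<lambda>h. (a * fst h + b * snd h, c * fst h + d * snd h))"
    by (intro bounded_linear_Pair bounded_linear_add
        bounded_linear_compose[OF bounded_linear_mult_right bounded_linear_fst]
        bounded_linear_compose[OF bounded_linear_mult_right bounded_linear_snd])
  then show ?thesis by (simp add: lin2_def bounded_linear_Blinfun_apply)
qed

lemma lin2_adjugate:
  fixes a b c d :: complex
  defines "D \<equiv> a * d - b * c"
  assumes "D \<noteq> 0"
  shows "blinfun_apply (lin2 a b c d) (blinfun_apply (lin2 (d / D) (- b / D) (- c / D) (a / D)) h) = h" (is ?A)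
    and "blinfun_apply (lin2 (d / D) (- b / D) (- c / D) (a / D)) (blinfun_apply (lin2 a b c d) h) = h" (is ?B)
proof -
  show ?A ?B
    unfolding lin2_apply using assms(2)
    by (cases h; simp add: field_simps, simp add: D_def algebra_simps)+
qed

text \<open>The real inverse function theorem provides a differentiable inverse. Its derivative is
  the inverse of a complex-linear map, given by the adjugate matrix, hence again complex-linear and
  continuous in the point.\<close>

lemma hol2_inverse_function:
  assumes "hol2 F" "hol2 G" "F 0 = 0" "G 0 = 0"
    and "(F has_derivative (\<lambda>h. a * fst h + b * snd h)) (at 0)"
    and "(G has_derivative (\<lambda>h. c * fst h + d * snd h)) (at 0)"
    and "a * d - b * c \<noteq> 0"
  obtains g where "hol2 (\<lambda>p. fst (g p))" "hol2 (\<lambda>p. snd (g p))" "g 0 = 0"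
    "\<forall>\<^sub>F p in nhds 0. (F (g p), G (g p)) = p" "\<forall>\<^sub>F p in nhds 0. g (F p, G p) = p"
proof -
  from assms(1) obtain S a1 b1 where S: "open S" "0 \<in> S" "continuous_on S a1" "continuous_on S b1"
    and F: "\<forall>p\<in>S. (F has_derivative (\<lambda>h. a1 p * fst h + b1 p * snd h)) (at p)" by (rule hol2E)
  from assms(2) obtain T a2 b2 where T: "open T" "0 \<in> T" "continuous_on T a2" "continuous_on T b2"
    and G: "\<forall>p\<in>T. (G has_derivative (\<lambda>h. a2 p * fst h + b2 p * snd h)) (at p)" by (rule hol2E)
  define U where "U = S \<inter> T"
  have U: "open U" "0 \<in> U" using S T by (auto simp: U_def)
  have ct: "continuous_on U a1" "continuous_on U b1" "continuous_on U a2" "continuous_on U b2"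
    using S T by (auto intro: continuous_on_subset simp: U_def)
  define P where "P = (\<lambda>p. (F p, G p))"
  define P' where "P' = (\<lambda>p. lin2 (a1 p) (b1 p) (a2 p) (b2 p))"
  define det where "det = (\<lambda>p. a1 p * b2 p - b1 p * a2 p)"
  have "a1 0 * fst h + b1 0 * snd h = a * fst h + b * snd h"
       "a2 0 * fst h + b2 0 * snd h = c * fst h + d * snd h" for h
    using has_derivative_unique[OF bspec[OF F S(2)] assms(5)]
      has_derivative_unique[OF bspec[OF G T(2)] assms(6)] by meson+
  from this[of "(1, 0)"] this[of "(0, 1)"] have "det 0 \<noteq> 0"
    using assms(7) by (simp add: det_def)
  have dP: "(P has_derivative blinfun_apply (P' p)) (at p)" if "p \<in> U" for p
    unfolding P_def P'_def lin2_apply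
    by (rule has_derivative_Pair[OF bspec[OF F] bspec[OF G]]) (use that in \<open>auto simp: U_def\<close>)
  have cP': "continuous_on U P'"
  proof (rule continuous_on_blinfun_componentwise)
    show "continuous_on U (\<lambda>p. blinfun_apply (P' p) i)" for i
      unfolding P'_def lin2_apply by (intro continuous_intros ct)
  qed
  define invf where "invf = lin2 (b2 0 / det 0) (- b1 0 / det 0) (- a2 0 / det 0) (a1 0 / det 0)"
  have "invf o\<^sub>L P' 0 = id_blinfun"
    using lin2_adjugate(2)[of "a1 0" "b2 0" "b1 0" "a2 0"] \<open>det 0 \<noteq> 0\<close>
    by (intro blinfun_eqI) (simp add: invf_def P'_def det_def)
  from inverse_function_theorem[OF U(1) dP cP' U(2) this] obtain U' V g g' where
    U': "open U'" "U' \<subseteq> U" "0 \<in> U'" and V: "open V" "P 0 \<in> V" and hom: "homeomorphism U' V P g"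
    and g: "\<And>y. y \<in> V \<Longrightarrow> (g has_derivative (g' y)) (at y)"
      "\<And>y. y \<in> V \<Longrightarrow> g' y = inv (blinfun_apply (P' (g y)))" "\<And>y. y \<in> V \<Longrightarrow> bij (blinfun_apply (P' (g y)))"
    by metis
  have "P 0 = 0" using assms by (simp add: P_def zero_prod_def)
  then have V0: "0 \<in> V" using V by simp
  have g0: "g 0 = 0" using homeomorphism_apply1[OF hom U'(3)] \<open>P 0 = 0\<close> by simp
  \<comment> \<open>Here g stays where the coefficient functions are continuous and the determinant
    does not vanish, so the adjugate formula is available at every point.\<close>
  define W where "W = V \<inter> g -` (U \<inter> det -` (- {0}))"
  have "open (U \<inter> det -` (- {0}))"
    unfolding det_def using U by (intro continuous_open_preimage continuous_intros ct) auto
  then have "open W"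
    unfolding W_def by (rule continuous_open_preimage[OF homeomorphism_cont2[OF hom] V(1)])
  moreover have "0 \<in> W"
    using V0 g0 U \<open>det 0 \<noteq> 0\<close> by (simp add: W_def)
  ultimately have W: "open W" "0 \<in> W" by simp_all
  have cg: "continuous_on W g"
    using homeomorphism_cont2[OF hom] by (rule continuous_on_subset) (auto simp: W_def)
  have cW: "continuous_on W (\<lambda>y. a1 (g y))" "continuous_on W (\<lambda>y. b1 (g y))"
      "continuous_on W (\<lambda>y. a2 (g y))" "continuous_on W (\<lambda>y. b2 (g y))"
    by (rule continuous_on_compose2[OF ct(1) cg] continuous_on_compose2[OF ct(2) cg]
        continuous_on_compose2[OF ct(3) cg] continuous_on_compose2[OF ct(4) cg], force simp: W_def)+
  have cdet: "continuous_on W (\<lambda>y. det (g y))" unfolding det_def by (intro continuous_intros cW)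
  have nz: "det (g y) \<noteq> 0" if "y \<in> W" for y using that by (auto simp: W_def)
  have dg: "(g has_derivative (\<lambda>h. (b2 (g y) / det (g y) * fst h + (- b1 (g y) / det (g y)) * snd h,
      (- a2 (g y) / det (g y)) * fst h + a1 (g y) / det (g y) * snd h))) (at y)" if y: "y \<in> W" for y
  proof -
    have yV: "y \<in> V" using y by (simp add: W_def)
    let ?E = "lin2 (b2 (g y) / det (g y)) (- b1 (g y) / det (g y)) (- a2 (g y) / det (g y)) (a1 (g y) / det (g y))"
    have "g' y h = blinfun_apply ?E h" for h
    proof -
      have "blinfun_apply (P' (g y)) (blinfun_apply ?E h) = h"
        using lin2_adjugate(1)[of "a1 (g y)" "b2 (g y)" "b1 (g y)" "a2 (g y)" h] nz[OF y]
        by (simp add: P'_def det_def)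
      then show ?thesis
        using g(2,3)[OF yV] by (metis bij_is_inj inv_f_f)
    qed
    then have "g' y = (\<lambda>h. (b2 (g y) / det (g y) * fst h + (- b1 (g y) / det (g y)) * snd h,
      (- a2 (g y) / det (g y)) * fst h + a1 (g y) / det (g y) * snd h))"
      unfolding lin2_apply by (rule ext)
    then show ?thesis using g(1)[OF yV] by (simp only:)
  qed
  have cc: "continuous_on W (\<lambda>p. b2 (g p) / det (g p))" "continuous_on W (\<lambda>p. - b1 (g p) / det (g p))"
      "continuous_on W (\<lambda>p. - a2 (g p) / det (g p))" "continuous_on W (\<lambda>p. a1 (g p) / det (g p))"
    using nz by (auto intro!: continuous_on_divide continuous_on_minus cW cdet)
  have h1: "hol2 (\<lambda>p. fst (g p))"
  proof (rule hol2I[OF W cc(1,2)])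
    show "((\<lambda>p. fst (g p)) has_derivative (\<lambda>h. b2 (g p) / det (g p) * fst h + - b1 (g p) / det (g p) * snd h)) (at p)"
      if "p \<in> W" for p
      using has_derivative_fst[OF dg[OF that]] by simp
  qed
  have h2: "hol2 (\<lambda>p. snd (g p))"
  proof (rule hol2I[OF W cc(3,4)])
    show "((\<lambda>p. snd (g p)) has_derivative (\<lambda>h. - a2 (g p) / det (g p) * fst h + a1 (g p) / det (g p) * snd h)) (at p)"
      if "p \<in> W" for p
      using has_derivative_snd[OF dg[OF that]] by simp
  qed
  have e1: "\<forall>\<^sub>F p in nhds 0. (F (g p), G (g p)) = p"
    using eventually_nhds_in_open[OF V(1) V0]
    by eventually_elim (use homeomorphism_apply2[OF hom] in \<open>simp add: P_def\<close>)
  have e2: "\<forall>\<^sub>F p in nhds 0. g (F p, G p) = p"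
    using eventually_nhds_in_open[OF U'(1,3)]
    by eventually_elim (use homeomorphism_apply1[OF hom] in \<open>simp add: P_def\<close>)
  show ?thesis by (rule that[OF h1 h2 g0 e1 e2])
qed

lemma hol2_isCont: "hol2 F \<Longrightarrow> isCont F 0"
  by (erule hol2E) (simp add: continuous_on_eq_continuous_at)

text \<open>Extend f and its conjugate to the pair (F, G) in two variables; its determinant at 0 is
  |a|^2 - |b|^2. The inverse g of the pair restricts to an inverse of f once it maps points of the
  form \<open>(z, cnj z)\<close> to such points. The pair commutes with the reflection that fixes
  these points, hence so does its local inverse.\<close>

lemma ra_inverse_function:
  assumes f: "ra f" "f 0 = 0" and ab: "has_wirtinger f a b 0" "a * cnj a - b * cnj b \<noteq> 0"
  obtains g where "ra g" "g 0 = 0" "\<forall>\<^sub>F z in nhds 0. f (g z) = z" "\<forall>\<^sub>F z in nhds 0. g (f z) = z"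
proof -
  obtain A where A: "has_expansion2 f A" using f(1) by (rule raE)
  note cA = has_expansion2_convergent2[OF A]
  note cA' = has_expansion2_convergent2[OF has_expansion2_cnj[OF A]]
  define F where "F = pser A"
  define G where "G = pser (cnj2 A)"
  have GF: "G (z, w) = cnj (F (cnj w, cnj z))" for z w by (simp add: F_def G_def pser_cnj2)
  have hol: "hol2 F" "hol2 G" unfolding F_def G_def using cA cA' by (simp_all add: hol2_pser)
  have eF: "\<forall>\<^sub>F z in nhds 0. f z = F (z, cnj z)"
    using has_expansion2_eq_ev[OF A] by (simp add: ev_def F_def)
  have F0: "F 0 = 0" using eventually_nhds_x_imp_x[OF eF] f(2) by (simp add: zero_prod_def)
  then have G0: "G 0 = 0" using GF[of 0 0] by (simp add: zero_prod_def)
  from hol2E[OF hol(1)] obtain a1 b1 where F': "(F has_derivative (\<lambda>h. a1 * fst h + b1 * snd h)) (at 0)" by metis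
  from hol2E[OF hol(2)] obtain a2 b2 where G': "(G has_derivative (\<lambda>h. a2 * fst h + b2 * snd h)) (at 0)" by metis
  have "has_wirtinger (\<lambda>z. F (z, cnj z)) a1 b1 0" "has_wirtinger (\<lambda>z. G (z, cnj z)) a2 b2 0"
    using hol2_has_wirtinger[of F a1 b1 0] hol2_has_wirtinger[of G a2 b2 0] F' G' by (simp_all add: zero_prod_def)
  moreover have "has_wirtinger (\<lambda>z. F (z, cnj z)) a b 0"
    by (rule has_wirtinger_cong[OF ab(1) eF])
  moreover from has_wirtinger_cnj[OF this] have "has_wirtinger (\<lambda>z. G (z, cnj z)) (cnj b) (cnj a) 0"
    by (simp add: GF)
  ultimately have "a1 = a" "b1 = b" "a2 = cnj b" "b2 = cnj a"
    using has_wirtinger_unique by blast+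
  then have "a1 * b2 - b1 * a2 \<noteq> 0" using ab(2) by simp
  from hol2_inverse_function[OF hol F0 G0 F' G' this]
  obtain g where g: "hol2 (\<lambda>p. fst (g p))" "hol2 (\<lambda>p. snd (g p))" "g 0 = 0"
    "\<forall>\<^sub>F p in nhds 0. (F (g p), G (g p)) = p" "\<forall>\<^sub>F p in nhds 0. g (F p, G p) = p" .
  define n where "n = (\<lambda>z. fst (g (z, cnj z)))"
  have ran: "ra n" unfolding ra_iff_hol2 n_def using g(1) by (intro exI[of _ "\<lambda>p. fst (g p)"]) simp
  have n0: "n 0 = 0" using g(3) by (simp add: n_def zero_prod_def)
  \<comment> \<open>The antiholomorphic reflection whose fixed points are the points
    \<open>(z, cnj z)\<close>. Below, g is used as a left inverse at the reflected point
    \<open>\<sigma> (g p)\<close>, which tends to 0 with p.\<close>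
  define \<sigma> where "\<sigma> = (\<lambda>p. (cnj (snd p), cnj (fst p)) :: complex \<times> complex)"
  have "isCont (\<lambda>p. \<sigma> (g p)) 0"
    unfolding \<sigma>_def by (intro continuous_intros hol2_isCont g)
  then have "((\<lambda>p. \<sigma> (g p)) \<longlongrightarrow> 0) (nhds 0)"
    using isCont_tendsto_nhds[of 0 "\<lambda>p. \<sigma> (g p)"] g(3) by (simp add: \<sigma>_def zero_prod_def)
  then have "\<forall>\<^sub>F p in nhds 0. g (F (\<sigma> (g p)), G (\<sigma> (g p))) = \<sigma> (g p)"
    using g(5) by (auto simp: filterlim_iff)
  from eventually_nhds_Pair_cnj[OF this] eventually_nhds_Pair_cnj[OF g(4)]
  have sym: "\<forall>\<^sub>F z in nhds 0. snd (g (z, cnj z)) = cnj (n z)"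
  proof eventually_elim
    case (elim z)
    obtain q1 q2 where q: "g (z, cnj z) = (q1, q2)" by (cases "g (z, cnj z)")
    have q12: "F (q1, q2) = z" "G (q1, q2) = cnj z" using elim(2) q by simp_all
    have "F (\<sigma> (q1, q2)) = cnj (G (q1, q2))" "G (\<sigma> (q1, q2)) = cnj (F (q1, q2))"
      by (simp_all add: \<sigma>_def GF)
    then have "F (\<sigma> (q1, q2)) = z" "G (\<sigma> (q1, q2)) = cnj z" unfolding q12 by simp_all
    then have "g (z, cnj z) = \<sigma> (q1, q2)" using elim(1)[unfolded q] by (simp only:)
    then have "(q1, q2) = \<sigma> (q1, q2)" unfolding q .
    then have "snd (q1, q2) = snd (\<sigma> (q1, q2))" by (rule arg_cong)
    then have "q2 = cnj q1" unfolding \<sigma>_def fst_conv snd_conv .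
    then show ?case by (simp add: q n_def)
  qed
  have "\<forall>\<^sub>F z in nhds 0. f (n z) = F (n z, cnj (n z))"
    using ra_eventually[OF ran, of "\<lambda>w. f w = F (w, cnj w)"] eF n0 by simp
  then have fn: "\<forall>\<^sub>F z in nhds 0. f (n z) = z"
    using sym eventually_nhds_Pair_cnj[OF g(4)]
  proof eventually_elim
    case (elim z)
    then have "(n z, cnj (n z)) = g (z, cnj z)" by (simp add: n_def prod_eq_iff)
    with elim show ?case by simp
  qed
  have nf: "\<forall>\<^sub>F z in nhds 0. n (f z) = z"
    using eF eventually_nhds_Pair_cnj[OF g(5)]
  proof eventually_elim
    case (elim z)
    have "cnj (f z) = G (z, cnj z)" using elim(1) by (simp add: GF)
    with elim have "g (f z, cnj (f z)) = (z, cnj z)" by simp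
    then show ?case by (simp add: n_def)
  qed
  show ?thesis by (rule that[OF ran n0 fn nf])
qed

lemma pser_has_sum_locally:
  assumes "convergent2 A"
  shows "\<exists>r>0. \<forall>z w. norm z < r \<longrightarrow> norm w < r \<longrightarrow>
       ((\<lambda>(m, n). coeff2 A m n * z ^ m * w ^ n) has_sum pser A (z, w)) UNIV"
  by (rule pser_locally[OF assms], rule exI, rule conjI, assumption) simp

subsection \<open>Comparison with expansions in real coordinates\<close>

lemma hol2_scaleC: "hol2 F \<Longrightarrow> hol2 (\<lambda>p. c * F p)"
  by (rule hol2_mult[OF hol2_const])

text \<open>Convergence at real points allows complex x and y, so the linear substitution x = (z +
  z')/2, y = (z - z')/(2 i) can be made with z and z' independent.\<close>

lemma ra_if_has_sum:
  fixes c :: "nat \<Rightarrow> nat \<Rightarrow> complex"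
  assumes "r > 0" "\<And>x y. \<bar>x\<bar> < r \<Longrightarrow> \<bar>y\<bar> < r \<Longrightarrow>
     ((\<lambda>(m, n). (x ^ m * y ^ n) *\<^sub>R c m n) has_sum f (Complex x y)) UNIV"
  shows "ra f"
proof -
  define A where "A = Abs_fps2 c"
  have s: "((\<lambda>(m, n). coeff2 A m n * of_real x ^ m * of_real y ^ n) has_sum f (Complex x y)) UNIV"
    if "\<bar>x\<bar> < r" "\<bar>y\<bar> < r" for x y
    using assms(2)[OF that] by (simp add: A_def scaleR_conv_of_real mult_ac)
  have "convergent2 A"
    by (rule has_sum_imp_convergent2[OF s[of "r / 2" "r / 2"], of "r / 2"]) (use assms(1) in auto)
  from pser_has_sum_locally[OF this] obtain R where R: "R > 0"
    "\<forall>z w. norm z < R \<longrightarrow> norm w < R \<longrightarrow>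
       ((\<lambda>(m, n). coeff2 A m n * z ^ m * w ^ n) has_sum pser A (z, w)) UNIV" by (elim exE conjE)
  have "\<forall>\<^sub>F z in nhds 0. f z = pser A (1 / 2 * (fst (z, cnj z) + snd (z, cnj z)),
       1 / (2 * \<i>) * (fst (z, cnj z) + (- 1) * snd (z, cnj z)))"
    using eventually_norm_less[OF assms(1)] eventually_norm_less[OF R(1)]
  proof eventually_elim
    case (elim z)
    have "\<bar>Re z\<bar> < r" "\<bar>Im z\<bar> < r" "\<bar>Re z\<bar> < R" "\<bar>Im z\<bar> < R"
      using elim abs_Re_le_cmod[of z] abs_Im_le_cmod[of z] by linarith+
    then have "f (Complex (Re z) (Im z)) = pser A (of_real (Re z), of_real (Im z))"
      by (intro has_sum_unique[OF s R(2)[rule_format]]) auto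
    moreover have "1 / 2 * (z + cnj z) = of_real (Re z)" "1 / (2 * \<i>) * (z + (- 1) * cnj z) = of_real (Im z)"
      by (simp_all add: complex_add_cnj complex_diff_cnj field_simps)
    ultimately show ?case by simp
  qed
  moreover have "hol2 (\<lambda>p. pser A (1 / 2 * (fst p + snd p), 1 / (2 * \<i>) * (fst p + (- 1) * snd p)))"
    by (intro hol2_compose hol2_pser \<open>convergent2 A\<close> hol2_scaleC hol2_add hol2_fst hol2_snd)
      (simp_all add: zero_prod_def)
  ultimately show ?thesis unfolding ra_iff_hol2 by (intro exI conjI)
qed

lemma real_analytic_at_imp_ra:
  fixes f :: "complex \<Rightarrow> complex"
  assumes "real_analytic_at f 0"
  shows "ra f"
  using assms ra_if_has_sum unfolding real_analytic_at_def add_0 by (elim exE conjE) blast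

lemma real_analytic_at_real_imp_ra:
  fixes f :: "complex \<Rightarrow> real"
  assumes "real_analytic_at f 0"
  shows "ra (\<lambda>z. of_real (f z))"
proof -
  obtain c r where r: "r > 0" and s: "\<And>x y. \<bar>x\<bar> < r \<Longrightarrow> \<bar>y\<bar> < r \<Longrightarrow>
        ((\<lambda>(m, n). (x ^ m * y ^ n) *\<^sub>R c m n) has_sum f (0 + Complex x y)) UNIV"
    using assms unfolding real_analytic_at_def by (elim exE conjE) blast
  show ?thesis
  proof (rule ra_if_has_sum[OF r, of "\<lambda>m n. of_real (c m n)"])
    fix x y assume "\<bar>x\<bar> < r" "\<bar>y\<bar> < r"
    from s[OF this] have "((\<lambda>k. of_real (case k of (m, n) \<Rightarrow> (x ^ m * y ^ n) *\<^sub>R c m n) :: complex)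
        has_sum of_real (f (0 + Complex x y))) UNIV"
      by (simp only: has_sum_of_real_iff)
    then show "((\<lambda>(m, n). (x ^ m * y ^ n) *\<^sub>R complex_of_real (c m n)) has_sum of_real (f (Complex x y))) UNIV"
      by (simp add: case_prod_unfold scaleR_conv_of_real)
  qed
qed

text \<open>The inverse substitution z = x + i y, z' = x - i y with x and y complex; Osgood's lemma
  then provides the expansion in x and y.\<close>

lemma ra_imp_real_analytic_at:
  assumes "ra f"
  shows "real_analytic_at f 0"
proof -
  obtain F where F: "hol2 F" "\<forall>\<^sub>F z in nhds 0. f z = F (z, cnj z)" using assms by (rule ra_hol2E)
  have "hol2 (\<lambda>p. F (fst p + \<i> * snd p, fst p + (- \<i>) * snd p))"
    by (intro hol2_compose F(1) hol2_scaleC hol2_add hol2_fst hol2_snd) simp_all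
  from osgood[OF this] obtain A where A: "convergent2 A"
    "\<forall>\<^sub>F p in nhds 0. F (fst p + \<i> * snd p, fst p + (- \<i>) * snd p) = pser A p" .
  from pser_has_sum_locally[OF A(1)] obtain R where R: "R > 0"
    "\<forall>z w. norm z < R \<longrightarrow> norm w < R \<longrightarrow>
       ((\<lambda>(m, n). coeff2 A m n * z ^ m * w ^ n) has_sum pser A (z, w)) UNIV" by (elim exE conjE)
  obtain e1 where e1: "e1 > 0" "\<And>z. norm z < e1 \<Longrightarrow> f z = F (z, cnj z)"
    using F(2) unfolding eventually_nhds_metric by auto
  obtain e2 where e2: "e2 > 0" "\<And>p. norm p < e2 \<Longrightarrow> F (fst p + \<i> * snd p, fst p + (- \<i>) * snd p) = pser A p"
    using A(2) unfolding eventually_nhds_metric by auto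
  \<comment> \<open>Halves, because the norm of a point is estimated by |x| + |y|.\<close>
  define r where "r = min R (min (e1 / 2) (e2 / 2))"
  have "((\<lambda>(m, n). (x ^ m * y ^ n) *\<^sub>R coeff2 A m n) has_sum f (0 + Complex x y)) UNIV"
    if "\<bar>x\<bar> < r" "\<bar>y\<bar> < r" for x y
  proof -
    have "norm (Complex x y) < e1"
      using that cmod_le[of "Complex x y"] by (simp add: r_def)
    then have "f (Complex x y) = F (Complex x y, cnj (Complex x y))" by (rule e1(2))
    also have "Complex x y = of_real x + \<i> * of_real y" by (rule complex_eqI) simp_all
    also have "cnj (of_real x + \<i> * of_real y) = of_real x + (- \<i>) * of_real y" by simp
    also have "F (of_real x + \<i> * of_real y, of_real x + (- \<i>) * of_real y) = pser A (of_real x, of_real y)"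
      using e2(2)[of "(of_real x, of_real y)"] norm_Pair_le[of "of_real x :: complex" "of_real y :: complex"] that
      by (simp add: r_def)
    finally have "f (Complex x y) = pser A (of_real x, of_real y)"
      unfolding \<open>Complex x y = of_real x + \<i> * of_real y\<close> .
    then show ?thesis
      using R(2)[rule_format, of "of_real x" "of_real y"] that by (simp add: r_def scaleR_conv_of_real mult_ac)
  qed
  moreover have "r > 0" using R e1 e2 by (simp add: r_def)
  ultimately show ?thesis unfolding real_analytic_at_def by blast
qed

subsection \<open>Symplectic germs\<close>

text \<open>The determinant of the real linear map u \<mapsto> a u + b \<open>cnj u\<close>. It is
  complex-valued, although real by \<open>jac_real\<close>, so that as a function of the point it
  can have a \<open>has_expansion2\<close>.\<close>

definition jac :: "complex \<Rightarrow> complex \<Rightarrow> complex" where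
  "jac a b = a * cnj a - b * cnj b"

lemma area_form_wirtinger:
  "area_form (a * u + b * cnj u) (a * v + b * cnj v) = Re (jac a b) * area_form u v"
  by (simp add: area_form_def jac_def algebra_simps)

lemma jac_real: "Im (jac a b) = 0"
  by (simp add: jac_def)

lemma jac_compose: "jac (c * a + d * cnj b) (c * b + d * cnj a) = jac c d * jac a b"
  by (simp add: jac_def algebra_simps)

lemma symplectic_germ_iff:
  assumes "\<forall>\<^sub>F z in nhds 0. has_wirtinger f (a z) (b z) z"
  shows "symplectic_germ f \<longleftrightarrow> (\<forall>\<^sub>F z in nhds 0. jac (a z) (b z) = 1)"
proof -
  have "(\<exists>D. (f has_derivative D) (at z) \<and> (\<forall>u v. area_form (D u) (D v) = area_form u v))
     \<longleftrightarrow> jac (a z) (b z) = 1" if w: "has_wirtinger f (a z) (b z) z" for z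
  proof
    assume "\<exists>D. (f has_derivative D) (at z) \<and> (\<forall>u v. area_form (D u) (D v) = area_form u v)"
    then obtain D where D: "(f has_derivative D) (at z)" "area_form (D 1) (D \<i>) = area_form 1 \<i>" by blast
    have "D = (\<lambda>u. a z * u + b z * cnj u)"
      using D(1) w unfolding has_wirtinger_def by (rule has_derivative_unique)
    with D(2) have "Re (jac (a z) (b z)) = 1"
      by (simp only: area_form_wirtinger) (simp add: area_form_def)
    then show "jac (a z) (b z) = 1" by (simp add: complex_eq_iff jac_real)
  next
    assume "jac (a z) (b z) = 1"
    then show "\<exists>D. (f has_derivative D) (at z) \<and> (\<forall>u v. area_form (D u) (D v) = area_form u v)"
      using w unfolding has_wirtinger_def
      by (intro exI[of _ "\<lambda>u. a z * u + b z * cnj u"]) (simp only: area_form_wirtinger, simp)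
  qed
  then show ?thesis
    unfolding symplectic_germ_def using assms by (intro eventually_subst) (elim eventually_mono)
qed

text \<open>Built from the expansion rather than from the derivative of the germ, so that its own
  expansion is explicit.\<close>

definition jacobian :: "fps2 \<Rightarrow> complex \<Rightarrow> complex" where
  "jacobian A z = jac (ev (deriv_z A) z) (ev (deriv_zbar A) z)"

lemma symplectic_germ_iff_jacobian:
  "has_expansion2 f A \<Longrightarrow> symplectic_germ f \<longleftrightarrow> (\<forall>\<^sub>F z in nhds 0. jacobian A z = 1)"
  unfolding jacobian_def by (rule symplectic_germ_iff[OF has_expansion2_wirtinger_ev])

lemma has_expansion2_jacobian:
  assumes "has_expansion2 f A"
  shows "has_expansion2 (jacobian A)
    (deriv_z A * cnj2 (deriv_z A) - deriv_zbar A * cnj2 (deriv_zbar A))"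
  unfolding jacobian_def[abs_def] jac_def
  by (intro has_expansion2_diff has_expansion2_mult has_expansion2_cnj has_expansion2_ev_deriv[OF assms])

lemma jacobian_var_z: "\<forall>\<^sub>F z in nhds 0. jacobian var_z z = 1"
  using symplectic_germ_iff_jacobian[OF has_expansion2_ident]
    symplectic_germ_iff[OF always_eventually[OF allI[OF has_wirtinger_ident]]] by (simp add: jac_def)

lemma jacobian_compose:
  assumes "has_expansion2 f A" "has_expansion2 p P" "p 0 = 0" "has_expansion2 (\<lambda>z. f (p z)) C"
  shows "\<forall>\<^sub>F z in nhds 0. jacobian C z = jacobian A (p z) * jacobian P z"
proof -
  have "\<forall>\<^sub>F z in nhds 0. has_wirtinger f (ev (deriv_z A) (p z)) (ev (deriv_zbar A) (p z)) (p z)"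
    using ra_eventually[OF has_expansion2_ra[OF assms(2)]] has_expansion2_wirtinger_ev[OF assms(1)] assms(3)
    by simp
  with has_expansion2_wirtinger_ev[OF assms(2)] has_expansion2_wirtinger_ev[OF assms(4)] show ?thesis
  proof eventually_elim
    case (elim z)
    from has_wirtinger_unique[OF elim(2) has_wirtinger_compose[OF elim(1,3)]] show ?case
      unfolding jacobian_def by (simp only: jac_compose)
  qed
qed

lemma symplectic_germ_formal:
  assumes "has_expansion2 f A" "symplectic_germ f"
  shows "formal_symplectic A"
proof -
  have "\<forall>\<^sub>F z in nhds 0. jacobian A z = 1"
    using symplectic_germ_iff_jacobian assms by blast
  from has_expansion2_unique[OF has_expansion2_cong[OF has_expansion2_jacobian[OF assms(1)] this] has_expansion2_const]
  show ?thesis by (simp add: formal_symplectic_def deriv_z_cnj2 deriv_zbar_cnj2 const2_simps)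
qed

lemma symplectic_germ_compose:
  assumes "ra f" "ra p" "p 0 = 0" "symplectic_germ f" "symplectic_germ p"
  shows "symplectic_germ (\<lambda>z. f (p z))"
proof -
  obtain A where A: "has_expansion2 f A" using assms(1) by (rule raE)
  obtain P where P: "has_expansion2 p P" using assms(2) by (rule raE)
  have "\<forall>\<^sub>F z in nhds 0. jacobian A (p z) = 1"
    using ra_eventually[OF assms(2), of "\<lambda>w. jacobian A w = 1"] symplectic_germ_iff_jacobian[OF A] assms(3,4) by simp
  moreover have "\<forall>\<^sub>F z in nhds 0. jacobian P z = 1"
    using symplectic_germ_iff_jacobian[OF P] assms(5) by simp
  ultimately have "\<forall>\<^sub>F z in nhds 0. jacobian (formal_comp A P) z = 1"
    using jacobian_compose[OF A P assms(3) has_expansion2_compose[OF A P assms(3)]]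
    by eventually_elim simp
  then show ?thesis using symplectic_germ_iff_jacobian[OF has_expansion2_compose[OF A P assms(3)]] by simp
qed

lemma symplectic_germ_inverse:
  assumes "ra f" "ra p" "p 0 = 0" "symplectic_germ f" "\<forall>\<^sub>F z in nhds 0. f (p z) = z"
  shows "symplectic_germ p"
proof -
  obtain A where A: "has_expansion2 f A" using assms(1) by (rule raE)
  obtain P where P: "has_expansion2 p P" using assms(2) by (rule raE)
  have "has_expansion2 (\<lambda>z. f (p z)) var_z"
    by (rule has_expansion2_cong[OF has_expansion2_ident]) (use assms(5) in eventually_elim, simp)
  note jacobian_compose[OF A P assms(3) this]
  moreover have "\<forall>\<^sub>F z in nhds 0. jacobian A (p z) = 1"
    using ra_eventually[OF assms(2), of "\<lambda>w. jacobian A w = 1"] symplectic_germ_iff_jacobian[OF A] assms(3,4) by simp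
  ultimately have "\<forall>\<^sub>F z in nhds 0. jacobian P z = 1"
    using jacobian_var_z by eventually_elim simp
  then show ?thesis using symplectic_germ_iff_jacobian[OF P] by simp
qed

section \<open>The isochore Morse lemma\<close>

lemma ra_has_wirtinger_0:
  assumes "ra f"
  obtains a b where "has_wirtinger f a b 0"
  using assms has_wirtinger_at_0 by (elim raE) blast

lemma has_wirtinger_real:
  assumes "has_wirtinger f a b z" "\<forall>\<^sub>F w in nhds z. cnj (f w) = f w"
  shows "b = cnj a"
  using has_wirtinger_unique(2)[OF assms(1) has_wirtinger_cong[OF has_wirtinger_cnj[OF assms(1)] assms(2)]] .

lemma has_expansion2_real_iff:
  assumes "has_expansion2 f A"
  shows "(\<forall>\<^sub>F z in nhds 0. cnj (f z) = f z) \<longleftrightarrow> cnj2 A = A"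
proof
  assume "\<forall>\<^sub>F z in nhds 0. cnj (f z) = f z"
  from has_expansion2_unique[OF has_expansion2_cong[OF has_expansion2_cnj[OF assms] this] assms]
  show "cnj2 A = A" .
next
  assume "cnj2 A = A"
  then have "\<forall>\<^sub>F z in nhds 0. cnj (f z) = ev A z"
    using has_expansion2_eq_ev[OF has_expansion2_cnj[OF assms]] by simp
  with has_expansion2_eq_ev[OF assms] show "\<forall>\<^sub>F z in nhds 0. cnj (f z) = f z"
    by eventually_elim simp
qed

lemma has_expansion2_eqI:
  assumes "has_expansion2 f A" "has_expansion2 g A"
  shows "\<forall>\<^sub>F z in nhds 0. f z = g z"
  using has_expansion2_eq_ev[OF assms(1)] has_expansion2_eq_ev[OF assms(2)] by eventually_elim simp

text \<open>Near 0 the values of f lie in the right half-plane, where the principal branch is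
  holomorphic, and they are real, so the branch is the positive real root.\<close>

lemma csqrt_real_germ:
  assumes "ra f" "\<forall>\<^sub>F z in nhds 0. cnj (f z) = f z" "f 0 = of_real x" "x > 0"
  shows "ra (\<lambda>z. csqrt (f z))" "\<forall>\<^sub>F z in nhds 0. cnj (csqrt (f z)) = csqrt (f z)"
    "\<forall>\<^sub>F z in nhds 0. csqrt (f z) \<noteq> 0"
proof -
  show "ra (\<lambda>z. csqrt (f z))"
    using assms by (intro ra_csqrt) (auto simp: complex_nonpos_Reals_iff)
  have "\<forall>\<^sub>F w in nhds (f 0). Re w > 0"
    using assms by (intro eventually_nhds_in_open[of "{w. Re w > 0}", simplified] open_halfspace_Re_gt) simp
  then have pos: "\<forall>\<^sub>F z in nhds 0. Re (f z) > 0" by (rule ra_eventually[OF assms(1)])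
  show "\<forall>\<^sub>F z in nhds 0. csqrt (f z) \<noteq> 0" using pos by eventually_elim auto
  show "\<forall>\<^sub>F z in nhds 0. cnj (csqrt (f z)) = csqrt (f z)"
    using pos assms(2)
  proof eventually_elim
    case (elim z)
    then have "f z = of_real (Re (f z))" by (simp add: complex_eq_iff)
    then have "csqrt (f z) = of_real (sqrt (Re (f z)))"
      using elim(1) of_real_sqrt[of "Re (f z)"] by simp
    then show ?case by simp
  qed
qed

text \<open>
  Write \<open>I = z\<^sup>2 \<alpha> + z z' \<beta> + z'\<^sup>2 \<alpha>'\<close> with \<open>\<beta>\<close> real and look for \<open>M = p z + q z'\<close> with \<open>p\<close> real:
  then \<open>q = \<alpha>' / p\<close>, and \<open>p\<^sup>2\<close> is the larger root of \<open>t\<^sup>2 - \<beta> t + \<alpha> \<alpha>' = 0\<close>.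
\<close>

lemma morse_lemma:
  assumes I: "has_expansion2 I A" and real: "cnj2 A = A"
    and A: "coeff2 A 0 0 = 0" "coeff2 A 1 0 = 0" "coeff2 A 2 0 = 0" "coeff2 A 1 1 = of_real c" and c: "c > 0"
  obtains M m where "ra M" "M 0 = 0" "m > 0" "has_wirtinger M (of_real m) 0 0"
    "\<forall>\<^sub>F z in nhds 0. M z * cnj (M z) = I z"
proof -
  note cA = has_expansion2_convergent2[OF I]
  have sym: "cnj (coeff2 A n m) = coeff2 A m n" for m n
    using real coeff2_cnj2 by metis
  \<comment> \<open>The pure powers of z go to A1, everything divisible by \<open>z z'\<close> goes
    to B; by reality the pure powers of \<open>z'\<close> are the conjugate of the first
    part.\<close>
  define A1 where "A1 = Abs_fps2 (\<lambda>m n. if n = 0 then coeff2 A (m + 2) 0 else 0)"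
  define B where "B = Abs_fps2 (\<lambda>m n. coeff2 A (m + 1) (n + 1))"
  have cA1: "convergent2 A1"
    by (rule convergent2_shifted[OF cA, of _ 2 0]) (auto simp: A1_def)
  have cB: "convergent2 B"
    by (rule convergent2_shifted[OF cA, of _ 1 1]) (auto simp: B_def)
  define \<alpha> where "\<alpha> = ev A1"
  define \<beta> where "\<beta> = ev B"
  have e: "has_expansion2 \<alpha> A1" "has_expansion2 \<beta> B"
    unfolding \<alpha>_def \<beta>_def using cA1 cB by (simp_all add: convergent2_has_expansion2)
  have r: "ra \<alpha>" "ra \<beta>" using e has_expansion2_ra by blast+
  have \<alpha>0: "\<alpha> 0 = 0" and \<beta>0: "\<beta> 0 = of_real c"
    using has_expansion2_at_0[OF e(1)] has_expansion2_at_0[OF e(2)] A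
    by (simp_all add: A1_def B_def numeral_2_eq_2)
  have "cnj2 B = B" by (rule fps2_eqI) (simp add: B_def sym)
  then have \<beta>_real: "\<forall>\<^sub>F z in nhds 0. cnj (\<beta> z) = \<beta> z" using has_expansion2_real_iff[OF e(2)] by simp
  have "A = var_z * (var_z * A1) + var_z * (var_zbar * B) + var_zbar * (var_zbar * cnj2 A1)"
  proof (rule fps2_eqI)
    fix m n :: nat
    consider "m = 0" "n = 0" | "m = 0" "n = 1" | n' where "m = 0" "n = Suc (Suc n')"
      | "m = 1" "n = 0" | m' where "m = Suc (Suc m')" "n = 0" | m' n' where "m = Suc m'" "n = Suc n'"
      by (metis One_nat_def not0_implies_Suc)
    then show "coeff2 A m n = coeff2 (var_z * (var_z * A1) + var_z * (var_zbar * B) + var_zbar * (var_zbar * cnj2 A1)) m n"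
      using A sym[of 1 0] by cases (auto simp: coeff2_var_z_mult coeff2_var_zbar_mult coeff2_var_z coeff2_var_zbar A1_def B_def sym)
  qed
  moreover have "has_expansion2 (\<lambda>z. z * (z * \<alpha> z) + z * (cnj z * \<beta> z) + cnj z * (cnj z * cnj (\<alpha> z)))
     (var_z * (var_z * A1) + var_z * (var_zbar * B) + var_zbar * (var_zbar * cnj2 A1))"
    by (intro has_expansion2_add has_expansion2_mult has_expansion2_cnj has_expansion2_ident
        has_expansion2_cnj_ident e)
  ultimately have I_eq: "\<forall>\<^sub>F z in nhds 0. I z = z * (z * \<alpha> z) + z * (cnj z * \<beta> z) + cnj z * (cnj z * cnj (\<alpha> z))"
    using has_expansion2_eqI[OF I] by simp
  \<comment> \<open>The discriminant of the quadratic equation for p^2. As \<alpha> vanishes at 0,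
    its value there is c^2, so the root q is c at 0, and both square roots are taken near positive
    reals.\<close>
  define \<delta> where "\<delta> = (\<lambda>z. \<beta> z * \<beta> z - 4 * (\<alpha> z * cnj (\<alpha> z)))"
  have ra\<delta>: "ra \<delta>" unfolding \<delta>_def by (intro ra_diff ra_mult ra_const ra_cnj r)
  have \<delta>0: "\<delta> 0 = of_real (c\<^sup>2)" by (simp add: \<delta>_def \<alpha>0 \<beta>0 power2_eq_square)
  have \<delta>_real: "\<forall>\<^sub>F z in nhds 0. cnj (\<delta> z) = \<delta> z"
    using \<beta>_real by eventually_elim (simp add: \<delta>_def mult.commute)
  note s = csqrt_real_germ[OF ra\<delta> \<delta>_real \<delta>0 zero_less_power[OF c]]
  define q where "q = (\<lambda>z. (\<beta> z + csqrt (\<delta> z)) * (1 / 2))"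
  have raq: "ra q" unfolding q_def by (intro ra_mult ra_const ra_add r s)
  have q0: "q 0 = of_real c" using c of_real_sqrt[of "c\<^sup>2"] by (simp add: q_def \<beta>0 \<delta>0)
  have q_real: "\<forall>\<^sub>F z in nhds 0. cnj (q z) = q z"
    using \<beta>_real s(2) by eventually_elim (simp add: q_def)
  note p = csqrt_real_germ[OF raq q_real q0 c]
  define p' where "p' = (\<lambda>z. csqrt (q z))"
  have p0: "p' 0 = of_real (sqrt c)" using c of_real_sqrt[of c] by (simp add: p'_def q0)
  have p0': "p' 0 \<noteq> 0" using c p0 by simp
  define M where "M = (\<lambda>z. p' z * z + (cnj (\<alpha> z) / p' z) * cnj z)"
  have rap: "ra p'" unfolding p'_def by (rule p)
  have rad: "ra (\<lambda>z. cnj (\<alpha> z) / p' z)" by (intro ra_divide ra_cnj r rap p0')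
  have raM: "ra M"
    unfolding M_def by (intro ra_add ra_mult rap rad ra_ident ra_cnj_ident)
  have M0: "M 0 = 0" by (simp add: M_def)
  \<comment> \<open>The coefficient of \<open>cnj z\<close> in M vanishes at 0 together with
    \<alpha>; this is the effect of the missing \<open>z^2\<close> term.\<close>
  have wM: "has_wirtinger M (of_real (sqrt c)) 0 0"
  proof -
    obtain a b where 1: "has_wirtinger p' a b 0" using rap by (rule ra_has_wirtinger_0)
    obtain d e where 2: "has_wirtinger (\<lambda>z. cnj (\<alpha> z) / p' z) d e 0" using rad by (rule ra_has_wirtinger_0)
    from has_wirtinger_add[OF has_wirtinger_mult[OF 1 has_wirtinger_ident]
        has_wirtinger_mult[OF 2 has_wirtinger_cnj[OF has_wirtinger_ident]]]
    show ?thesis by (simp add: M_def p0 \<alpha>0)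
  qed
  have "\<forall>\<^sub>F z in nhds 0. M z * cnj (M z) = I z"
    using I_eq p(2,3) \<beta>_real
  proof eventually_elim
    case (elim z)
    have pr: "cnj (p' z) = p' z" "p' z \<noteq> 0" using elim by (simp_all add: p'_def)
    have pq: "p' z * p' z = q z" by (simp add: p'_def flip: power2_eq_square)
    have ss: "csqrt (\<delta> z) * csqrt (\<delta> z) = \<delta> z" by (simp flip: power2_eq_square)
    have "q z * q z + \<alpha> z * cnj (\<alpha> z) = \<beta> z * q z"
    proof -
      define x where "x = csqrt (\<delta> z)"
      have qx: "q z = (\<beta> z + x) * (1 / 2)" by (simp add: q_def x_def)
      have "\<alpha> z * cnj (\<alpha> z) = (\<beta> z * \<beta> z - x * x) / 4"
        using ss unfolding x_def[symmetric] by (simp add: \<delta>_def)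
      then show ?thesis unfolding qx by (simp only:) (simp add: field_simps)
    qed
    then have "p' z * p' z * (p' z * p' z) + \<alpha> z * cnj (\<alpha> z) = \<beta> z * (p' z * p' z)" by (simp add: pq)
    then have k: "p' z * p' z + \<alpha> z * cnj (\<alpha> z) / (p' z * p' z) = \<beta> z"
      using pr(2) by (simp add: field_simps)
    have "M z * cnj (M z) = (p' z * z + cnj (\<alpha> z) / p' z * cnj z) * (p' z * cnj z + \<alpha> z / p' z * z)"
      by (simp add: M_def pr)
    also have "\<dots> = z * cnj z * (p' z * p' z + \<alpha> z * cnj (\<alpha> z) / (p' z * p' z)) + z * (z * \<alpha> z) + cnj z * (cnj z * cnj (\<alpha> z))"
      using pr(2) by (simp add: field_simps)
    also have "\<dots> = I z" unfolding k elim(1) by (simp add: algebra_simps)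
    finally show ?case .
  qed
  then show ?thesis using that[OF raM M0 _ wM] c by simp
qed

section \<open>Maps in polar form and the angular derivative\<close>

lemma has_wirtinger_polar:
  assumes "has_wirtinger K K1 K2 z" "has_wirtinger u u1 u2 z"
  shows "has_wirtinger (\<lambda>z. z * K z * exp (\<i> * u z))
     (exp (\<i> * u z) * (K z + z * K1 + \<i> * z * K z * u1)) (exp (\<i> * u z) * (z * K2 + \<i> * z * K z * u2)) z"
proof -
  have "has_wirtinger (\<lambda>z. \<i> * u z) (0 * u z + \<i> * u1) (0 * u z + \<i> * u2) z"
    by (rule has_wirtinger_mult[OF has_wirtinger_const assms(2)])
  from has_wirtinger_field[OF this DERIV_exp]
    has_wirtinger_mult[OF has_wirtinger_ident assms(1)]
  have "has_wirtinger (\<lambda>z. exp (\<i> * u z)) (exp (\<i> * u z) * (\<i> * u1)) (exp (\<i> * u z) * (\<i> * u2)) z"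
    "has_wirtinger (\<lambda>z. z * K z) (K z + z * K1) (z * K2) z"
    by simp_all
  from has_wirtinger_mult[OF this(2,1)] show ?thesis by (simp add: algebra_simps)
qed

text \<open>The hypothesis \<open>z * K1 = cnj z * K2\<close> says that K is constant along circles.
  In t = |z|^2 and the angle, the Jacobian is the derivative of t K^2 in t times that of (angle + u)
  in the angle; the latter is 1 + i (z u1 - z' u2).\<close>

lemma jac_polar:
  assumes "cnj K = K" "K2 = cnj K1" "u2 = cnj u1" "z * K1 = cnj z * K2" "E * cnj E = 1"
  shows "jac (E * (K + z * K1 + \<i> * z * K * u1)) (E * (z * K2 + \<i> * z * K * u2)) =
     (K * K + 2 * K * (z * K1)) * (1 + \<i> * (z * u1 - cnj z * u2))"
proof -
  have "cnj K1 = K2" "cnj K2 = K1" "cnj u1 = u2" "cnj u2 = u1" using assms by simp_all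
  note r = assms(1) this
  have "jac (E * (K + z * K1 + \<i> * z * K * u1)) (E * (z * K2 + \<i> * z * K * u2)) = (E * cnj E) *
     ((K + z * K1 + \<i> * z * K * u1) * (K + cnj z * K2 - \<i> * cnj z * K * u2) -
      (cnj z * K2 + \<i> * cnj z * K * u2) * (z * K1 - \<i> * z * K * u1))"
    by (simp add: jac_def r algebra_simps)
  then show ?thesis
    unfolding assms(5) assms(4)[symmetric] by (simp add: algebra_simps)
qed

text \<open>The operator is -\<i> times the derivative in the angle. Monomials are eigenvectors with
  the integer eigenvalues m - n, so inverting it off the diagonal does not enlarge
  coefficients.\<close>

lemma has_expansion2_angular:
  assumes "has_expansion2 u A" "\<forall>\<^sub>F z in nhds 0. has_wirtinger u (u1 z) (u2 z) z"
  shows "has_expansion2 (\<lambda>z. z * u1 z - cnj z * u2 z) (Abs_fps2 (\<lambda>m n. (of_nat m - of_nat n) * coeff2 A m n))"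
proof -
  have "has_expansion2 (\<lambda>z. z * u1 z - cnj z * u2 z) (var_z * deriv_z A - var_zbar * deriv_zbar A)"
    by (intro has_expansion2_diff has_expansion2_mult has_expansion2_ident has_expansion2_cnj_ident
        has_expansion2_wirtinger[OF assms])
  moreover have "var_z * deriv_z A - var_zbar * deriv_zbar A = Abs_fps2 (\<lambda>m n. (of_nat m - of_nat n) * coeff2 A m n)"
  proof (rule fps2_eqI)
    show "coeff2 (var_z * deriv_z A - var_zbar * deriv_zbar A) m n =
        coeff2 (Abs_fps2 (\<lambda>m n. (of_nat m - of_nat n) * coeff2 A m n)) m n" for m n
      by (cases m; cases n)
        (simp_all add: coeff2_var_z coeff2_var_zbar coeff2_var_z_mult coeff2_var_zbar_mult algebra_simps)
  qed
  ultimately show ?thesis by simp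
qed

text \<open>Needed to see that the norm of the symplectic coordinate is a function of the norm of
  M.\<close>

lemma ev_diag2_norm_cong: "norm z = norm w \<Longrightarrow> ev (diag2 a) z = ev (diag2 a) w"
proof -
  assume "norm z = norm w"
  then have "z * cnj z = w * cnj w" by (simp flip: complex_norm_square)
  then have "z ^ n * cnj z ^ n = w ^ n * cnj w ^ n" for n by (simp flip: power_mult_distrib)
  then show ?thesis
    unfolding ev_def pser_def by (intro infsum_cong) (auto simp: coeff2_diag2 mult.assoc)
qed

text \<open>
  If \<open>a\<close> is the area density in the coordinate \<open>M\<close>, then \<open>z \<mapsto> z K e\<^bsup>iu\<^esup>\<close>, with \<open>K\<close> a function of
  \<open>z z'\<close>, has Jacobian \<open>a\<close> as soon as \<open>(z z' K\<^sup>2)' = b\<close>, where \<open>b\<close> is the part of \<open>a\<close> with equal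
  exponents, and \<open>i (z \<partial>\<^sub>z - z' \<partial>\<^bsub>z'\<^esub>) (b u) = a - b\<close>. The second equation is solved by dividing the
  coefficient of \<open>z\<^sup>m z'\<^sup>n\<close> by \<open>i (m - n)\<close>, so there are no small divisors and \<open>u\<close> converges.
\<close>

lemma symplectic_morse_coordinate:
  assumes M: "ra M" "M 0 = 0" "has_wirtinger M (of_real m) 0 0" "m > 0"
  obtains \<Psi> \<kappa> where "ra \<Psi>" "\<Psi> 0 = 0" "symplectic_germ \<Psi>" "has_wirtinger \<Psi> 1 0 0"
    "\<forall>\<^sub>F z in nhds 0. norm (\<Psi> z) = \<kappa> (norm (M z))"
proof -
  have "of_real m * cnj (of_real m) - 0 * cnj 0 \<noteq> (0 :: complex)" using M(4) by simp
  from ra_inverse_function[OF M(1,2,3) this] obtain N where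
    N: "ra N" "N 0 = 0" "\<forall>\<^sub>F z in nhds 0. M (N z) = z" "\<forall>\<^sub>F z in nhds 0. N (M z) = z" .
  obtain MA where MA: "has_expansion2 M MA" using M(1) by (rule raE)
  obtain NA where NA: "has_expansion2 N NA" using N(1) by (rule raE)
  \<comment> \<open>The area density in the coordinate M: pulling the area form back by the inverse
    N multiplies it by this function.\<close>
  define a where "a = jacobian NA"
  have raa: "ra a" unfolding a_def using has_expansion2_jacobian[OF NA] by (rule has_expansion2_ra)
  have a_real: "\<forall>\<^sub>F z in nhds 0. cnj (a z) = a z"
    by (simp add: a_def jacobian_def jac_real complex_eq_iff)
  have "has_expansion2 (\<lambda>z. N (M z)) var_z"
    by (rule has_expansion2_cong[OF has_expansion2_ident]) (use N(4) in eventually_elim, simp)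
  from jacobian_compose[OF NA MA M(2) this] jacobian_var_z
  have jNM: "\<forall>\<^sub>F z in nhds 0. a (M z) * jacobian MA z = 1"
    by eventually_elim (simp add: a_def)
  have "jacobian MA 0 = of_real (m\<^sup>2)"
    using has_wirtinger_unique[OF eventually_nhds_x_imp_x[OF has_expansion2_wirtinger_ev[OF MA]] M(3)]
    by (simp add: jacobian_def jac_def power2_eq_square)
  then have a0: "a 0 = of_real (1 / m\<^sup>2)"
    using eventually_nhds_x_imp_x[OF jNM] M(2,4) by (simp add: field_simps)
  obtain S where S: "has_expansion2 a S" using raa by (rule raE)
  have S_real: "cnj2 S = S" using a_real has_expansion2_real_iff[OF S] by simp
  have S_sym: "cnj (coeff2 S j i) = coeff2 S i j" for i j using S_real coeff2_cnj2 by metis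
  note cS = has_expansion2_convergent2[OF S]
  have S00: "coeff2 S 0 0 = of_real (1 / m\<^sup>2)" using has_expansion2_at_0[OF S] a0 by simp
  \<comment> \<open>The mean of a over circles, a function of \<open>z z'\<close> alone.\<close>
  define b where "b = ev (diag2 (Abs_fps (\<lambda>n. coeff2 S n n)))"
  \<comment> \<open>This will be K^2. The divisor n + 1 integrates b in t = \<open>z z'\<close>,
    without constant of integration, and divides by t: the derivative of t k is b.\<close>
  define kf where "kf = Abs_fps (\<lambda>n. coeff2 S n n / of_nat (Suc n))"
  define k where "k = ev (diag2 kf)"
  \<comment> \<open>The equation leaves the diagonal coefficients free. With the value 0 the
    functions v and u vanish at 0, so no rotation is added to the linear part.\<close>
  define W where "W = Abs_fps2 (\<lambda>i j. if i = j then 0 else coeff2 S i j / (\<i> * (of_nat i - of_nat j)))"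
  define v where "v = ev W"
  have dom: "convergent2 B" if "\<And>i j. norm (coeff2 B i j) \<le> norm (coeff2 S i j)" for B
    by (rule convergent2_shifted[OF cS, of _ 0 0]) (use that in simp)
  have eb: "has_expansion2 b (diag2 (Abs_fps (\<lambda>n. coeff2 S n n)))"
    unfolding b_def by (intro convergent2_has_expansion2 dom) (auto simp: coeff2_diag2)
  have ek: "has_expansion2 k (diag2 kf)"
    unfolding k_def kf_def
  proof (intro convergent2_has_expansion2 dom)
    fix i j
    have "norm (coeff2 S j j) / real (Suc j) \<le> norm (coeff2 S j j) / 1"
      by (intro divide_left_mono) auto
    then show "norm (coeff2 (diag2 (Abs_fps (\<lambda>n. coeff2 S n n / of_nat (Suc n)))) i j) \<le> norm (coeff2 S i j)"
      by (auto simp: coeff2_diag2 norm_divide simp del: of_nat_Suc)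
  qed
  have ev: "has_expansion2 v W"
    unfolding v_def W_def
  proof (intro convergent2_has_expansion2 dom)
    fix i j
    show "norm (coeff2 (Abs_fps2 (\<lambda>i j. if i = j then 0 else coeff2 S i j / (\<i> * (of_nat i - of_nat j)))) i j)
        \<le> norm (coeff2 S i j)"
    proof (cases "i = j")
      case False
      have "norm (of_nat i - of_nat j :: complex) = norm (of_int (int i - int j) :: complex)" by simp
      also have "\<dots> = of_int \<bar>int i - int j\<bar>" by (simp only: norm_of_int of_int_abs)
      also have "\<dots> \<ge> 1" using False by linarith
      finally have "norm (coeff2 S i j) / norm (of_nat i - of_nat j :: complex) \<le> norm (coeff2 S i j) / 1"
        by (intro divide_left_mono) auto
      then show ?thesis using False by (simp add: norm_divide norm_mult)
    qed simp
  qed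
  have rab: "ra b" "ra k" "ra v" using eb ek ev has_expansion2_ra by blast+
  have b0: "b 0 = of_real (1 / m\<^sup>2)" and k0: "k 0 = of_real (1 / m\<^sup>2)" and v0: "v 0 = 0"
    using has_expansion2_at_0[OF eb] has_expansion2_at_0[OF ek] has_expansion2_at_0[OF ev] S00
    by (simp_all add: coeff2_diag2 kf_def W_def)
  have b0': "b 0 \<noteq> 0" using b0 M(4) by simp
  have "cnj2 (diag2 (Abs_fps (\<lambda>n. coeff2 S n n))) = diag2 (Abs_fps (\<lambda>n. coeff2 S n n))"
    "cnj2 (diag2 kf) = diag2 kf" "cnj2 W = W"
    by (rule fps2_eqI, auto simp: coeff2_diag2 kf_def W_def S_sym divide_simps algebra_simps)+
  then have real: "\<forall>\<^sub>F z in nhds 0. cnj (b z) = b z" "\<forall>\<^sub>F z in nhds 0. cnj (k z) = k z" "\<forall>\<^sub>F z in nhds 0. cnj (v z) = v z"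
    using has_expansion2_real_iff[OF eb] has_expansion2_real_iff[OF ek] has_expansion2_real_iff[OF ev] by simp_all
  have "1 / m\<^sup>2 > 0" using M(4) by simp
  note csq = csqrt_real_germ[OF rab(2) real(2) k0 this]
  define K where "K = (\<lambda>z. csqrt (k z))"
  \<comment> \<open>The equation determines v = b u, whose coefficients are those of a divided by
    integers; the division by b, which is nonzero at 0, comes afterwards.\<close>
  define u where "u = (\<lambda>z. v z / b z)"
  have raK: "ra K" unfolding K_def by (rule csq)
  have rau: "ra u" unfolding u_def by (intro ra_divide rab b0')
  have K0: "K 0 = of_real (1 / m)"
    using M(4) of_real_sqrt[of "1 / m\<^sup>2"] by (simp add: K_def k0 real_sqrt_divide)
  have K_real: "\<forall>\<^sub>F z in nhds 0. cnj (K z) = K z" and K_nz: "\<forall>\<^sub>F z in nhds 0. K z \<noteq> 0"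
    using csq by (simp_all add: K_def)
  have u_real: "\<forall>\<^sub>F z in nhds 0. cnj (u z) = u z"
    using real(1,3) by eventually_elim (simp add: u_def)
  obtain KA where KA: "has_expansion2 K KA" using raK by (rule raE)
  obtain UA where UA: "has_expansion2 u UA" using rau by (rule raE)
  define K1 where "K1 = ev (deriv_z KA)"
  define K2 where "K2 = ev (deriv_zbar KA)"
  define u1 where "u1 = ev (deriv_z UA)"
  define u2 where "u2 = ev (deriv_zbar UA)"
  have wK: "\<forall>\<^sub>F z in nhds 0. has_wirtinger K (K1 z) (K2 z) z"
    unfolding K1_def K2_def by (rule has_expansion2_wirtinger_ev[OF KA])
  have wu: "\<forall>\<^sub>F z in nhds 0. has_wirtinger u (u1 z) (u2 z) z"
    unfolding u1_def u2_def by (rule has_expansion2_wirtinger_ev[OF UA])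
  define G where "G = (\<lambda>z. z * K z * exp (\<i> * u z))"
  define G1 where "G1 = (\<lambda>z. exp (\<i> * u z) * (K z + z * K1 z + \<i> * z * K z * u1 z))"
  define G2 where "G2 = (\<lambda>z. exp (\<i> * u z) * (z * K2 z + \<i> * z * K z * u2 z))"
  have raG: "ra G" unfolding G_def by (intro ra_mult ra_exp ra_const ra_ident raK rau)
  have wG: "\<forall>\<^sub>F z in nhds 0. has_wirtinger G (G1 z) (G2 z) z"
    unfolding G_def G1_def G2_def using wK wu by eventually_elim (rule has_wirtinger_polar)
  have k_wirt: "\<forall>\<^sub>F z in nhds 0. has_wirtinger k (2 * K z * K1 z) (2 * K z * K2 z) z"
    using wK
  proof eventually_elim
    case (elim z)
    have "has_wirtinger (\<lambda>z. K z * K z) (2 * K z * K1 z) (2 * K z * K2 z) z"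
      using has_wirtinger_mult[OF elim elim] by (simp add: algebra_simps)
    moreover have "(\<lambda>z. K z * K z) = k" by (simp add: K_def flip: power2_eq_square)
    ultimately show ?case by simp
  qed
  have k_eq: "\<forall>\<^sub>F z in nhds 0. z * (2 * K z * K1 z) - cnj z * (2 * K z * K2 z) = 0"
  proof -
    have "Abs_fps2 (\<lambda>i j. (of_nat i - of_nat j) * coeff2 (diag2 kf) i j) = const2 0"
      by (rule fps2_eqI) (simp add: coeff2_diag2 coeff2_const2)
    from has_expansion2_eqI[OF has_expansion2_angular[OF ek k_wirt, unfolded this] has_expansion2_const]
    show ?thesis .
  qed
  have b_eq: "\<forall>\<^sub>F z in nhds 0. k z + z * (2 * K z * K1 z) = b z"
  proof -
    have "has_expansion2 (\<lambda>z. k z + z * (2 * K z * K1 z)) (diag2 kf + var_z * deriv_z (diag2 kf))"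
      by (intro has_expansion2_add has_expansion2_mult has_expansion2_ident ek has_expansion2_wirtinger[OF ek k_wirt])
    moreover have "diag2 kf + var_z * deriv_z (diag2 kf) = diag2 (Abs_fps (\<lambda>n. coeff2 S n n))"
    proof (rule fps2_eqI)
      show "coeff2 (diag2 kf + var_z * deriv_z (diag2 kf)) i j = coeff2 (diag2 (Abs_fps (\<lambda>n. coeff2 S n n))) i j" for i j
        by (cases i) (auto simp: coeff2_diag2 coeff2_var_z_mult kf_def field_simps simp flip: of_nat_Suc, simp add: algebra_simps)
    qed
    ultimately show ?thesis using has_expansion2_eqI[OF _ eb] by simp
  qed
  define BA where BA: "BA = diag2 (Abs_fps (\<lambda>n. coeff2 S n n))"
  have wb: "\<forall>\<^sub>F z in nhds 0. has_wirtinger b (ev (deriv_z BA) z) (ev (deriv_zbar BA) z) z"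
    unfolding BA by (rule has_expansion2_wirtinger_ev[OF eb])
  \<comment> \<open>Since b is constant along circles, the angular derivative of v = b u is b times
    that of u.\<close>
  have b_ang: "\<forall>\<^sub>F z in nhds 0. z * ev (deriv_z BA) z - cnj z * ev (deriv_zbar BA) z = 0"
  proof -
    have "Abs_fps2 (\<lambda>i j. (of_nat i - of_nat j) * coeff2 BA i j) = const2 0"
      unfolding BA by (rule fps2_eqI) (simp add: coeff2_diag2 coeff2_const2)
    from has_expansion2_eqI[OF has_expansion2_angular[OF eb[folded BA] wb, unfolded this] has_expansion2_const]
    show ?thesis .
  qed
  have b_nz: "\<forall>\<^sub>F z in nhds 0. b z \<noteq> 0"
    by (rule ra_eventually[OF rab(1)]) (use b0' in \<open>auto intro: t1_space_nhds\<close>)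
  have v_wirt: "\<forall>\<^sub>F z in nhds 0. has_wirtinger v (u1 z * b z + u z * ev (deriv_z BA) z) (u2 z * b z + u z * ev (deriv_zbar BA) z) z"
    using wu wb eventually_nhds_nhds[OF b_nz]
  proof eventually_elim
    case (elim z)
    have "\<forall>\<^sub>F w in nhds z. u w * b w = v w" using elim(3) by eventually_elim (simp add: u_def)
    from has_wirtinger_cong[OF has_wirtinger_mult[OF elim(1,2)] this] show ?case .
  qed
  have v_eq: "\<forall>\<^sub>F z in nhds 0. z * (u1 z * b z + u z * ev (deriv_z BA) z) - cnj z * (u2 z * b z + u z * ev (deriv_zbar BA) z) = - \<i> * (a z - b z)"
  proof -
    have "has_expansion2 (\<lambda>z. - \<i> * (a z - b z)) (const2 (- \<i>) * (S - BA))"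
      unfolding BA by (intro has_expansion2_const_mult has_expansion2_diff S eb)
    moreover have "Abs_fps2 (\<lambda>i j. (of_nat i - of_nat j) * coeff2 W i j) = const2 (- \<i>) * (S - BA)"
    proof (rule fps2_eqI)
      fix i j :: nat
      have "i \<noteq> j \<Longrightarrow> of_nat i - of_nat j \<noteq> (0 :: complex)" by simp
      then show "coeff2 (Abs_fps2 (\<lambda>i j. (of_nat i - of_nat j) * coeff2 W i j)) i j = coeff2 (const2 (- \<i>) * (S - BA)) i j"
        unfolding coeff2_const2_mult coeff2_diff coeff2_Abs_fps2
        by (auto simp: W_def BA coeff2_diag2 field_simps)
    qed
    ultimately show ?thesis using has_expansion2_eqI[OF has_expansion2_angular[OF ev v_wirt]] by simp
  qed
  have jG: "\<forall>\<^sub>F z in nhds 0. jac (G1 z) (G2 z) = a z"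
    using K_real K_nz u_real wK wu k_eq b_eq b_ang v_eq
      eventually_nhds_nhds[OF K_real] eventually_nhds_nhds[OF u_real]
  proof eventually_elim
    case (elim z)
    have r: "K2 z = cnj (K1 z)" "u2 z = cnj (u1 z)"
      using has_wirtinger_real[OF elim(4,10)] has_wirtinger_real[OF elim(5,11)] .
    have 1: "z * K1 z = cnj z * K2 z" using elim(2,6) by (simp add: algebra_simps)
    have "Im (u z) = 0" using elim(3) by (simp add: complex_eq_iff)
    then have "u z = of_real (Re (u z))" by (simp add: complex_eq_iff)
    then have "exp (\<i> * u z) * cnj (exp (\<i> * u z)) = 1"
      by (metis complex_norm_square norm_exp_i_times of_real_1 power_one)
    from jac_polar[OF elim(1) r 1 this] have "jac (G1 z) (G2 z) =
       (K z * K z + 2 * K z * (z * K1 z)) * (1 + \<i> * (z * u1 z - cnj z * u2 z))"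
      by (simp add: G1_def G2_def)
    also have "K z * K z + 2 * K z * (z * K1 z) = b z"
      using elim(7) by (simp add: K_def algebra_simps flip: power2_eq_square)
    also have "b z * (1 + \<i> * (z * u1 z - cnj z * u2 z)) = b z + \<i> * (z * (u1 z * b z + u z * ev (deriv_z BA) z) - cnj z * (u2 z * b z + u z * ev (deriv_zbar BA) z))
       - \<i> * u z * (z * ev (deriv_z BA) z - cnj z * ev (deriv_zbar BA) z)"
      by (simp add: algebra_simps)
    also have "\<dots> = a z" unfolding elim(8,9) by (simp add: algebra_simps)
    finally show ?case .
  qed
  define \<Psi> where "\<Psi> = (\<lambda>z. G (M z))"
  have ra\<Psi>: "ra \<Psi>" unfolding \<Psi>_def by (rule ra_compose[OF raG M(1,2)])
  have \<Psi>0: "\<Psi> 0 = 0" by (simp add: \<Psi>_def M(2) G_def)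
  obtain GA where GA: "has_expansion2 G GA" using raG by (rule raE)
  have "\<forall>\<^sub>F z in nhds 0. jacobian GA z = a z"
    using jG wG has_expansion2_wirtinger_ev[OF GA]
  proof eventually_elim
    case (elim z)
    with has_wirtinger_unique[OF elim(2,3)] show ?case by (simp add: jacobian_def)
  qed
  then have "\<forall>\<^sub>F z in nhds 0. jacobian GA (M z) = a (M z)"
    using ra_eventually[OF M(1), of "\<lambda>w. jacobian GA w = a w"] M(2) by simp
  with jNM jacobian_compose[OF GA MA M(2) has_expansion2_compose[OF GA MA M(2)]]
  have "\<forall>\<^sub>F z in nhds 0. jacobian (formal_comp GA MA) z = 1"
    by eventually_elim simp
  then have sympl: "symplectic_germ \<Psi>"
    unfolding \<Psi>_def using symplectic_germ_iff_jacobian[OF has_expansion2_compose[OF GA MA M(2)]] by simp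
  \<comment> \<open>The linear part m of M is undone by K 0 = 1 / m, and the exponential is 1 at
    0.\<close>
  have "has_wirtinger G (G1 (M 0)) (G2 (M 0)) (M 0)"
    using eventually_nhds_x_imp_x[OF wG] M(2) by simp
  from has_wirtinger_compose[OF M(3) this] have w0: "has_wirtinger \<Psi> 1 0 0"
    unfolding \<Psi>_def using M(2,4) by (simp add: G1_def G2_def K0 u_def v0)
  have "\<forall>\<^sub>F z in nhds 0. cnj (u (M z)) = u (M z)"
    using ra_eventually[OF M(1), of "\<lambda>w. cnj (u w) = u w"] u_real M(2) by simp
  \<comment> \<open>As k depends only on the norm of its argument, it may be evaluated at the real
    number |M z|; this gives the function \<open>\<kappa>\<close>.\<close>
  then have "\<forall>\<^sub>F z in nhds 0. norm (\<Psi> z) = norm (M z) * norm (csqrt (k (of_real (norm (M z)))))"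
  proof eventually_elim
    case (elim z)
    then have "u (M z) = of_real (Re (u (M z)))" by (simp add: complex_eq_iff)
    then have "norm (exp (\<i> * u (M z))) = 1" by (metis norm_exp_i_times)
    moreover have "k (M z) = k (of_real (norm (M z)))"
      unfolding k_def by (rule ev_diag2_norm_cong) simp
    ultimately show ?case by (simp add: \<Psi>_def G_def K_def norm_mult)
  qed
  then show ?thesis
    by (rule that[OF ra\<Psi> \<Psi>0 sympl w0, of "\<lambda>r. r * norm (csqrt (k (of_real r)))"])
qed

section \<open>Symplectic germs that preserve the norm\<close>

lemma has_expansion2_diag2_sums:
  assumes "has_expansion2 f (diag2 a)"
  shows "\<forall>\<^sub>F z in nhds 0. (\<lambda>n. fps_nth a n * of_real (norm z ^ (2 * n))) sums f z"
  using assms unfolding has_expansion2_def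
proof eventually_elim
  case (elim z)
  have zz: "z ^ n * cnj z ^ n = of_real (norm z ^ (2 * n))" for n
    by (simp add: power_mult flip: power_mult_distrib complex_norm_square)
  have "((\<lambda>(m, n). coeff2 (diag2 a) m n * z ^ m * cnj z ^ n) has_sum f z) (range (\<lambda>n. (n, n)))"
    using elim by (subst has_sum_cong_neutral[where S = UNIV, symmetric])
      (auto simp: coeff2_diag2)
  then have "((\<lambda>n. fps_nth a n * of_real (norm z ^ (2 * n))) has_sum f z) UNIV"
    by (subst (asm) has_sum_reindex) (auto simp: inj_on_def o_def coeff2_diag2 mult.assoc zz)
  then show ?case by (rule has_sum_imp_sums)
qed

lemma has_fps_expansion_imp_has_expansion2:
  assumes "F has_fps_expansion a"
  shows "has_expansion2 (\<lambda>z. F (z * cnj z)) (diag2 a)"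
proof -
  have "isCont (\<lambda>z. z * cnj z) 0" by (intro continuous_intros)
  then have lim: "((\<lambda>z. z * cnj z) \<longlongrightarrow> 0) (nhds 0)"
    using isCont_tendsto_nhds by fastforce
  obtain r where r: "r > 0" "ereal r < fps_conv_radius a"
    using assms ereal_dense2[of 0 "fps_conv_radius a"] by (auto simp: has_fps_expansion_def)
  have "\<forall>\<^sub>F z in nhds 0. eval_fps a (z * cnj z) = F (z * cnj z)"
    using assms lim by (auto simp: has_fps_expansion_def filterlim_iff)
  moreover have "\<forall>\<^sub>F z in nhds 0. norm (z * cnj z) < r"
    using eventually_norm_less[OF r(1)] lim by (auto simp: filterlim_iff)
  ultimately show ?thesis
    unfolding has_expansion2_def
  proof eventually_elim
    case (elim z)
    have "ereal (norm (z * cnj z)) < fps_conv_radius a"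
      using elim(2) r(2) by (meson ereal_less(3) less_ereal.simps(1) order.strict_trans)
    then have s: "summable (\<lambda>n. norm (fps_nth a n * (z * cnj z) ^ n))"
      by (rule norm_summable_fps)
    then have "(\<lambda>n. fps_nth a n * (z * cnj z) ^ n) sums F (z * cnj z)"
      using elim(1) unfolding eval_fps_def by (metis summable_norm_cancel summable_sums)
    with s have "((\<lambda>n. fps_nth a n * (z * cnj z) ^ n) has_sum F (z * cnj z)) UNIV"
      by (rule norm_summable_imp_has_sum)
    then have "((\<lambda>(m, n). coeff2 (diag2 a) m n * z ^ m * cnj z ^ n) has_sum F (z * cnj z)) (range (\<lambda>n. (n, n)))"
      by (subst has_sum_reindex) (auto simp: inj_on_def o_def coeff2_diag2 power_mult_distrib mult.assoc)
    then show "((\<lambda>(m, n). coeff2 (diag2 a) m n * z ^ m * cnj z ^ n) has_sum F (z * cnj z)) UNIV"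
      by (subst has_sum_cong_neutral[where T = "range (\<lambda>n. (n, n))"]) (auto simp: coeff2_diag2)
  qed
qed

text \<open>Summability at one nonzero point gives the phase a positive radius of convergence in t =
  |w|^2, and formal composition with the exponential then represents the actual composition.\<close>

lemma normal_form_map_has_expansion2:
  assumes "normal_form_convergent \<gamma>"
  shows "has_expansion2 (normal_form_map \<omega> \<gamma>) (formal_normal_form \<omega> \<gamma>)"
proof -
  obtain e where e: "e > 0" "\<And>w :: complex. norm w < e \<Longrightarrow> summable (\<lambda>k. \<gamma> (Suc k) * norm w ^ (2 * Suc k))"
    using assms unfolding normal_form_convergent_def eventually_nhds_metric by auto
  define x where "x = (e / 2)\<^sup>2"
  have x: "x > 0" using e by (simp add: x_def)
  have n: "norm (complex_of_real (e / 2)) = e / 2" using e(1) by simp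
  have "summable (\<lambda>k. \<gamma> (Suc k) * (e / 2) ^ (2 * Suc k))"
    by (rule e(2)[of "of_real (e / 2)", unfolded n]) (use e(1) in simp)
  then have "summable (\<lambda>k. \<gamma> (Suc k) * x ^ Suc k)"
    unfolding x_def power_mult .
  then have "summable (\<lambda>k. of_real (\<gamma> (Suc k) * x ^ Suc k) :: complex)" by (rule summable_of_real)
  then have "summable (\<lambda>k. fps_nth (nf_phase \<gamma>) (Suc k) * of_real x ^ Suc k)"
    by (simp add: nf_phase_def)
  then have "summable (\<lambda>k. fps_nth (nf_phase \<gamma>) k * of_real x ^ k)"
    by (subst (asm) summable_Suc_iff)
  then have "fps_conv_radius (nf_phase \<gamma>) \<ge> norm (of_real x :: complex)"
    unfolding fps_conv_radius_def by (rule conv_radius_geI)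
  then have "fps_conv_radius (nf_phase \<gamma>) > 0" using x
    by (metis ereal_less(2) less_le_trans norm_of_real abs_of_pos)
  from has_fps_expansion_compose[OF has_fps_expansion_exp eval_fps_has_fps_expansion[OF this] nf_phase_0]
  have "has_expansion2 (\<lambda>z. exp (\<i> * eval_fps (nf_phase \<gamma>) (z * cnj z))) (diag2 (nf_factor \<gamma>))"
    unfolding nf_factor_def o_def by (rule has_fps_expansion_imp_has_expansion2)
  then have "has_expansion2 (\<lambda>z. exp (\<i> * of_real (2 * pi * \<omega>)) * (z * exp (\<i> * eval_fps (nf_phase \<gamma>) (z * cnj z))))
      (formal_normal_form \<omega> \<gamma>)"
    unfolding formal_normal_form_eq by (intro has_expansion2_const_mult has_expansion2_mult has_expansion2_ident)
  moreover have "\<forall>\<^sub>F z in nhds 0. exp (\<i> * of_real (2 * pi * \<omega>)) * (z * exp (\<i> * eval_fps (nf_phase \<gamma>) (z * cnj z)))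
      = normal_form_map \<omega> \<gamma> z"
    using assms unfolding normal_form_convergent_def
  proof eventually_elim
    case (elim z)
    have "(\<lambda>k. of_real (\<gamma> (Suc k) * norm z ^ (2 * Suc k)) :: complex) sums
        of_real (\<Sum>k. \<gamma> (Suc k) * norm z ^ (2 * Suc k))"
      by (rule sums_of_real[OF summable_sums[OF elim]])
    moreover have "of_real (\<gamma> (Suc k) * norm z ^ (2 * Suc k)) = fps_nth (nf_phase \<gamma>) (Suc k) * (z * cnj z) ^ Suc k" for k
      by (simp add: nf_phase_def power_mult del: power_Suc mult_Suc_right flip: complex_norm_square)
    ultimately have "(\<lambda>k. fps_nth (nf_phase \<gamma>) (Suc k) * (z * cnj z) ^ Suc k) sums
        of_real (\<Sum>k. \<gamma> (Suc k) * norm z ^ (2 * Suc k))" by (simp only:)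
    from sums_Suc[OF this]
    have "eval_fps (nf_phase \<gamma>) (z * cnj z) = of_real (\<Sum>k. \<gamma> (Suc k) * norm z ^ (2 * Suc k))"
      unfolding eval_fps_def by (simp add: sums_iff)
    then show ?case
      unfolding normal_form_map_def of_real_add distrib_left exp_add by (simp add: mult_ac)
  qed
  ultimately show ?thesis by (rule has_expansion2_cong)
qed

text \<open>In polar form with radial factor 1, \<open>jac_polar\<close> says that area is preserved
  exactly when the rotation angle has zero angular derivative. This leaves only its coefficients
  with m = n.\<close>

lemma norm_preserving_symplectic_germ:
  assumes g: "ra g" "has_wirtinger g \<mu> 0 0" "\<mu> = exp (\<i> * of_real (2 * pi * \<omega>))"
    and norm: "\<forall>\<^sub>F z in nhds 0. norm (g z) = norm z" and sympl: "symplectic_germ g"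
  obtains \<gamma> where "normal_form_convergent \<gamma>" "\<forall>\<^sub>F z in nhds 0. g z = normal_form_map \<omega> \<gamma> z"
proof -
  obtain A where A: "has_expansion2 g A" using g(1) by (rule raE)
  have A1: "coeff2 A 1 0 = \<mu>" using has_wirtinger_unique[OF has_wirtinger_at_0[OF A] g(2)] by simp
  have \<mu>: "norm \<mu> = 1" by (simp only: g(3) norm_exp_i_times)
  \<comment> \<open>To divide g by z, set z = 0 in the expansion of this identity: the product of
    the two series in \<open>z'\<close> is 0. The factor from the conjugate has linear coefficient
    \<open>cnj \<mu>\<close>, hence is not 0, so the factor from g is, and z divides g.\<close>
  have "\<forall>\<^sub>F z in nhds 0. g z * cnj (g z) = z * cnj z"
    using norm by eventually_elim (simp flip: complex_norm_square)
  from has_expansion2_unique[OF has_expansion2_cong[OF has_expansion2_mult[OF A has_expansion2_cnj[OF A]] this]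
      has_expansion2_mult[OF has_expansion2_ident has_expansion2_cnj_ident]]
  have "fps_nth (A * cnj2 A) 0 = fps_nth (var_z * var_zbar) 0" by simp
  then have "fps_nth A 0 * fps_nth (cnj2 A) 0 = 0" by (simp add: var_z_def)
  moreover have "fps_nth (fps_nth (cnj2 A) 0) 1 = cnj \<mu>"
    using A1 coeff2_cnj2[of A 0 1] by (simp add: coeff2_def)
  then have "fps_nth (cnj2 A) 0 \<noteq> 0" using \<mu> by auto
  ultimately have row0: "fps_nth A 0 = 0" by simp
  define H where "H = Abs_fps2 (\<lambda>m n. coeff2 A (Suc m) n)"
  define h where "h = ev H"
  have "convergent2 H"
    by (rule convergent2_shifted[OF has_expansion2_convergent2[OF A], of _ 1 0]) (simp add: H_def)
  then have H: "has_expansion2 h H" unfolding h_def by (rule convergent2_has_expansion2)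
  have rah: "ra h" using H by (rule has_expansion2_ra)
  have "A = var_z * H"
    by (rule fps2_eqI, case_tac m) (simp_all add: coeff2_var_z_mult H_def row0 coeff2_def[of A 0])
  then have gh: "\<forall>\<^sub>F z in nhds 0. g z = z * h z"
    using has_expansion2_eqI[OF A] has_expansion2_mult[OF has_expansion2_ident H] by simp
  have h0: "h 0 = \<mu>" using has_expansion2_at_0[OF H] A1 by (simp add: H_def)
  have hn: "\<forall>\<^sub>F z in nhds 0. norm (h z) = 1"
    using gh norm
  proof eventually_elim
    case (elim z)
    then show ?case by (cases "z = 0") (simp_all add: h0 \<mu> norm_mult)
  qed
  have \<mu>0: "\<mu> \<noteq> 0" using \<mu> by auto
  \<comment> \<open>The quotient is 1 at 0, inside the domain of the principal logarithm, so
    \<theta> vanishes there. This is why the phase series will start at degree 1.\<close>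
  define \<theta> where "\<theta> = (\<lambda>z. - \<i> * Ln (h z / \<mu>))"
  have ra\<theta>: "ra \<theta>"
    unfolding \<theta>_def by (intro ra_mult ra_const ra_Ln ra_divide rah) (use \<mu>0 h0 in simp_all)
  have \<theta>_real: "\<forall>\<^sub>F z in nhds 0. cnj (\<theta> z) = \<theta> z"
    using hn
  proof eventually_elim
    case (elim z)
    then have "h z \<noteq> 0" by auto
    then have "Re (Ln (h z / \<mu>)) = 0" using \<mu> \<mu>0 elim by (simp add: norm_divide)
    then show ?case by (simp add: \<theta>_def complex_eq_iff)
  qed
  have exp\<theta>: "\<forall>\<^sub>F z in nhds 0. \<mu> * exp (\<i> * \<theta> z) = h z"
    using hn
  proof eventually_elim
    case (elim z)
    then have "h z / \<mu> \<noteq> 0" using \<mu>0 by auto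
    then have "exp (\<i> * \<theta> z) = h z / \<mu>" by (simp add: \<theta>_def exp_Ln flip: mult.assoc)
    then show ?case using \<mu>0 by simp
  qed
  define u where "u = (\<lambda>z. \<theta> z + of_real (2 * pi * \<omega>))"
  obtain T where T: "has_expansion2 \<theta> T" using ra\<theta> by (rule raE)
  define u1 where "u1 = ev (deriv_z T)"
  define u2 where "u2 = ev (deriv_zbar T)"
  have w\<theta>: "\<forall>\<^sub>F z in nhds 0. has_wirtinger \<theta> (u1 z) (u2 z) z"
    unfolding u1_def u2_def by (rule has_expansion2_wirtinger_ev[OF T])
  then have wu: "\<forall>\<^sub>F z in nhds 0. has_wirtinger u (u1 z) (u2 z) z"
    unfolding u_def by eventually_elim (use has_wirtinger_add[OF _ has_wirtinger_const] in fastforce)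
  have gu: "\<forall>\<^sub>F z in nhds 0. z * 1 * exp (\<i> * u z) = g z"
    using gh exp\<theta>
  proof eventually_elim
    case (elim z)
    have "exp (\<i> * u z) = \<mu> * exp (\<i> * \<theta> z)"
      unfolding u_def g(3) by (simp only: distrib_left exp_add mult.commute)
    then show ?case using elim by simp
  qed
  \<comment> \<open>The factor K = 1 and its zero derivatives are left unsimplified, to match
    \<open>has_wirtinger_polar\<close>.\<close>
  define G1 where "G1 = (\<lambda>z. exp (\<i> * u z) * (1 + z * 0 + \<i> * z * 1 * u1 z))"
  define G2 where "G2 = (\<lambda>z. exp (\<i> * u z) * (z * 0 + \<i> * z * 1 * u2 z))"
  have wg: "\<forall>\<^sub>F z in nhds 0. has_wirtinger g (G1 z) (G2 z) z"
    using wu eventually_nhds_nhds[OF gu]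
  proof eventually_elim
    case (elim z)
    show ?case
      unfolding G1_def G2_def
      by (rule has_wirtinger_cong[OF has_wirtinger_polar[OF has_wirtinger_const elim(1)] elim(2)])
  qed
  then have "\<forall>\<^sub>F z in nhds 0. jac (G1 z) (G2 z) = 1"
    using symplectic_germ_iff sympl by blast
  then have "\<forall>\<^sub>F z in nhds 0. z * u1 z - cnj z * u2 z = 0"
    using w\<theta> \<theta>_real eventually_nhds_nhds[OF \<theta>_real]
  proof eventually_elim
    case (elim z)
    have r: "u2 z = cnj (u1 z)" by (rule has_wirtinger_real[OF elim(2,4)])
    have "u z = of_real (Re (u z))" using elim(3) by (simp add: u_def complex_eq_iff)
    then have "norm (exp (\<i> * u z)) = 1" by (metis norm_exp_i_times)
    then have "exp (\<i> * u z) * cnj (exp (\<i> * u z)) = 1"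
      by (metis complex_norm_square of_real_1 power_one)
    from jac_polar[OF _ _ r _ this, of 1 0 0 z] elim(1)
    have "1 + \<i> * (z * u1 z - cnj z * u2 z) = 1" by (simp add: G1_def G2_def)
    then show ?case by simp
  qed
  from has_expansion2_unique[OF has_expansion2_cong[OF has_expansion2_angular[OF T w\<theta>] this] has_expansion2_const]
  have z: "Abs_fps2 (\<lambda>m n. (of_nat m - of_nat n) * coeff2 T m n) = const2 0" .
  have "coeff2 T m n = 0" if "m \<noteq> n" for m n
    using arg_cong[OF z, of "\<lambda>A. coeff2 A m n"] that by (simp add: coeff2_const2 split: if_splits)
  then obtain t where t: "T = diag2 t" by (rule fps2_eq_diag2I)
  define \<gamma> where "\<gamma> = (\<lambda>n. Re (fps_nth t n))"
  have "cnj2 T = T" using \<theta>_real has_expansion2_real_iff[OF T] by simp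
  then have "cnj (coeff2 T n n) = coeff2 T n n" for n using coeff2_cnj2 by metis
  then have t\<gamma>: "fps_nth t n = of_real (\<gamma> n)" for n by (simp add: t coeff2_diag2 \<gamma>_def complex_eq_iff)
  have "\<theta> 0 = 0" using h0 \<mu>0 by (simp add: \<theta>_def)
  then have t0: "fps_nth t 0 = 0" using has_expansion2_at_0[OF T] by (simp add: t coeff2_diag2)
  have sums: "\<forall>\<^sub>F z in nhds 0. (\<lambda>k. \<gamma> (Suc k) * norm z ^ (2 * Suc k)) sums Re (\<theta> z)"
    using has_expansion2_diag2_sums[OF T[unfolded t]]
  proof eventually_elim
    case (elim z)
    then have "(\<lambda>k. fps_nth t (Suc k) * of_real (norm z ^ (2 * Suc k))) sums \<theta> z"
      using sums_Suc_iff[of "\<lambda>n. fps_nth t n * of_real (norm z ^ (2 * n))" "\<theta> z"] t0 by simp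
    from sums_Re[OF this] show ?case by (simp add: t\<gamma>)
  qed
  have "normal_form_convergent \<gamma>"
    unfolding normal_form_convergent_def using sums by eventually_elim (rule sums_summable)
  moreover have "\<forall>\<^sub>F z in nhds 0. g z = normal_form_map \<omega> \<gamma> z"
    using sums gu \<theta>_real
  proof eventually_elim
    case (elim z)
    have "(\<Sum>k. \<gamma> (Suc k) * norm z ^ (2 * Suc k)) = Re (\<theta> z)" using elim(1) by (simp add: sums_iff)
    moreover have "of_real (Re (\<theta> z)) = \<theta> z" using elim(3) by (simp add: complex_eq_iff)
    ultimately have "of_real (2 * pi * \<omega> + (\<Sum>k. \<gamma> (Suc k) * norm z ^ (2 * Suc k))) = u z"
      by (simp add: u_def)
    then show ?case using elim(2) by (simp add: normal_form_map_def)
  qed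
  ultimately show ?thesis by (rule that)
qed

section \<open>Conjugation to the normal form\<close>

lemma formal_tangent_to_idI:
  assumes "has_expansion2 f A" "f 0 = 0" "has_wirtinger f 1 0 0"
  shows "formal_tangent_to_id A"
  using has_wirtinger_unique[OF has_wirtinger_at_0[OF assms(1)] assms(3)] has_expansion2_at_0[OF assms(1)] assms(2)
  by (simp add: formal_tangent_to_id_def)

text \<open>Invariance under f makes the quadratic part invariant under the rotation by \<mu>. The
  coefficient a of \<open>z^2\<close> satisfies \<mu>^2 a = a, hence vanishes, and the Hessian
  determines the remaining coefficient.\<close>

lemma first_integral_coeffs:
  assumes I: "has_expansion2 (\<lambda>z. of_real (I z)) A" and min: "nondegenerate_local_min I 0"
    and f: "has_expansion2 f F" "f 0 = 0" "has_wirtinger f \<mu> 0 0" "\<mu>\<^sup>2 \<noteq> 1"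
    and inv: "\<forall>\<^sub>F z in nhds 0. I (f z) = I z"
  shows "coeff2 A 1 0 = 0" "coeff2 A 2 0 = 0" "\<exists>c>0. coeff2 A 1 1 = of_real c"
proof -
  obtain D H where D: "\<forall>\<^sub>F z in nhds 0. (I has_derivative D z) (at z)" "\<And>v. D 0 v = 0"
    and H: "\<And>v. ((\<lambda>z. D z v) has_derivative (\<lambda>u. H u v)) (at 0)" "\<And>v. v \<noteq> 0 \<Longrightarrow> H v v > 0"
    using min unfolding nondegenerate_local_min_def by blast
  let ?a = "ev (deriv_z A)" and ?b = "ev (deriv_zbar A)"
  note e = has_expansion2_ev_deriv[OF I]
  have "\<forall>\<^sub>F z in nhds 0. \<forall>v. of_real (D z v) = ?a z * v + ?b z * cnj v"
    using D(1) has_expansion2_wirtinger_ev[OF I]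
  proof eventually_elim
    case (elim z)
    have "((\<lambda>z. complex_of_real (I z)) has_derivative (\<lambda>v. of_real (D z v))) (at z)"
      by (rule bounded_linear.has_derivative[OF bounded_linear_of_real elim(1)])
    from has_derivative_unique[OF this elim(2)[unfolded has_wirtinger_def]]
    show ?case by meson
  qed
  note eq = this
  have "0 = ?a 0 * v + ?b 0 * cnj v" for v
    using spec[OF eventually_nhds_x_imp_x[OF eq], of v] D(2) by simp
  from this[of 1] this[of \<i>] have "?a 0 + ?b 0 = 0" "?a 0 - ?b 0 = 0" by (simp_all add: algebra_simps)
  then have "?a 0 = 0" "?b 0 = 0" by (simp_all add: algebra_simps)
  then have A1: "coeff2 A 1 0 = 0" "coeff2 A 0 1 = 0"
    using e[THEN has_expansion2_at_0] by simp_all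
  then show "coeff2 A 1 0 = 0" by simp
  have F: "coeff2 F 0 0 = 0" "coeff2 (cnj2 F) 0 0 = 0" "coeff2 F 1 0 = \<mu>" "coeff2 F 0 1 = 0"
    using has_expansion2_at_0[OF f(1)] f(2) has_wirtinger_unique[OF has_wirtinger_at_0[OF f(1)] f(3)] by simp_all
  have "has_expansion2 (\<lambda>z. of_real (I z)) (formal_comp A F)"
    by (rule has_expansion2_cong[OF has_expansion2_compose[OF I f(1,2)]]) (use inv in eventually_elim, simp)
  from has_expansion2_unique[OF this I] have "coeff2 (deriv_z (deriv_z (formal_comp A F))) 0 0 = coeff2 (deriv_z (deriv_z A)) 0 0"
    by simp
  \<comment> \<open>At 0 the terms with first derivatives of A vanish because 0 is critical, and the
    others that would mix in vanish because the linear part of F has no \<open>z'\<close>.\<close>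
  moreover have "coeff2 (deriv_z (deriv_z (formal_comp A F))) 0 0 = \<mu> * \<mu> * coeff2 (deriv_z (deriv_z A)) 0 0"
    unfolding formal_comp_def deriv_z_subst2[OF F(1,2)] deriv_z.add deriv_z.mult coeff2_add coeff2_0_0_mult
      coeff2_subst2_0_0
    using F A1 by (simp add: algebra_simps)
  ultimately have "(\<mu>\<^sup>2 - 1) * coeff2 (deriv_z (deriv_z A)) 0 0 = 0"
    by (simp add: power2_eq_square algebra_simps)
  then show A2: "coeff2 A 2 0 = 0" using f(4) by (simp add: numeral_2_eq_2)
  have "\<forall>\<^sub>F z in nhds 0. cnj (complex_of_real (I z)) = of_real (I z)" by simp
  then have "cnj2 A = A" using has_expansion2_real_iff[OF I] by simp
  then have A2': "coeff2 A 0 2 = 0" using A2 by (metis coeff2_cnj2 complex_cnj_zero)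
  \<comment> \<open>The derivative of I in direction 1 is \<open>?a + ?b\<close>. Differentiating
    once more in direction 1 gives \<open>H 1 1\<close>, which is twice the coefficient of
    \<open>z z'\<close> since those of \<open>z^2\<close> and \<open>z'^2\<close> vanish.\<close>
  have "has_wirtinger ?a (coeff2 (deriv_z A) 1 0) (coeff2 (deriv_z A) 0 1) 0"
    "has_wirtinger ?b (coeff2 (deriv_zbar A) 1 0) (coeff2 (deriv_zbar A) 0 1) 0"
    using e[THEN has_wirtinger_at_0] .
  from has_wirtinger_add[OF this]
  have "has_wirtinger (\<lambda>z. ?a z + ?b z) (coeff2 A 1 1) (coeff2 A 1 1) 0"
    using A2 A2' by (simp add: numeral_2_eq_2)
  moreover have "\<forall>\<^sub>F z in nhds 0. ?a z + ?b z = of_real (D z 1)"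
    using eq by eventually_elim simp
  ultimately have "has_wirtinger (\<lambda>z. of_real (D z 1)) (coeff2 A 1 1) (coeff2 A 1 1) 0"
    by (rule has_wirtinger_cong)
  moreover have "((\<lambda>z. complex_of_real (D z 1)) has_derivative (\<lambda>u. of_real (H u 1))) (at 0)"
    by (rule bounded_linear.has_derivative[OF bounded_linear_of_real H(1)])
  ultimately have "(\<lambda>u. complex_of_real (H u 1)) = (\<lambda>u. coeff2 A 1 1 * u + coeff2 A 1 1 * cnj u)"
    unfolding has_wirtinger_def by (rule has_derivative_unique[rotated])
  then have "complex_of_real (H 1 1) = coeff2 A 1 1 * 1 + coeff2 A 1 1 * cnj 1" by (rule fun_cong)
  then have "coeff2 A 1 1 = of_real (H 1 1 / 2)" by simp
  moreover have "H 1 1 / 2 > 0" using H(2)[of 1] by simp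
  ultimately show "\<exists>c>0. coeff2 A 1 1 = of_real c" by blast
qed

text \<open>The linear parts of \<phi> and \<psi> are recorded because
  \<open>birkhoff_normal_form_of\<close> and the uniqueness theorem require changes tangent to the
  identity.\<close>

theorem normal_form_conjugation:
  assumes f: "ra f" "symplectic_germ f" "f 0 = 0" "has_wirtinger f \<mu> 0 0"
    and \<mu>: "\<mu> = exp (\<i> * of_real (2 * pi * \<omega>))" "\<mu>\<^sup>2 \<noteq> 1"
    and I: "ra (\<lambda>z. of_real (I z))" "nondegenerate_local_min I 0" "\<forall>\<^sub>F z in nhds 0. I (f z) = I z"
  obtains \<phi> \<psi> \<gamma> where "ra \<phi>" "\<phi> 0 = 0" "symplectic_germ \<phi>" "has_wirtinger \<phi> 1 0 0"
    "ra \<psi>" "\<psi> 0 = 0" "symplectic_germ \<psi>" "has_wirtinger \<psi> 1 0 0"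
    "\<forall>\<^sub>F z in nhds 0. \<psi> (\<phi> z) = z" "\<forall>\<^sub>F z in nhds 0. \<phi> (\<psi> z) = z"
    "normal_form_convergent \<gamma>" "\<forall>\<^sub>F z in nhds 0. \<psi> (f (\<phi> z)) = normal_form_map \<omega> \<gamma> z"
proof -
  obtain A where A: "has_expansion2 (\<lambda>z. of_real (I z)) A" using I(1) by (rule raE)
  obtain F where F: "has_expansion2 f F" using f(1) by (rule raE)
  note A' = first_integral_coeffs[OF A I(2) F f(3,4) \<mu>(2) I(3)]
  obtain c where c: "c > 0" "coeff2 A 1 1 = of_real c" using A'(3) by blast
  define B where "B = A - const2 (of_real (I 0))"
  have B: "has_expansion2 (\<lambda>z. of_real (I z) - of_real (I 0)) B"
    unfolding B_def by (intro has_expansion2_diff A has_expansion2_const)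
  have "\<forall>\<^sub>F z in nhds 0. cnj (complex_of_real (I z) - of_real (I 0)) = of_real (I z) - of_real (I 0)" by simp
  then have B_real: "cnj2 B = B" using has_expansion2_real_iff[OF B] by simp
  have B': "coeff2 B 0 0 = 0" "coeff2 B 1 0 = 0" "coeff2 B 2 0 = 0" "coeff2 B 1 1 = of_real c"
    using has_expansion2_at_0[OF A] A' c by (simp_all add: B_def coeff2_const2)
  from morse_lemma[OF B B_real B' c(1)] obtain M m where
    M: "ra M" "M 0 = 0" "m > 0" "has_wirtinger M (of_real m) 0 0"
    and MI: "\<forall>\<^sub>F z in nhds 0. M z * cnj (M z) = of_real (I z) - of_real (I 0)" .
  from symplectic_morse_coordinate[OF M(1,2,4,3)] obtain \<psi> \<kappa> where
    \<psi>: "ra \<psi>" "\<psi> 0 = 0" "symplectic_germ \<psi>" "has_wirtinger \<psi> 1 0 0"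
    and \<kappa>: "\<forall>\<^sub>F z in nhds 0. norm (\<psi> z) = \<kappa> (norm (M z))" .
  have "1 * cnj 1 - 0 * cnj 0 \<noteq> (0 :: complex)" by simp
  from ra_inverse_function[OF \<psi>(1,2,4) this] obtain \<phi> where
    \<phi>: "ra \<phi>" "\<phi> 0 = 0" and inv: "\<forall>\<^sub>F z in nhds 0. \<psi> (\<phi> z) = z" "\<forall>\<^sub>F z in nhds 0. \<phi> (\<psi> z) = z" .
  have sympl\<phi>: "symplectic_germ \<phi>" by (rule symplectic_germ_inverse[OF \<psi>(1) \<phi> \<psi>(3) inv(1)])
  obtain a b where ab: "has_wirtinger \<phi> a b 0" using \<phi>(1) by (rule ra_has_wirtinger_0)
  have "has_wirtinger \<psi> 1 0 (\<phi> 0)" using \<psi>(4) \<phi>(2) by simp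
  from has_wirtinger_unique[OF has_wirtinger_cong[OF has_wirtinger_compose[OF ab this] inv(1)] has_wirtinger_ident]
  have w\<phi>: "has_wirtinger \<phi> 1 0 0" using ab by simp
  \<comment> \<open>|M|^2 is the first integral up to a constant, so f preserves |M|, and with it
    every function of |M|.\<close>
  have norm\<psi>f: "\<forall>\<^sub>F z in nhds 0. norm (\<psi> (f z)) = norm (\<psi> z)"
  proof -
    have 1: "\<forall>\<^sub>F z in nhds 0. norm (\<psi> (f z)) = \<kappa> (norm (M (f z)))"
      using ra_eventually[OF f(1), of "\<lambda>w. norm (\<psi> w) = \<kappa> (norm (M w))"] \<kappa> f(3) by simp
    have 2: "\<forall>\<^sub>F z in nhds 0. M (f z) * cnj (M (f z)) = of_real (I (f z)) - of_real (I 0)"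
      using ra_eventually[OF f(1), of "\<lambda>w. M w * cnj (M w) = of_real (I w) - of_real (I 0)"] MI f(3) by simp
    show ?thesis
      using 1 2 \<kappa> MI I(3)
    proof eventually_elim
      case (elim z)
      have "complex_of_real ((norm (M (f z)))\<^sup>2) = of_real ((norm (M z))\<^sup>2)"
        unfolding complex_norm_square using elim by simp
      then have "(norm (M (f z)))\<^sup>2 = (norm (M z))\<^sup>2" by (simp only: of_real_eq_iff)
      then have "norm (M (f z)) = norm (M z)" by (simp add: power2_eq_iff_nonneg)
      then show ?case using elim(1,3) by simp
    qed
  qed
  define g where "g = (\<lambda>z. \<psi> (f (\<phi> z)))"
  have raf\<phi>: "ra (\<lambda>z. f (\<phi> z))" by (rule ra_compose[OF f(1) \<phi>])
  have rag: "ra g" unfolding g_def by (rule ra_compose[OF \<psi>(1) raf\<phi>]) (simp add: \<phi> f)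
  have gn: "\<forall>\<^sub>F z in nhds 0. norm (g z) = norm z"
  proof -
    have "\<forall>\<^sub>F z in nhds 0. norm (\<psi> (f (\<phi> z))) = norm (\<psi> (\<phi> z))"
      using ra_eventually[OF \<phi>(1), of "\<lambda>w. norm (\<psi> (f w)) = norm (\<psi> w)"] norm\<psi>f \<phi>(2) by simp
    with inv(1) show ?thesis by eventually_elim (simp add: g_def)
  qed
  have symplg: "symplectic_germ g"
    unfolding g_def
    by (intro symplectic_germ_compose[OF \<psi>(1) raf\<phi>] symplectic_germ_compose[OF f(1) \<phi>] \<psi> f sympl\<phi>)
      (simp add: \<phi> f)
  have "has_wirtinger f \<mu> 0 (\<phi> 0)" using f(4) \<phi>(2) by simp
  from has_wirtinger_compose[OF w\<phi> this] have "has_wirtinger (\<lambda>z. f (\<phi> z)) \<mu> 0 0" by simp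
  moreover have "has_wirtinger \<psi> 1 0 (f (\<phi> 0))" using \<psi>(4) \<phi>(2) f(3) by simp
  ultimately have wg: "has_wirtinger g \<mu> 0 0"
    unfolding g_def using has_wirtinger_compose by fastforce
  from norm_preserving_symplectic_germ[OF rag wg \<mu>(1) gn symplg] obtain \<gamma> where
    \<gamma>: "normal_form_convergent \<gamma>" "\<forall>\<^sub>F z in nhds 0. g z = normal_form_map \<omega> \<gamma> z" .
  show ?thesis
    by (rule that[OF \<phi> sympl\<phi> w\<phi> \<psi> inv \<gamma>[unfolded g_def]])
qed

theorem proposition3p2:
  fixes f :: "complex \<Rightarrow> complex" and \<omega>\<^sub>0 :: real
    and U :: "complex set" and I\<^sub>1 :: "complex \<Rightarrow> real"
  assumes "real_analytic_at f 0"
    and "symplectic_germ f"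
    and "elliptic_fixed_point f \<omega>\<^sub>0"
    and "\<omega>\<^sub>0 \<notin> \<rat>"
    and "first_integral_on U f I\<^sub>1"
    and "\<forall>p\<in>U. real_analytic_at I\<^sub>1 p"
    and "nondegenerate_local_min I\<^sub>1 0"
  shows "(\<exists>\<gamma>. birkhoff_normal_form_of f \<omega>\<^sub>0 \<gamma>) \<and>
         (\<forall>\<gamma>. birkhoff_normal_form_of f \<omega>\<^sub>0 \<gamma> \<longrightarrow>
            normal_form_convergent \<gamma> \<and>
            analytically_symplectically_conjugate f (normal_form_map \<omega>\<^sub>0 \<gamma>))"
proof -
  define \<mu> where "\<mu> = exp (\<i> * of_real (2 * pi * \<omega>\<^sub>0))"
  have raf: "ra f" using assms(1) by (rule real_analytic_at_imp_ra)
  have f0: "f 0 = 0" and wf: "has_wirtinger f \<mu> 0 0"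
    using assms(3) by (simp_all add: elliptic_fixed_point_def has_wirtinger_def \<mu>_def)
  \<comment> \<open>Non-resonance for exponents 2, 0 and 0.\<close>
  have \<mu>2: "\<mu>\<^sup>2 \<noteq> 1" using unit_rotation_power_eq[OF assms(4) \<mu>_def, of 2 0 0] by auto
  have "0 \<in> U" and inv_I: "\<forall>\<^sub>F z in nhds 0. I\<^sub>1 (f z) = I\<^sub>1 z"
    using assms(5) by (auto simp: first_integral_on_def elim: eventually_mono)
  then have raI: "ra (\<lambda>z. of_real (I\<^sub>1 z))" using assms(6) by (intro real_analytic_at_real_imp_ra) simp
  from normal_form_conjugation[OF raf assms(2) f0 wf \<mu>_def \<mu>2 raI assms(7) inv_I]
  obtain \<phi> \<psi> \<gamma>0 where
    \<phi>: "ra \<phi>" "\<phi> 0 = 0" "symplectic_germ \<phi>" "has_wirtinger \<phi> 1 0 0" and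
    \<psi>: "ra \<psi>" "\<psi> 0 = 0" "symplectic_germ \<psi>" "has_wirtinger \<psi> 1 0 0" and
    inv: "\<forall>\<^sub>F z in nhds 0. \<psi> (\<phi> z) = z" "\<forall>\<^sub>F z in nhds 0. \<phi> (\<psi> z) = z" and
    \<gamma>0: "normal_form_convergent \<gamma>0" and
    conj: "\<forall>\<^sub>F z in nhds 0. \<psi> (f (\<phi> z)) = normal_form_map \<omega>\<^sub>0 \<gamma>0 z" .
  obtain F where F: "has_expansion2 f F" using raf by (rule raE)
  obtain \<Phi> where \<Phi>: "has_expansion2 \<phi> \<Phi>" using \<phi>(1) by (rule raE)
  obtain \<Psi> where \<Psi>: "has_expansion2 \<psi> \<Psi>" using \<psi>(1) by (rule raE)
  note nf = normal_form_map_has_expansion2[OF \<gamma>0, of \<omega>\<^sub>0]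
  have nf0: "normal_form_map \<omega>\<^sub>0 \<gamma>0 0 = 0" by (simp add: normal_form_map_def)
  have F0: "coeff2 F 0 0 = 0" using has_expansion2_at_0[OF F] f0 by simp
  note t\<Phi> = formal_tangent_to_idI[OF \<Phi> \<phi>(2,4)] symplectic_germ_formal[OF \<Phi> \<phi>(3)]
  note t\<Psi> = formal_tangent_to_idI[OF \<Psi> \<psi>(2,4)] symplectic_germ_formal[OF \<Psi> \<psi>(3)]
  \<comment> \<open>The conjugacy is needed in two forms: through \<phi> it shows that \<gamma>0 is
    a formal normal form, and through \<psi>, below, it is the first hypothesis of the uniqueness
    theorem.\<close>
  have "\<forall>\<^sub>F z in nhds 0. \<phi> (\<psi> (f (\<phi> z))) = f (\<phi> z)"
    using ra_eventually[OF ra_compose[OF raf \<phi>(1,2)], of "\<lambda>w. \<phi> (\<psi> w) = w"] inv(2) \<phi>(2) f0 by simp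
  with conj have "\<forall>\<^sub>F z in nhds 0. f (\<phi> z) = \<phi> (normal_form_map \<omega>\<^sub>0 \<gamma>0 z)"
    by eventually_elim simp
  from has_expansion2_unique[OF has_expansion2_cong[OF has_expansion2_compose[OF F \<Phi> \<phi>(2)] this]
      has_expansion2_compose[OF \<Phi> nf nf0]]
  have conj\<Phi>: "formal_comp F \<Phi> = formal_comp \<Phi> (formal_normal_form \<omega>\<^sub>0 \<gamma>0)" .
  then have ex: "birkhoff_normal_form_of f \<omega>\<^sub>0 \<gamma>0"
    unfolding birkhoff_normal_form_of_def using F t\<Phi> by blast
  have "\<forall>\<^sub>F z in nhds 0. \<psi> (f (\<phi> (\<psi> z))) = normal_form_map \<omega>\<^sub>0 \<gamma>0 (\<psi> z)"
    using ra_eventually[OF \<psi>(1), of "\<lambda>w. \<psi> (f (\<phi> w)) = normal_form_map \<omega>\<^sub>0 \<gamma>0 w"] conj \<psi>(2) by simp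
  with inv(2) have "\<forall>\<^sub>F z in nhds 0. \<psi> (f z) = normal_form_map \<omega>\<^sub>0 \<gamma>0 (\<psi> z)"
    by eventually_elim simp
  from has_expansion2_unique[OF has_expansion2_cong[OF has_expansion2_compose[OF \<Psi> F f0] this]
      has_expansion2_compose[OF nf \<Psi> \<psi>(2)]]
  have conj\<Psi>: "formal_comp \<Psi> F = formal_comp (formal_normal_form \<omega>\<^sub>0 \<gamma>0) \<Psi>" .
  \<comment> \<open>The given \<gamma> may come from a divergent formal change, so it is compared
    with \<gamma>0 through formal uniqueness.\<close>
  have "normal_form_convergent \<gamma> \<and> analytically_symplectically_conjugate f (normal_form_map \<omega>\<^sub>0 \<gamma>)"
    if \<gamma>: "birkhoff_normal_form_of f \<omega>\<^sub>0 \<gamma>" for \<gamma>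
  proof -
    obtain F' \<Phi>' where F': "has_expansion2 f F'" and \<Phi>': "formal_tangent_to_id \<Phi>'" "formal_symplectic \<Phi>'"
      and conj': "formal_comp F' \<Phi>' = formal_comp \<Phi>' (formal_normal_form \<omega>\<^sub>0 \<gamma>)"
      using \<gamma> unfolding birkhoff_normal_form_of_def by blast
    have "F' = F" by (rule has_expansion2_unique[OF F' F])
    with conj' have "\<gamma> k = \<gamma>0 k" if "k > 0" for k
      using birkhoff_normal_form_unique[OF assms(4) t\<Psi> \<Phi>' F0 conj\<Psi> _ that] by simp
    \<comment> \<open>Only indices from 1 on enter \<open>normal_form_convergent\<close> and
      \<open>normal_form_map\<close>, so agreement there transfers both conclusions from \<gamma>0
      to \<gamma>.\<close>
    then have eq: "\<gamma> (Suc k) = \<gamma>0 (Suc k)" for k by simp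
    have "normal_form_convergent \<gamma>" using \<gamma>0 by (simp add: normal_form_convergent_def eq)
    moreover have "normal_form_map \<omega>\<^sub>0 \<gamma> = normal_form_map \<omega>\<^sub>0 \<gamma>0"
      by (simp add: normal_form_map_def eq fun_eq_iff)
    moreover have "analytically_symplectically_conjugate f (normal_form_map \<omega>\<^sub>0 \<gamma>0)"
      unfolding analytically_symplectically_conjugate_def
      using \<phi> \<psi> inv conj ra_imp_real_analytic_at by blast
    ultimately show ?thesis by simp
  qed
  with ex show ?thesis by blast
qed

end
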